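(* Let $k$ be a field of characteristic $p>0$, let $V$ be a finite-dimensional $k$-vector space, and let $m$ be a positive integer divisible by $p$. Let $N_m(V)$ be the cochain complex with $N_m(V)^i=S_{(m-i,1^i)}(V)$ for $0\le i\le m-1$, $$0\to S_m(V)\to S_{(m-1,1)}(V)\to\cdots\to S_{(m-i,1^i)}(V)\to\cdots\to\bigwedge^m V\to 0,$$ with differentials induced by the map $\phi$ defined in the context. Then for every $i\ge 0$ there is a $\mathrm{GL}(V)$-equivariant isomorphism $$H^i(N_m(V))\cong F^pS_{(m/p-i,1^i)}(V).$$
   Context: Koszul maps and hook Schur modules: for a finite-dimensional vector space $V$, let $\kappa_{a,b}:\bigwedge^bV\otimes S_a(V)\to\bigwedge^{b-1}V\otimes S_{a+1}(V)$ be the Koszul map, i.e. the composition of exterior comultiplication $\bigwedge^bV\to\bigwedge^{b-1}V\otimes V$ with symmetric multiplication $V\otimes S_a(V)\to S_{a+1}(V)$. For $a\ge1$, $b\ge0$ the Schur module of the hook partition $(a,1^b)$ is $$S_{(a,1^b)}(V)=\ker\kappa_{a,b}=\operatorname{im}\kappa_{a-1,b+1}\cong\operatorname{coker}\kappa_{a-2,b+2},$$ so that $S_{(a,1^b)}(V)$ is a quotient of $\bigwedge^{b+1}V\otimes S_{a-1}(V)$; thus $S_{(a)}(V)=S_a(V)$ and $S_{(1^b)}(V)=\bigwedge^bV$. Convention: $S_{(a,1^b)}(V)=0$ for $a\le 0$. The map $\phi$: let $v_1,\dots,v_n$ be a basis of $V$; for $I=(\ell_1<\cdots<\ell_r)$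 write $v_I=v_{\ell_1}\wedge\cdots\wedge v_{\ell_r}$, for an exponent vector $\alpha$ write $v^\alpha=v_1^{\alpha_1}\cdots v_n^{\alpha_n}$, and let $\epsilon_t$ be the $t$-th standard vector. The map $\phi:\bigwedge^rV\otimes S_j(V)\to\bigwedge^{r+1}V\otimes S_{j-1}(V)$ is symmetric comultiplication $S_j(V)\to V\otimes S_{j-1}(V)$ followed by exterior multiplication, i.e. $\phi(v_I\otimes v^\alpha)=\sum_{t=1}^n\alpha_t\,v_I\wedge v_t\otimes v^{\alpha-\epsilon_t}$. When $k$ has characteristic $p$ and $p\mid m$, $\phi$ descends to the quotients to give maps $S_{(m-i,1^i)}(V)\to S_{(m-i-1,1^{i+1})}(V)$ whose consecutive compositions vanish; these are the differentials of $N_m(V)$. Frobenius twist: for a hook Schur module $W=S_{(a,1^b)}(V)$, $F^pW$ denotes its Frobenius twist, i.e. $W\otimes_{k,\,x\mapsto x^p}k$ with the induced $\mathrm{GL}(V)$-action, so that $F^p(\lambda w)=\lambda^pF^p(w)$ and $g\cdot F^p(w)=F^p(g\cdot w)$ for $\lambda\in k$, $w\in W$, $g\in\mathrm{GL}(V)$. In particular $F^pV\cong\operatorname{Span}_k\{v_1^p,\dots,v_n^p\}\subset S_p(V)$. *)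

theory Defs
  imports
    "HOL-Library.Poly_Mapping"
    "HOL-Computational_Algebra.Computational_Algebra"
begin

section \<open>Representations, subrepresentations and quotients\<close>

text \<open>
  A vector space over \<open>'k\<close>, given by an explicit carrier, together with an action of the operators
  of type \<open>'g\<close>.  The quotient by \<open>B\<close> has the cosets of \<open>B\<close> as elements.
\<close>

record ('k, 'g, 'w) rep =
  carr :: "'w set"
  zer :: "'w"
  add :: "'w \<Rightarrow> 'w \<Rightarrow> 'w"
  scl :: "'k \<Rightarrow> 'w \<Rightarrow> 'w"
  act :: "'g \<Rightarrow> 'w \<Rightarrow> 'w"

definition sub_rep :: "('k, 'g, 'w) rep \<Rightarrow> 'w set \<Rightarrow> ('k, 'g, 'w) rep" where
  "sub_rep M Z = M\<lparr>carr := Z\<rparr>"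

definition coset :: "('k, 'g, 'w) rep \<Rightarrow> 'w set \<Rightarrow> 'w \<Rightarrow> 'w set" where
  "coset M B x = {add M x b | b. b \<in> B}"

definition quot_rep :: "('k, 'g, 'w) rep \<Rightarrow> 'w set \<Rightarrow> ('k, 'g, 'w set) rep" where
  "quot_rep M B =
    \<lparr>carr = coset M B ` carr M,
     zer = B,
     add = (\<lambda>X Y. {add M x y | x y. x \<in> X \<and> y \<in> Y}),
     scl = (\<lambda>c X. \<Union>x\<in>X. coset M B (scl M c x)),
     act = (\<lambda>g X. \<Union>x\<in>X. coset M B (act M g x))\<rparr>"

text \<open>The map induced by \<open>f\<close> on a quotient of its domain, with values in \<open>quot_rep N B\<close>.\<close>

definition induced_map :: "('k, 'g, 'w) rep \<Rightarrow> 'w set \<Rightarrow> ('u \<Rightarrow> 'w) \<Rightarrow> 'u set \<Rightarrow> 'w set" where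
  "induced_map N B f X = (\<Union>x\<in>X. coset N B (f x))"

definition rep_iso ::
  "'g set \<Rightarrow> ('k, 'g, 'u) rep \<Rightarrow> ('k, 'g, 'w) rep \<Rightarrow> ('u \<Rightarrow> 'w) \<Rightarrow> bool" where
  "rep_iso G M N f \<longleftrightarrow>
     bij_betw f (carr M) (carr N) \<and>
     (\<forall>x\<in>carr M. \<forall>y\<in>carr M. f (add M x y) = add N (f x) (f y)) \<and>
     (\<forall>c. \<forall>x\<in>carr M. f (scl M c x) = scl N c (f x)) \<and>
     (\<forall>g\<in>G. \<forall>x\<in>carr M. f (act M g x) = act N g (f x))"

definition rep_isomorphic :: "'g set \<Rightarrow> ('k, 'g, 'u) rep \<Rightarrow> ('k, 'g, 'w) rep \<Rightarrow> bool" where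
  "rep_isomorphic G M N \<longleftrightarrow> (\<exists>f. rep_iso G M N f)"

definition GL :: "('k::field \<Rightarrow> 'v::ab_group_add \<Rightarrow> 'v) \<Rightarrow> ('v \<Rightarrow> 'v) set" where
  "GL scale = {g. Vector_Spaces.linear scale scale g \<and> bij g}"

definition cohomology ::
  "(int \<Rightarrow> ('k, 'g, 'w) rep) \<Rightarrow> (int \<Rightarrow> 'w \<Rightarrow> 'w) \<Rightarrow> int \<Rightarrow> ('k, 'g, 'w set) rep" where
  "cohomology C d i =
     quot_rep (sub_rep (C i) {x \<in> carr (C i). d i x = zer (C (i + 1))})
              (d (i - 1) ` carr (C (i - 1)))"


section \<open>Free vector spaces\<close>

definition fscale :: "'k::field \<Rightarrow> ('a \<Rightarrow>\<^sub>0 'k) \<Rightarrow> ('a \<Rightarrow>\<^sub>0 'k)" where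
  "fscale c = Poly_Mapping.map ((*) c)"

lemma lookup_fscale: "Poly_Mapping.lookup (fscale c f) x = c * Poly_Mapping.lookup f x"
  by (simp add: fscale_def Poly_Mapping.map.rep_eq when_def)

global_interpretation free: vector_space "fscale :: 'k::field \<Rightarrow> ('a \<Rightarrow>\<^sub>0 'k) \<Rightarrow> _"
  defines fspan = "module.span (fscale :: 'k::field \<Rightarrow> ('a \<Rightarrow>\<^sub>0 'k) \<Rightarrow> _)"
  by unfold_locales
    (simp_all add: poly_mapping_eq_iff fun_eq_iff lookup_fscale lookup_add algebra_simps)

text \<open>Linear extension of a map given on basis elements.\<close>

definition lin_ext :: "('a \<Rightarrow> ('b \<Rightarrow>\<^sub>0 'k::field)) \<Rightarrow> ('a \<Rightarrow>\<^sub>0 'k) \<Rightarrow> ('b \<Rightarrow>\<^sub>0 'k)" where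
  "lin_ext h f = (\<Sum>x\<in>Poly_Mapping.keys f. fscale (Poly_Mapping.lookup f x) (h x))"

abbreviation basis_vec :: "'a \<Rightarrow> ('a \<Rightarrow>\<^sub>0 'k::field)" where
  "basis_vec x \<equiv> Poly_Mapping.single x 1"

definition free_rep :: "'a set \<Rightarrow> ('g \<Rightarrow> 'a \<Rightarrow> 'a) \<Rightarrow> ('k::field, 'g, 'a \<Rightarrow>\<^sub>0 'k) rep" where
  "free_rep A \<alpha> =
    \<lparr>carr = {f. Poly_Mapping.keys f \<subseteq> A},
     zer = 0,
     add = (+),
     scl = fscale,
     act = (\<lambda>g. lin_ext (\<lambda>x. basis_vec (\<alpha> g x)))\<rparr>"


section \<open>The spaces \<open>\<Lambda>\<^sup>bV \<otimes> S\<^sub>a(V)\<close>\<close>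

text \<open>
  The pair \<open>(xs, ys)\<close> stands for the tensor of the exterior product of the vectors in \<open>xs\<close> with
  the symmetric product of the vectors in \<open>ys\<close>.  The space is the one generated by these symbols,
  with \<open>length xs = b\<close> and \<open>length ys = a\<close>, subject to multilinearity in all entries,
  alternation in \<open>xs\<close> and symmetry in \<open>ys\<close>; that is, it represents the maps that are
  multilinear, alternating in the first \<open>b\<close> and symmetric in the last \<open>a\<close> arguments.
  The degrees are integers, so that the space is zero if one of them is negative.
\<close>

definition symbols :: "int \<Rightarrow> int \<Rightarrow> ('v list \<times> 'v list) set" where
  "symbols b a = {(xs, ys). int (length xs) = b \<and> int (length ys) = a}"

inductive_set ext_sym_relators ::
  "('k::field \<Rightarrow> 'v::ab_group_add \<Rightarrow> 'v) \<Rightarrow> int \<Rightarrow> int \<Rightarrow> ('v list \<times> 'v list \<Rightarrow>\<^sub>0 'k) set"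
  for scale b a where
  ext_add: "(xs @ u # xs', ys) \<in> symbols b a \<Longrightarrow>
    basis_vec (xs @ (u + v) # xs', ys) - basis_vec (xs @ u # xs', ys)
      - basis_vec (xs @ v # xs', ys) \<in> ext_sym_relators scale b a"
| ext_scale: "(xs @ u # xs', ys) \<in> symbols b a \<Longrightarrow>
    basis_vec (xs @ scale c u # xs', ys) - fscale c (basis_vec (xs @ u # xs', ys))
      \<in> ext_sym_relators scale b a"
| ext_alt: "(xs @ u # xs' @ u # xs'', ys) \<in> symbols b a \<Longrightarrow>
    basis_vec (xs @ u # xs' @ u # xs'', ys) \<in> ext_sym_relators scale b a"
| sym_add: "(xs, ys @ u # ys') \<in> symbols b a \<Longrightarrow>
    basis_vec (xs, ys @ (u + v) # ys') - basis_vec (xs, ys @ u # ys')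
      - basis_vec (xs, ys @ v # ys') \<in> ext_sym_relators scale b a"
| sym_scale: "(xs, ys @ u # ys') \<in> symbols b a \<Longrightarrow>
    basis_vec (xs, ys @ scale c u # ys') - fscale c (basis_vec (xs, ys @ u # ys'))
      \<in> ext_sym_relators scale b a"
| sym_perm: "(xs, ys) \<in> symbols b a \<Longrightarrow> mset ys' = mset ys \<Longrightarrow>
    basis_vec (xs, ys) - basis_vec (xs, ys') \<in> ext_sym_relators scale b a"

definition ext_sym_rel ::
  "('k::field \<Rightarrow> 'v::ab_group_add \<Rightarrow> 'v) \<Rightarrow> int \<Rightarrow> int \<Rightarrow> ('v list \<times> 'v list \<Rightarrow>\<^sub>0 'k) set" where
  "ext_sym_rel scale b a = fspan (ext_sym_relators scale b a)"

definition symbol_rep :: "int \<Rightarrow> int \<Rightarrow> ('k::field, 'v \<Rightarrow> 'v, 'v list \<times> 'v list \<Rightarrow>\<^sub>0 'k) rep" where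
  "symbol_rep b a = free_rep (symbols b a) (\<lambda>g (xs, ys). (map g xs, map g ys))"

definition ext_sym ::
  "('k::field \<Rightarrow> 'v::ab_group_add \<Rightarrow> 'v) \<Rightarrow> int \<Rightarrow> int \<Rightarrow>
    ('k, 'v \<Rightarrow> 'v, ('v list \<times> 'v list \<Rightarrow>\<^sub>0 'k) set) rep" where
  "ext_sym scale b a = quot_rep (symbol_rep b a) (ext_sym_rel scale b a)"


section \<open>The Koszul maps and the maps \<open>\<phi>\<close>\<close>

definition remove_nth :: "nat \<Rightarrow> 'a list \<Rightarrow> 'a list" where
  "remove_nth i xs = take i xs @ drop (Suc i) xs"

text \<open>
  The sign of the \<open>i\<close>-th summand of the comultiplication \<open>\<Lambda>\<^sup>bV \<rightarrow> \<Lambda>\<^sup>b\<^sup>-\<^sup>1V \<otimes> V\<close> is that of the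
  permutation moving the \<open>i\<close>-th factor to the last position.
\<close>

definition koszul_symbol :: "'v list \<times> 'v list \<Rightarrow> ('v list \<times> 'v list \<Rightarrow>\<^sub>0 'k::field)" where
  "koszul_symbol = (\<lambda>(xs, ys). \<Sum>i<length xs.
     fscale ((- 1) ^ (length xs - 1 - i)) (basis_vec (remove_nth i xs, xs ! i # ys)))"

definition phi_symbol :: "'v list \<times> 'v list \<Rightarrow> ('v list \<times> 'v list \<Rightarrow>\<^sub>0 'k::field)" where
  "phi_symbol = (\<lambda>(xs, ys). \<Sum>i<length ys. basis_vec (xs @ [ys ! i], remove_nth i ys))"

text \<open>\<open>koszul scale a b\<close> goes from \<open>ext_sym scale b a\<close> to \<open>ext_sym scale (b - 1) (a + 1)\<close>.\<close>

definition koszul ::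
  "('k::field \<Rightarrow> 'v::ab_group_add \<Rightarrow> 'v) \<Rightarrow> int \<Rightarrow> int \<Rightarrow>
    ('v list \<times> 'v list \<Rightarrow>\<^sub>0 'k) set \<Rightarrow> ('v list \<times> 'v list \<Rightarrow>\<^sub>0 'k) set" where
  "koszul scale a b = induced_map (symbol_rep (b - 1) (a + 1)) (ext_sym_rel scale (b - 1) (a + 1))
     (lin_ext koszul_symbol)"

text \<open>\<open>phi scale r j\<close> goes from \<open>ext_sym scale r j\<close> to \<open>ext_sym scale (r + 1) (j - 1)\<close>.\<close>

definition phi ::
  "('k::field \<Rightarrow> 'v::ab_group_add \<Rightarrow> 'v) \<Rightarrow> int \<Rightarrow> int \<Rightarrow>
    ('v list \<times> 'v list \<Rightarrow>\<^sub>0 'k) set \<Rightarrow> ('v list \<times> 'v list \<Rightarrow>\<^sub>0 'k) set" where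
  "phi scale r j = induced_map (symbol_rep (r + 1) (j - 1)) (ext_sym_rel scale (r + 1) (j - 1))
     (lin_ext phi_symbol)"


section \<open>Hook Schur modules and the complex \<open>N\<^sub>m(V)\<close>\<close>

text \<open>\<open>hook scale a b\<close> is the Schur module of the hook \<open>(a, 1\<^sup>b)\<close>.\<close>

definition hook ::
  "('k::field \<Rightarrow> 'v::ab_group_add \<Rightarrow> 'v) \<Rightarrow> int \<Rightarrow> int \<Rightarrow>
    ('k, 'v \<Rightarrow> 'v, ('v list \<times> 'v list \<Rightarrow>\<^sub>0 'k) set) rep" where
  "hook scale a b = sub_rep (ext_sym scale b a)
     (if a \<le> 0 then {zer (ext_sym scale b a)}
      else {X \<in> carr (ext_sym scale b a).
              koszul scale a b X = zer (ext_sym scale (b - 1) (a + 1))})"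

definition N_module ::
  "('k::field \<Rightarrow> 'v::ab_group_add \<Rightarrow> 'v) \<Rightarrow> nat \<Rightarrow> int \<Rightarrow>
    ('k, 'v \<Rightarrow> 'v, ('v list \<times> 'v list \<Rightarrow>\<^sub>0 'k) set) rep" where
  "N_module scale m i = hook scale (int m - i) i"

text \<open>
  The module \<open>hook scale a b\<close> is a quotient of \<open>ext_sym scale (b + 1) (a - 1)\<close> by means of the
  Koszul map \<open>koszul scale (a - 1) (b + 1)\<close>.  The differential is the map on these quotients
  induced by \<open>phi\<close>: if \<open>X\<close> is the image of \<open>Y\<close>, then \<open>X\<close> is sent to the image of \<open>phi Y\<close>.
\<close>

definition N_diff ::
  "('k::field \<Rightarrow> 'v::ab_group_add \<Rightarrow> 'v) \<Rightarrow> nat \<Rightarrow> int \<Rightarrow>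
    ('v list \<times> 'v list \<Rightarrow>\<^sub>0 'k) set \<Rightarrow> ('v list \<times> 'v list \<Rightarrow>\<^sub>0 'k) set" where
  "N_diff scale m i X = (THE Z. \<exists>Y\<in>carr (ext_sym scale (i + 1) (int m - i - 1)).
     X = koszul scale (int m - i - 1) (i + 1) Y \<and>
     Z = koszul scale (int m - i - 2) (i + 2) (phi scale (i + 1) (int m - i - 1) Y))"


section \<open>Frobenius twist\<close>

text \<open>
  The tensor product of \<open>M\<close> with \<open>'k\<close> along \<open>x \<mapsto> x\<^sup>p\<close>: the free vector space on the symbols
  \<open>F\<^sup>p w\<close>, \<open>w \<in> carr M\<close>, modulo \<open>F\<^sup>p (w + w') = F\<^sup>p w + F\<^sup>p w'\<close> and \<open>F\<^sup>p (c w) = c\<^sup>p F\<^sup>p w\<close>.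
  The field is not assumed to be perfect, so \<open>F\<^sup>p\<close> need not be surjective.
\<close>

definition frobenius_twist ::
  "nat \<Rightarrow> ('k::field, 'g, 'w) rep \<Rightarrow> ('k, 'g, ('w \<Rightarrow>\<^sub>0 'k) set) rep" where
  "frobenius_twist p M = quot_rep (free_rep (carr M) (act M))
     (fspan
       ({basis_vec (add M w w') - basis_vec w - basis_vec w' | w w'. w \<in> carr M \<and> w' \<in> carr M}
        \<union> {basis_vec (scl M c w) - fscale (c ^ p) (basis_vec w) | c w. w \<in> carr M}))"

end

theory Submission
  imports Defs
begin

text \<open>
  Fix a basis \<open>v\<^sub>0, \<dots>, v\<^sub>n\<^sub>-\<^sub>1\<close> of \<open>V\<close> and give the basis vector \<open>v\<^sub>I \<otimes> v\<^sup>\<alpha>\<close> of \<open>\<Lambda>V \<otimes> SV\<close> the weight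
  \<open>\<beta> = \<alpha> + 1\<^sub>I\<close>.  Reading \<open>\<Lambda>V \<otimes> SV\<close> as polynomial differential forms, \<open>\<phi>\<close> is the de Rham
  differential and the Koszul map \<open>\<kappa>\<close> is the contraction with the Euler vector field.  Both preserve
  the weight.  The part of weight \<open>\<beta>\<close> has a basis indexed by the subsets \<open>I\<close> of the support of
  \<open>\<beta>\<close>; there \<open>\<phi>\<close> is the exterior product with \<open>\<Sum>\<^sub>t \<beta>\<^sub>t v\<^sub>t\<close>, and \<open>\<kappa>\<close> is the contraction with the sum of
  the dual basis vectors.  The Clifford relations then give everything that is needed.

  \<^item> \<open>\<kappa>\<phi> + \<phi>\<kappa>\<close> is multiplication by \<open>\<Sum>\<^sub>t \<beta>\<^sub>t\<close>, which is \<open>m = 0\<close> in \<open>k\<close>.  As the differential of \<open>N\<^sub>m(V)\<close> sends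
    \<open>\<kappa>Y\<close> to \<open>\<kappa>\<phi>Y\<close>, it is the restriction of \<open>-\<phi>\<close> to \<open>ker \<kappa>\<close> (\<open>coord_form_N_diff\<close>).
  \<^item> If \<open>\<beta> \<noteq> 0\<close>, then \<open>v\<^sub>t \<and> _\<close> is a contracting homotopy for \<open>\<kappa>\<close>, where \<open>t\<close> is any index in the
    support of \<open>\<beta>\<close>.  So the Koszul complex is exact in positive degrees (\<open>cycles_exact\<close>).
  \<^item> If some \<open>\<beta>\<^sub>t\<close> is nonzero in \<open>k\<close>, then \<open>\<beta>\<^sub>t\<^sup>-\<^sup>1\<close> times the contraction with \<open>v\<^sub>t\<^sup>*\<close> is a contracting
    homotopy for \<open>\<phi>\<close>.  It anticommutes with \<open>\<kappa>\<close>, another contraction, so that it preserves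
    \<open>ker \<kappa>\<close>.  Hence only the weights \<open>\<beta> = p\<gamma>\<close> contribute to the cohomology of \<open>ker \<kappa>\<close>; there \<open>\<phi>\<close>
    vanishes.  The Cartier operator divides these weights by \<open>p\<close>, and it identifies the cohomology
    with \<open>ker \<kappa>\<close> in total degree \<open>m/p\<close> (\<open>cohomology_models\<close>).
  \<^item> The space \<open>ker \<kappa>\<close> is spanned by the images under \<open>\<kappa>\<close> of basis vectors, whose coordinates lie in
    the prime field.  So raising coordinates to the \<open>p\<close>-th power identifies the Frobenius twist of
    \<open>ker \<kappa>\<close> with \<open>ker \<kappa>\<close> itself, whether or not \<open>k\<close> is perfect (\<open>twist_models\<close>).

  The Cartier operator depends on the basis, and equivariance is a separate point.  The inverse of
  the Cartier isomorphism is given on symbols by a formula without coordinates, which sends a factor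
  \<open>y\<close> of the symmetric part to \<open>y\<^sup>p\<close> and a factor \<open>dx\<close> of the exterior part to \<open>x\<^sup>p\<^sup>-\<^sup>1 dx\<close>
  (\<open>cartier_inv_cartier_symbol\<close>).  It follows that the group acts in the same way on both sides
  (\<open>cartier_gl\<close>, \<open>frob_gl\<close>).
\<close>

section \<open>Linear maps between free vector spaces\<close>

abbreviation lin :: "(('a \<Rightarrow>\<^sub>0 'k::field) \<Rightarrow> ('b \<Rightarrow>\<^sub>0 'k)) \<Rightarrow> bool" where
  "lin \<equiv> Vector_Spaces.linear fscale fscale"

named_theorems lin_intros

lemma linI:
  assumes "\<And>x y. A (x + y) = A x + A y" "\<And>c x. A (fscale c x) = fscale c (A x)"
  shows "lin A"
  using assms
  by (simp add: Vector_Spaces.linear_def module_hom_iff free.vector_space_axioms free.module_axioms)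

lemma linear_iff_lin:
  "lin A \<longleftrightarrow> (\<forall>x y. A (x + y) = A x + A y) \<and> (\<forall>c x. A (fscale c x) = fscale c (A x))"
  by (auto simp: Vector_Spaces.linear_def module_hom_iff free.vector_space_axioms free.module_axioms)

lemma lin_add: "lin A \<Longrightarrow> A (x + y) = A x + A y"
  and lin_fscale: "lin A \<Longrightarrow> A (fscale c x) = fscale c (A x)"
  by (simp_all add: Vector_Spaces.linear_def module_hom_iff)

lemma lin_zero: "lin A \<Longrightarrow> A 0 = 0"
  using lin_add[of A 0 0] by simp

lemma lin_uminus: "lin A \<Longrightarrow> A (- x) = - A x"
  using lin_add[of A x "- x"] lin_zero[of A] by (simp add: eq_neg_iff_add_eq_0 add.commute)

lemma lin_diff: "lin A \<Longrightarrow> A (x - y) = A x - A y"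
  using lin_add[of A x "- y"] lin_uminus[of A y] by simp

lemma lin_sum: "lin A \<Longrightarrow> A (\<Sum>i\<in>S. f i) = (\<Sum>i\<in>S. A (f i))"
  by (induction S rule: infinite_finite_induct) (simp_all add: lin_zero lin_add)

lemmas lin_simps = lin_add lin_fscale lin_zero lin_uminus lin_diff lin_sum

lemma lin_id [lin_intros]: "lin (\<lambda>x. x)"
  by (rule linI) auto

lemma lin_plus_fun [lin_intros]: "lin A \<Longrightarrow> lin B \<Longrightarrow> lin (\<lambda>x. A x + B x)"
  and lin_diff_fun [lin_intros]: "lin A \<Longrightarrow> lin B \<Longrightarrow> lin (\<lambda>x. A x - B x)"
  and lin_uminus_fun [lin_intros]: "lin A \<Longrightarrow> lin (\<lambda>x. - A x)"
  and lin_fscale_fun [lin_intros]: "lin A \<Longrightarrow> lin (\<lambda>x. fscale c (A x))"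
  by (rule linI; simp add: lin_simps free.scale_right_distrib free.scale_right_diff_distrib
      mult.commute)+

lemma lin_zero_fun [lin_intros]: "lin (\<lambda>x. 0)"
  by (rule linI) auto

lemma lin_sum_fun [lin_intros]: "(\<And>i. i \<in> S \<Longrightarrow> lin (A i)) \<Longrightarrow> lin (\<lambda>x. \<Sum>i\<in>S. A i x)"
  by (rule linI) (simp_all add: lin_simps sum.distrib free.scale_sum_right)

lemma lin_if_fun [lin_intros]: "lin A \<Longrightarrow> lin B \<Longrightarrow> lin (\<lambda>x. if P then A x else B x)"
  by (cases P) simp_all

lemma lin_funpow [lin_intros]: "lin A \<Longrightarrow> lin B \<Longrightarrow> lin (\<lambda>x. (A ^^ k) (B x))"
  for A :: "('a \<Rightarrow>\<^sub>0 'k::field) \<Rightarrow> ('a \<Rightarrow>\<^sub>0 'k)"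
  by (induction k) (simp_all add: linear_iff_lin)

lemma lin_ext_superset:
  assumes "finite S" "Poly_Mapping.keys f \<subseteq> S"
  shows "lin_ext h f = (\<Sum>x\<in>S. fscale (Poly_Mapping.lookup f x) (h x))"
  unfolding lin_ext_def using assms
  by (intro sum.mono_neutral_left) (auto simp: in_keys_iff)

lemma lin_lin_ext: "lin (lin_ext h)" for h :: "'a \<Rightarrow> ('b \<Rightarrow>\<^sub>0 'k::field)"
proof (rule linI)
  fix x y :: "'a \<Rightarrow>\<^sub>0 'k" and c :: 'k
  let ?S = "Poly_Mapping.keys x \<union> Poly_Mapping.keys y"
  show "lin_ext h (x + y) = lin_ext h x + lin_ext h y"
    using keys_add[of x y]
    by (simp add: lin_ext_superset[of ?S] lookup_add free.scale_left_distrib sum.distrib)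
  have "Poly_Mapping.keys (fscale c x) \<subseteq> Poly_Mapping.keys x"
    by (auto simp: in_keys_iff lookup_fscale)
  then show "lin_ext h (fscale c x) = fscale c (lin_ext h x)"
    by (simp add: lin_ext_superset[of "Poly_Mapping.keys x"] lookup_fscale free.scale_sum_right)
qed

lemma lin_lin_ext_comp [lin_intros]: "lin B \<Longrightarrow> lin (\<lambda>x. lin_ext h (B x))"
  by (rule linI) (simp_all add: lin_simps lin_lin_ext)

lemma lin_ext_basis [simp]: "lin_ext h (basis_vec x) = h x"
  by (simp add: lin_ext_def)

lemma lin_ext_zero [simp]: "lin_ext h 0 = 0"
  by (simp add: lin_ext_def)

lemma basis_expansion:
  "f = (\<Sum>x\<in>Poly_Mapping.keys f. fscale (Poly_Mapping.lookup f x) (basis_vec x))"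
proof -
  have "Poly_Mapping.lookup (\<Sum>x\<in>Poly_Mapping.keys f. fscale (Poly_Mapping.lookup f x) (basis_vec x)) y
      = Poly_Mapping.lookup f y" for y
    by (simp add: lookup_sum lookup_fscale lookup_single when_def sum.delta in_keys_iff
        if_distrib[of "(*) _"] cong: if_cong)
  then show ?thesis by (metis poly_mapping_eqI)
qed

lemma lin_eqI:
  assumes "lin A" "lin B" "\<And>x. x \<in> Poly_Mapping.keys f \<Longrightarrow> A (basis_vec x) = B (basis_vec x)"
  shows "A f = B f"
  by (subst (1 2) basis_expansion[of f]) (use assms in \<open>simp add: lin_simps\<close>)

lemma mem_subspace_if_basis:
  assumes "free.subspace S" "\<And>x. x \<in> Poly_Mapping.keys f \<Longrightarrow> basis_vec x \<in> S"
  shows "f \<in> S"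
  by (subst basis_expansion)
     (intro free.subspace_sum[OF assms(1)] free.subspace_scale[OF assms(1)] assms(2))

lemma subspace_keys: "free.subspace {f. Poly_Mapping.keys f \<subseteq> A}"
  unfolding free.subspace_def
  by (auto simp: in_keys_iff lookup_fscale lookup_add subset_iff) (metis add.right_neutral)

lemma keys_add_subset:
  "Poly_Mapping.keys x \<subseteq> A \<Longrightarrow> Poly_Mapping.keys y \<subseteq> A \<Longrightarrow> Poly_Mapping.keys (x + y) \<subseteq> A"
  for x y :: "'a \<Rightarrow>\<^sub>0 'k::field"
  using free.subspace_add[OF subspace_keys[of A], of x y] by simp

lemma keys_fscale_subset: "Poly_Mapping.keys x \<subseteq> A \<Longrightarrow> Poly_Mapping.keys (fscale c x) \<subseteq> A"
  using free.subspace_scale[OF subspace_keys[of A], of x c] by simp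

lemma lin_in_subspace:
  assumes "lin A" "free.subspace S" "\<And>x. x \<in> Poly_Mapping.keys f \<Longrightarrow> A (basis_vec x) \<in> S"
  shows "A f \<in> S"
proof -
  have "A f = (\<Sum>x\<in>Poly_Mapping.keys f. fscale (Poly_Mapping.lookup f x) (A (basis_vec x)))"
    by (subst basis_expansion[of f]) (simp add: lin_simps assms(1))
  then show ?thesis using assms by (auto intro!: free.subspace_sum free.subspace_scale)
qed

section \<open>Creation and annihilation operators on weighted forms\<close>

text \<open>
  The basis element \<open>(I, \<beta>)\<close> stands for \<open>v\<^sub>I \<otimes> v\<^sup>\<alpha>\<close> with \<open>\<alpha> = \<beta> - 1\<^sub>I\<close>.  Recording the total weight \<open>\<beta>\<close>
  instead of the exponent vector makes the Koszul map and \<open>\<phi>\<close> act on the set \<open>I\<close> alone.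
\<close>

type_synonym 'k wform = "(nat set \<times> (nat \<Rightarrow> nat)) \<Rightarrow>\<^sub>0 'k"

text \<open>
  The sign of the left exterior product with \<open>v\<^sub>t\<close>.  Counting the elements below \<open>t\<close>, the relations
  hold for every set \<open>I\<close>, finite or not.
\<close>

definition wsign :: "nat set \<Rightarrow> nat \<Rightarrow> 'k::field" where
  "wsign I t = (-1) ^ card {s\<in>I. s < t}"

definition mulx :: "nat \<Rightarrow> 'k::field wform \<Rightarrow> 'k wform" where
  "mulx t = lin_ext (\<lambda>(I, \<beta>). basis_vec (I, \<beta>(t := Suc (\<beta> t))))"

definition wedge :: "nat \<Rightarrow> 'k::field wform \<Rightarrow> 'k wform" where
  "wedge t = lin_ext (\<lambda>(I, \<beta>).
     if t \<in> I then 0 else fscale (wsign I t) (basis_vec (insert t I, \<beta>)))"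

definition contr :: "nat \<Rightarrow> 'k::field wform \<Rightarrow> 'k wform" where
  "contr t = lin_ext (\<lambda>(I, \<beta>).
     if t \<in> I then fscale (wsign I t) (basis_vec (I - {t}, \<beta>)) else 0)"

definition euler :: "nat \<Rightarrow> 'k::field wform \<Rightarrow> 'k wform" where
  "euler t = lin_ext (\<lambda>(I, \<beta>). fscale (of_nat (\<beta> t)) (basis_vec (I, \<beta>)))"

lemma lin_ops [lin_intros]:
  "lin A \<Longrightarrow> lin (\<lambda>x. mulx t (A x))" "lin A \<Longrightarrow> lin (\<lambda>x. wedge t (A x))"
  "lin A \<Longrightarrow> lin (\<lambda>x. contr t (A x))" "lin A \<Longrightarrow> lin (\<lambda>x. euler t (A x))"
  unfolding mulx_def wedge_def contr_def euler_def by (simp_all add: lin_intros)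

lemma lin_ops' [lin_intros]: "lin (mulx t)" "lin (wedge t)" "lin (contr t)" "lin (euler t)"
  using lin_ops[OF lin_id] by auto

lemma basis_ops [simp]:
  "mulx t (basis_vec (I, \<beta>)) = basis_vec (I, \<beta>(t := Suc (\<beta> t)))"
  "wedge t (basis_vec (I, \<beta>)) = (if t \<in> I then 0 else fscale (wsign I t) (basis_vec (insert t I, \<beta>)))"
  "contr t (basis_vec (I, \<beta>)) = (if t \<in> I then fscale (wsign I t) (basis_vec (I - {t}, \<beta>)) else 0)"
  "euler t (basis_vec (I, \<beta>)) = fscale (of_nat (\<beta> t)) (basis_vec (I, \<beta>))"
  by (simp_all add: mulx_def wedge_def contr_def euler_def)

lemmas ops_simps [simp] =
  lin_simps[OF lin_ops'(1)] lin_simps[OF lin_ops'(2)] lin_simps[OF lin_ops'(3)]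
  lin_simps[OF lin_ops'(4)]

lemma wsign_sq [simp]: "wsign I t * wsign I t = 1" "wsign I t * (wsign I t * c) = c"
  by (simp_all add: wsign_def flip: mult.assoc power_mult_distrib)

lemma wsign_insert:
  "s \<notin> I \<Longrightarrow> wsign (insert s I) t = (if s < t then - wsign I t else wsign I t)"
proof -
  assume "s \<notin> I"
  moreover have "{r \<in> insert s I. r < t} = (if s < t then insert s {r\<in>I. r < t} else {r\<in>I. r < t})"
    by auto
  ultimately show ?thesis by (simp add: wsign_def)
qed

lemma wsign_remove:
  assumes "s \<in> I"
  shows "wsign (I - {s}) t = (if s < t then - wsign I t else wsign I t :: 'k::field)"
proof -
  have "(wsign I t :: 'k) = (if s < t then - wsign (I - {s}) t else wsign (I - {s}) t)"
    using wsign_insert[of s "I - {s}" t, where ?'a = 'k] assms by (simp add: insert_absorb)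
  then show ?thesis by simp
qed

text \<open>
  The relations of the Clifford algebra (for \<open>wedge\<close> and \<open>contr\<close>) and of the Weyl algebra (for \<open>mulx\<close>
  and \<open>euler\<close>).  All later computations with forms rest on them.
\<close>

lemma mulx_mulx: "mulx s (mulx t f) = mulx t (mulx s f)"
  by (rule lin_eqI[where f = f]; (intro lin_intros)?; cases "s = t"; auto simp: fun_upd_twist)

lemma wedge_mulx: "wedge s (mulx t f) = mulx t (wedge s f)"
  and contr_mulx: "contr s (mulx t f) = mulx t (contr s f)"
  and euler_wedge: "euler s (wedge t f) = wedge t (euler s f)"
  and euler_contr: "euler s (contr t f) = contr t (euler s f)"
  by (rule lin_eqI[where f = f]; (intro lin_intros)?; auto simp: mult.commute)+

lemma euler_mulx: "euler s (mulx t f) = mulx t (euler s f) + (if s = t then mulx t f else 0)"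
  by (rule lin_eqI[where f = f]; (intro lin_intros)?; auto simp: free.scale_left_distrib)

lemma wedge_anticomm: "wedge s (wedge t f) = - wedge t (wedge s f)"
  by (rule lin_eqI[where f = f]; (intro lin_intros)?; auto simp: wsign_insert insert_commute mult.commute)

lemma wedge_wedge_self [simp]: "wedge t (wedge t f) = 0"
  by (rule lin_eqI[where f = f]; (intro lin_intros)?; auto)

lemma contr_anticomm: "contr s (contr t f) = - contr t (contr s f)"
  by (rule lin_eqI[where f = f]; (intro lin_intros)?; auto simp: wsign_remove mult.commute Diff_insert2[symmetric] insert_commute)

lemma contr_wedge: "contr s (wedge t f) = (if s = t then f else 0) - wedge t (contr s f)"
  by (rule lin_eqI[where f = f]; (intro lin_intros)?; auto simp: wsign_remove wsign_insert mult.commute insert_absorb insert_Diff_if)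

section \<open>The Koszul and de Rham differentials and their homotopies\<close>

definition koszul_form :: "nat \<Rightarrow> 'k::field wform \<Rightarrow> 'k wform" where
  "koszul_form n f = (\<Sum>t<n. contr t f)"

definition deriv_form :: "nat \<Rightarrow> 'k::field wform \<Rightarrow> 'k wform" where
  "deriv_form n f = (\<Sum>t<n. wedge t (euler t f))"

lemma lin_diffs [lin_intros]:
  "lin A \<Longrightarrow> lin (\<lambda>x. koszul_form n (A x))" "lin A \<Longrightarrow> lin (\<lambda>x. deriv_form n (A x))"
  unfolding koszul_form_def deriv_form_def by (intro lin_intros | assumption)+

lemma lin_diffs' [lin_intros]: "lin (koszul_form n)" "lin (deriv_form n)"
  using lin_diffs[OF lin_id] by auto

lemmas diffs_simps [simp] = lin_simps[OF lin_diffs'(1)] lin_simps[OF lin_diffs'(2)]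

lemma koszul_form_contr: "koszul_form n (contr t f) = - contr t (koszul_form n f)"
  by (simp add: koszul_form_def sum_negf[symmetric] contr_anticomm[of t])

text \<open>
  In characteristic 2 the antisymmetry of \<open>F\<close> alone would not suffice.
\<close>

lemma alternating_double_sum:
  fixes F :: "nat \<Rightarrow> nat \<Rightarrow> 'a::ab_group_add"
  assumes "\<And>s t. F s t = - F t s" "\<And>t. F t t = 0"
  shows "(\<Sum>s<n. \<Sum>t<n. F s t) = 0"
proof (induction n)
  case (Suc n)
  have "(\<Sum>t<n. F n t) = - (\<Sum>s<n. F s n)"
    by (subst assms(1)) (simp add: sum_negf)
  then show ?case using Suc assms(2) by (simp add: sum.distrib)
qed simp

lemma contr_contr_self [simp]: "contr t (contr t f) = 0"
  by (rule lin_eqI[where f = f]; (intro lin_intros)?; auto)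

lemma euler_euler: "euler s (euler t f) = euler t (euler s f)"
  by (rule lin_eqI[where f = f]; (intro lin_intros)?; auto simp: mult.commute)

lemma koszul_koszul [simp]: "koszul_form n (koszul_form n f) = 0"
  using alternating_double_sum[of "\<lambda>s t. contr s (contr t f)" n, OF contr_anticomm]
  by (simp add: koszul_form_def)

lemma deriv_deriv [simp]: "deriv_form n (deriv_form n f) = 0"
proof -
  have "wedge s (euler s (wedge t (euler t f))) = - wedge t (euler t (wedge s (euler s f)))" for s t
    by (simp add: euler_wedge wedge_anticomm[of s t] euler_euler[of s t])
  then have "(\<Sum>s<n. \<Sum>t<n. wedge s (euler s (wedge t (euler t f)))) = 0"
    by (rule alternating_double_sum) (simp add: euler_wedge)
  then show ?thesis
    by (simp add: deriv_form_def)
qed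

text \<open>
  Cartan's formula for the Euler vector field: its Lie derivative is the degree.
\<close>

lemma koszul_deriv_basis:
  "koszul_form n (deriv_form n (basis_vec (I, \<beta>))) + deriv_form n (koszul_form n (basis_vec (I, \<beta>)))
     = fscale (of_nat (\<Sum>t<n. \<beta> t)) (basis_vec (I, \<beta>))"
proof -
  let ?e = "basis_vec (I, \<beta>)"
  have "koszul_form n (deriv_form n ?e) + deriv_form n (koszul_form n ?e) =
      (\<Sum>s<n. \<Sum>t<n. contr s (wedge t (euler t ?e))) + (\<Sum>t<n. \<Sum>s<n. wedge t (euler t (contr s ?e)))"
    by (simp add: koszul_form_def deriv_form_def del: basis_ops)
  also have "\<dots> = (\<Sum>s<n. \<Sum>t<n. contr s (wedge t (euler t ?e)) + wedge t (contr s (euler t ?e)))"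
    by (subst (2) sum.swap) (simp add: euler_contr sum.distrib del: basis_ops)
  also have "\<dots> = (\<Sum>s<n. \<Sum>t<n. if s = t then euler t ?e else 0)"
    by (simp add: contr_wedge del: basis_ops)
  also have "\<dots> = fscale (of_nat (\<Sum>t<n. \<beta> t)) ?e"
    by (simp add: free.scale_sum_left)
  finally show ?thesis .
qed

text \<open>
  The differentials preserve the weight \<open>\<beta>\<close>, so that a homotopy may be chosen separately in each
  weight.
\<close>

definition weightwise ::
    "((nat \<Rightarrow> nat) \<Rightarrow> 'k::field wform \<Rightarrow> 'k wform) \<Rightarrow> 'k wform \<Rightarrow> 'k wform" where
  "weightwise A = lin_ext (\<lambda>(I, \<beta>). A \<beta> (basis_vec (I, \<beta>)))"

lemma lin_weightwise [lin_intros]: "lin B \<Longrightarrow> lin (\<lambda>x. weightwise A (B x))"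
  and lin_weightwise' [lin_intros]: "lin (weightwise A)"
  unfolding weightwise_def by (intro lin_intros lin_lin_ext | assumption)+

lemmas weightwise_simps [simp] = lin_simps[OF lin_weightwise']

lemma weightwise_basis [simp]: "weightwise A (basis_vec (I, \<beta>)) = A \<beta> (basis_vec (I, \<beta>))"
  by (simp add: weightwise_def)

lemma weightwise_contr_basis:
  "lin (A \<beta>) \<Longrightarrow> weightwise A (contr t (basis_vec (I, \<beta>))) = A \<beta> (contr t (basis_vec (I, \<beta>)))"
  and weightwise_wedge_basis:
  "lin (A \<beta>) \<Longrightarrow> weightwise A (wedge t (basis_vec (I, \<beta>))) = A \<beta> (wedge t (basis_vec (I, \<beta>)))"
  by (simp_all add: lin_simps)

text \<open>
  In terms of exponents this is the exterior product with \<open>v\<^sub>t\<close> followed by division by the variable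
  \<open>v\<^sub>t\<close>.  It must not involve the factor \<open>\<beta>\<^sub>t\<close>, which may vanish in the field.
\<close>

definition koszul_homotopy :: "'k::field wform \<Rightarrow> 'k wform" where
  "koszul_homotopy = weightwise (\<lambda>\<beta>. wedge (LEAST t. 0 < \<beta> t))"

lemma koszul_homotopy_basis:
  assumes "t0 < n" "0 < \<beta> t0"
  shows "koszul_form n (koszul_homotopy (basis_vec (I, \<beta>)))
     + koszul_homotopy (koszul_form n (basis_vec (I, \<beta>))) = basis_vec (I, \<beta>)"
proof -
  define t where "t = (LEAST t. 0 < \<beta> t)"
  have t: "t < n" using Least_le[of "\<lambda>t. 0 < \<beta> t", OF assms(2)] assms(1) by (simp add: t_def)
  let ?e = "basis_vec (I, \<beta>)"
  have "koszul_form n (koszul_homotopy ?e) + koszul_homotopy (koszul_form n ?e)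
      = (\<Sum>s<n. contr s (wedge t ?e) + wedge t (contr s ?e))"
    by (simp add: koszul_form_def koszul_homotopy_def weightwise_contr_basis lin_intros sum.distrib
         t_def del: basis_ops)
  also have "\<dots> = ?e"
    using t by (simp add: contr_wedge del: basis_ops)
  finally show ?thesis .
qed

text \<open>
  The contraction with the vector field \<open>v\<^sub>t \<partial>/\<partial>v\<^sub>t\<close>, whose Lie derivative is multiplication by
  \<open>\<beta>\<^sub>t\<close>, divided by this number.
\<close>

definition deriv_homotopy :: "'k::field wform \<Rightarrow> 'k wform" where
  "deriv_homotopy = weightwise (\<lambda>\<beta> f.
     if \<exists>t. of_nat (\<beta> t) \<noteq> (0 :: 'k) then
       let t = (LEAST t. of_nat (\<beta> t) \<noteq> (0 :: 'k)) in fscale (inverse (of_nat (\<beta> t))) (contr t f)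
     else 0)"

lemma lin_homotopies [lin_intros]:
  "lin A \<Longrightarrow> lin (\<lambda>x. koszul_homotopy (A x))" "lin A \<Longrightarrow> lin (\<lambda>x. deriv_homotopy (A x))"
  unfolding koszul_homotopy_def deriv_homotopy_def by (intro lin_intros | assumption)+

lemma lin_homotopies' [lin_intros]: "lin koszul_homotopy" "lin deriv_homotopy"
  using lin_homotopies[OF lin_id] by auto

text \<open>
  Contractions anticommute.  This is why the homotopy restricts to the kernel of the Koszul map and
  contracts the complex of hook modules as well, away from the weights divisible by \<open>p\<close>.
\<close>

lemma deriv_homotopy_koszul: "koszul_form n (deriv_homotopy f) = - deriv_homotopy (koszul_form n f)"
  for f :: "'k::field wform"
proof (rule lin_eqI[where f = f]; (intro lin_intros)?)
  fix x :: "nat set \<times> (nat \<Rightarrow> nat)"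
  let ?e = "basis_vec x :: 'k wform"
  obtain I \<beta> where x: "x = (I, \<beta>)" by (cases x)
  define A where "A = (\<lambda>\<beta> (f :: 'k wform).
     if \<exists>t. of_nat (\<beta> t) \<noteq> (0 :: 'k) then
       let t = (LEAST t. of_nat (\<beta> t) \<noteq> (0 :: 'k)) in fscale (inverse (of_nat (\<beta> t))) (contr t f)
     else 0)"
  have h: "deriv_homotopy = weightwise A"
    by (simp add: deriv_homotopy_def A_def)
  have lin: "lin (A \<beta>)"
    unfolding A_def Let_def by (intro lin_intros)
  have "deriv_homotopy (koszul_form n ?e) = A \<beta> (koszul_form n ?e)"
    by (simp add: h x koszul_form_def weightwise_contr_basis lin lin_sum[OF lin] del: basis_ops)
  also have "\<dots> = - koszul_form n (A \<beta> ?e)"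
    by (simp add: A_def Let_def koszul_form_contr del: basis_ops)
  finally show "koszul_form n (deriv_homotopy ?e) = - deriv_homotopy (koszul_form n ?e)"
    by (simp add: h x del: basis_ops)
qed

section \<open>The Cartier operator\<close>

text \<open>
  On a form \<open>v\<^sub>I \<otimes> v\<^sup>\<alpha>\<close> of weight \<open>p\<gamma>\<close> this is the classical Cartier operator, which replaces
  \<open>f\<^sup>p v\<^sub>t\<^sup>p\<^sup>-\<^sup>1 dv\<^sub>t\<close> by \<open>f dv\<^sub>t\<close>, made linear instead of semilinear.  In
  characteristic \<open>p\<close>, its section \<open>dilate\<close> takes values in closed forms.
\<close>

definition cartier :: "nat \<Rightarrow> 'k::field wform \<Rightarrow> 'k wform" where
  "cartier p = lin_ext (\<lambda>(I, \<beta>).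
     if \<forall>t. p dvd \<beta> t then basis_vec (I, \<lambda>t. \<beta> t div p) else 0)"

definition dilate :: "nat \<Rightarrow> 'k::field wform \<Rightarrow> 'k wform" where
  "dilate p = lin_ext (\<lambda>(I, \<beta>). basis_vec (I, \<lambda>t. p * \<beta> t))"

lemma lin_cartier [lin_intros]:
  "lin A \<Longrightarrow> lin (\<lambda>x. cartier p (A x))" "lin A \<Longrightarrow> lin (\<lambda>x. dilate p (A x))"
  "lin (cartier p)" "lin (dilate p)"
  unfolding cartier_def dilate_def by (intro lin_intros lin_lin_ext | assumption)+

lemma cartier_basis [simp]:
  "cartier p (basis_vec (I, \<beta>)) = (if \<forall>t. p dvd \<beta> t then basis_vec (I, \<lambda>t. \<beta> t div p) else 0)"
  "dilate p (basis_vec (I, \<beta>)) = basis_vec (I, \<lambda>t. p * \<beta> t)"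
  by (simp_all add: cartier_def dilate_def)

lemmas cartier_simps [simp] = lin_simps[OF lin_cartier(3)] lin_simps[OF lin_cartier(4)]

lemma cartier_wedge: "cartier p (wedge t f) = wedge t (cartier p f)"
  and cartier_contr: "cartier p (contr t f) = contr t (cartier p f)"
  and dilate_wedge: "dilate p (wedge t f) = wedge t (dilate p f)"
  and dilate_contr: "dilate p (contr t f) = contr t (dilate p f)"
  by (rule lin_eqI[where f = f]; (intro lin_intros)?; auto)+

lemma cartier_koszul: "cartier p (koszul_form n f) = koszul_form n (cartier p f)"
  and dilate_koszul: "dilate p (koszul_form n f) = koszul_form n (dilate p f)"
  by (simp_all add: koszul_form_def cartier_contr dilate_contr)

lemma cartier_dilate [simp]: "p > 0 \<Longrightarrow> cartier p (dilate p f) = f"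
  by (rule lin_eqI[where f = f]; (intro lin_intros)?; auto)

lemma euler_dilate:
  assumes "CHAR('k) = p"
  shows "euler t (dilate p (f :: 'k::field wform)) = 0"
  by (rule lin_eqI[where f = f]; (intro lin_intros)?;
      use assms in \<open>auto simp: of_nat_eq_0_iff_char_dvd simp del: of_nat_mult\<close>)

lemma cartier_euler:
  assumes "CHAR('k) = p"
  shows "cartier p (euler t (f :: 'k::field wform)) = 0"
  by (rule lin_eqI[where f = f]; (intro lin_intros)?;
      use assms in \<open>auto simp: of_nat_eq_0_iff_char_dvd\<close>)

lemma cartier_deriv:
  assumes "CHAR('k) = p"
  shows "cartier p (deriv_form n (f :: 'k::field wform)) = 0"
  by (simp add: deriv_form_def cartier_wedge cartier_euler[OF assms])

lemma deriv_dilate: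
  assumes "CHAR('k) = p"
  shows "deriv_form n (dilate p (f :: 'k::field wform)) = 0"
  by (simp add: deriv_form_def euler_dilate[OF assms])

text \<open>
  The de Rham complex retracts onto the weights divisible by \<open>p\<close>.
\<close>

lemma deriv_homotopy_basis:
  fixes I \<beta>
  defines "e \<equiv> basis_vec (I, \<beta>) :: 'k::field wform"
  assumes "\<And>t. t \<ge> n \<Longrightarrow> \<beta> t = 0" and p: "CHAR('k) = p" "p > 0"
  shows "deriv_form n (deriv_homotopy e) + deriv_homotopy (deriv_form n e) + dilate p (cartier p e) = e"
proof (cases "\<exists>t. of_nat (\<beta> t) \<noteq> (0 :: 'k)")
  case False
  then have dvd: "p dvd \<beta> t" for t
    using p by (simp add: of_nat_eq_0_iff_char_dvd)
  have "euler t e = 0" for t using False by (simp add: e_def)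
  then have "deriv_form n e = 0"
    by (simp add: deriv_form_def)
  moreover have "deriv_homotopy e = 0"
    using False by (simp add: deriv_homotopy_def e_def)
  moreover have "dilate p (cartier p e) = e"
    using dvd by (simp add: e_def)
  ultimately show ?thesis by (simp add: lin_simps lin_intros)
next
  case True
  define t where "t = (LEAST t. of_nat (\<beta> t) \<noteq> (0 :: 'k))"
  have t: "of_nat (\<beta> t) \<noteq> (0 :: 'k)"
    unfolding t_def using True by (rule LeastI_ex)
  with assms(2)[of t] have tn: "t < n" by (cases "t < n") auto
  have "\<not> p dvd \<beta> t" using t p by (simp add: of_nat_eq_0_iff_char_dvd)
  then have c: "cartier p e = 0" by (auto simp: e_def)
  let ?h = "\<lambda>f. fscale (inverse (of_nat (\<beta> t))) (contr t f)"
  have h1: "deriv_homotopy e = ?h e"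
    using True by (simp add: deriv_homotopy_def e_def t_def Let_def)
  have eu: "euler s e = fscale (of_nat (\<beta> s)) e" for s by (simp add: e_def)
  have h2: "deriv_homotopy (wedge s e) = ?h (wedge s e)" for s
    using True unfolding deriv_homotopy_def e_def
    by (subst weightwise_wedge_basis) (auto simp: t_def Let_def intro!: lin_intros)
  have "deriv_form n (deriv_homotopy e) + deriv_homotopy (deriv_form n e)
      = (\<Sum>s<n. fscale (inverse (of_nat (\<beta> t)) * of_nat (\<beta> s)) (wedge s (contr t e) + contr t (wedge s e)))"
    by (simp add: deriv_form_def h1 h2 euler_contr eu lin_simps lin_intros sum.distrib
        free.scale_right_distrib free.scale_sum_right mult.commute)
  also have "\<dots> = (\<Sum>s<n. if s = t then e else 0)"
    using t by (intro sum.cong) (auto simp: contr_wedge)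
  also have "\<dots> = e" using tn by simp
  finally show ?thesis using c by simp
qed

section \<open>Homogeneous forms\<close>

text \<open>
  The condition \<open>I \<subseteq> {t. 0 < \<beta> t}\<close> says that the exponents \<open>\<beta> - 1\<^sub>I\<close> are not negative.
\<close>

definition form_index :: "nat \<Rightarrow> int \<Rightarrow> int \<Rightarrow> (nat set \<times> (nat \<Rightarrow> nat)) set" where
  "form_index n b a = {(I, \<beta>). I \<subseteq> {t. 0 < \<beta> t} \<and> (\<forall>t\<ge>n. \<beta> t = 0) \<and>
     int (card I) = b \<and> int (\<Sum>t<n. \<beta> t) = a + b}"

definition forms :: "nat \<Rightarrow> int \<Rightarrow> int \<Rightarrow> 'k::field wform set" where
  "forms n b a = {f. Poly_Mapping.keys f \<subseteq> form_index n b a}"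

lemma subspace_forms: "free.subspace (forms n b a)"
  unfolding forms_def by (rule subspace_keys)

lemmas forms_closed = free.subspace_0[OF subspace_forms] free.subspace_add[OF subspace_forms]
  free.subspace_scale[OF subspace_forms] free.subspace_neg[OF subspace_forms]
  free.subspace_diff[OF subspace_forms] free.subspace_sum[OF subspace_forms]

lemma basis_in_forms: "basis_vec x \<in> (forms n b a :: 'k::field wform set) \<longleftrightarrow> x \<in> form_index n b a"
  by (simp add: forms_def)

lemma lin_forms:
  assumes "lin A" "f \<in> forms n b a"
    and "\<And>I \<beta>. (I, \<beta>) \<in> form_index n b a \<Longrightarrow> A (basis_vec (I, \<beta>)) \<in> forms n b' a'"
  shows "A f \<in> forms n b' a'"
proof (rule lin_in_subspace[OF assms(1) subspace_forms])
  fix x assume "x \<in> Poly_Mapping.keys f"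
  then have "(fst x, snd x) \<in> form_index n b a"
    using assms(2) by (auto simp: forms_def)
  from assms(3)[OF this] show "A (basis_vec x) \<in> forms n b' a'" by simp
qed

lemma forms_eqI:
  assumes "lin A" "lin B" "f \<in> forms n b a"
    and "\<And>I \<beta>. (I, \<beta>) \<in> form_index n b a \<Longrightarrow> A (basis_vec (I, \<beta>)) = B (basis_vec (I, \<beta>))"
  shows "A f = B f"
proof (rule lin_eqI[OF assms(1,2)])
  fix x assume "x \<in> Poly_Mapping.keys f"
  then have "(fst x, snd x) \<in> form_index n b a"
    using assms(3) by (auto simp: forms_def)
  from assms(4)[OF this] show "A (basis_vec x) = B (basis_vec x)" by simp
qed

lemma form_index_finite:
  assumes "(I, \<beta>) \<in> form_index n b a" shows "finite I" "I \<subseteq> {..<n}"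
proof -
  show "I \<subseteq> {..<n}"
    using assms by (force simp: form_index_def not_less[symmetric])
  then show "finite I" by (rule finite_subset) simp
qed

lemma sum_fun_upd_Suc:
  fixes t n :: nat
  assumes "t < n"
  shows "(\<Sum>s<n. int (if s = t then Suc (\<beta> t) else \<beta> s)) = (\<Sum>s<n. int (\<beta> s)) + 1"
proof -
  have "(\<Sum>s<n. int (if s = t then Suc (\<beta> t) else \<beta> s))
      = (\<Sum>s<n. int (\<beta> s) + (if s = t then 1 else 0))"
    by (intro sum.cong) auto
  then show ?thesis using assms by (simp add: sum.distrib)
qed

lemma mulx_forms:
  assumes "t < n" "f \<in> forms n b a" shows "mulx t f \<in> forms n b (a + 1)"
  by (rule lin_forms[OF _ assms(2)], intro lin_intros)
     (use assms(1) in \<open>auto simp: basis_in_forms form_index_def sum_fun_upd_Suc\<close>)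

lemma wedge_mulx_forms:
  assumes "t < n" "f \<in> forms n b a" shows "wedge t (mulx t f) \<in> forms n (b + 1) a"
proof (rule lin_forms[OF _ assms(2)], intro lin_intros)
  fix I \<beta> assume x: "(I, \<beta>) \<in> form_index n b a"
  have "t \<notin> I \<Longrightarrow> (insert t I, \<beta>(t := Suc (\<beta> t))) \<in> form_index n (b + 1) a"
    using x form_index_finite[OF x] assms(1) by (auto simp: form_index_def sum_fun_upd_Suc)
  then show "wedge t (mulx t (basis_vec (I, \<beta>))) \<in> forms n (b + 1) a"
    by (auto intro!: forms_closed simp: basis_in_forms)
qed

lemma wedge_forms:
  assumes x: "(I, \<beta>) \<in> form_index n b a" and "0 < \<beta> t"
  shows "wedge t (basis_vec (I, \<beta>)) \<in> forms n (b + 1) (a - 1)"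
proof -
  have "t \<notin> I \<Longrightarrow> (insert t I, \<beta>) \<in> form_index n (b + 1) (a - 1)"
    using x form_index_finite[OF x] assms(2) by (auto simp: form_index_def)
  then show ?thesis
    by (auto intro!: forms_closed simp: basis_in_forms)
qed

lemma contr_forms:
  assumes "f \<in> forms n b a" shows "contr t f \<in> forms n (b - 1) (a + 1)"
proof (rule lin_forms[OF _ assms], intro lin_intros)
  fix I \<beta> assume x: "(I, \<beta>) \<in> form_index n b a"
  have "t \<in> I \<Longrightarrow> (I - {t}, \<beta>) \<in> form_index n (b - 1) (a + 1)"
    using x form_index_finite[OF x] card_Suc_Diff1[of I t] by (auto simp: form_index_def)
  then show "contr t (basis_vec (I, \<beta>)) \<in> forms n (b - 1) (a + 1)"
    by (auto intro!: forms_closed simp: basis_in_forms)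
qed

lemma koszul_form_forms: "f \<in> forms n b a \<Longrightarrow> koszul_form n f \<in> forms n (b - 1) (a + 1)"
  unfolding koszul_form_def by (intro forms_closed contr_forms)

lemma deriv_form_forms:
  assumes "f \<in> forms n b a" shows "deriv_form n f \<in> forms n (b + 1) (a - 1)"
proof (rule lin_forms[OF _ assms])
  show "lin (deriv_form n)" by (rule lin_intros)
  fix I \<beta> assume x: "(I, \<beta>) \<in> form_index n b a"
  have "wedge t (euler t (basis_vec (I, \<beta>))) \<in> forms n (b + 1) (a - 1)" for t
    using wedge_forms[OF x, of t] by (cases "\<beta> t = 0") (auto intro: forms_closed simp del: basis_ops(2))
  then show "deriv_form n (basis_vec (I, \<beta>)) \<in> forms n (b + 1) (a - 1)"
    unfolding deriv_form_def by (rule forms_closed)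
qed

lemma koszul_homotopy_forms:
  assumes "f \<in> forms n b a" "a + b > 0" shows "koszul_homotopy f \<in> forms n (b + 1) (a - 1)"
proof (rule lin_forms[OF _ assms(1)], intro lin_intros)
  fix I \<beta> assume x: "(I, \<beta>) \<in> form_index n b a"
  then have "\<exists>t. 0 < \<beta> t"
    using assms(2) by (auto simp: form_index_def intro: ccontr)
  then have "0 < \<beta> (LEAST t. 0 < \<beta> t)" by (rule LeastI_ex)
  from wedge_forms[OF x this] show "koszul_homotopy (basis_vec (I, \<beta>)) \<in> forms n (b + 1) (a - 1)"
    by (simp add: koszul_homotopy_def)
qed

lemma deriv_homotopy_forms:
  assumes "f \<in> forms n b a" shows "deriv_homotopy f \<in> forms n (b - 1) (a + 1)"
proof (rule lin_forms[OF _ assms], intro lin_intros)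
  fix I \<beta> assume x: "(I, \<beta>) \<in> form_index n b a"
  then have "contr t (basis_vec (I, \<beta>)) \<in> forms n (b - 1) (a + 1)" for t
    by (intro contr_forms) (simp add: basis_in_forms)
  then show "deriv_homotopy (basis_vec (I, \<beta>)) \<in> forms n (b - 1) (a + 1)"
    by (auto simp: deriv_homotopy_def Let_def intro!: forms_closed simp del: basis_ops)
qed

lemma koszul_homotopy_forms_eq:
  assumes "f \<in> forms n b a" "a + b > 0"
  shows "koszul_form n (koszul_homotopy f) + koszul_homotopy (koszul_form n f) = f"
proof (rule forms_eqI[OF _ _ assms(1)]; (intro lin_intros)?)
  fix I \<beta> assume x: "(I, \<beta>) \<in> form_index n b a"
  then have "\<exists>t<n. 0 < \<beta> t"
    using assms(2) by (auto simp: form_index_def intro: ccontr)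
  then show "koszul_form n (koszul_homotopy (basis_vec (I, \<beta>))) + koszul_homotopy (koszul_form n (basis_vec (I, \<beta>))) = basis_vec (I, \<beta>)"
    using koszul_homotopy_basis by blast
qed

lemma koszul_deriv_forms:
  assumes "f \<in> forms n b a" "a + b \<ge> 0"
  shows "koszul_form n (deriv_form n f) + deriv_form n (koszul_form n f) = fscale (of_nat (nat (a + b))) f"
proof (rule forms_eqI[OF _ _ assms(1)]; (intro lin_intros)?)
  fix I \<beta> assume x: "(I, \<beta>) \<in> form_index n b a"
  then have "int (\<Sum>t<n. \<beta> t) = a + b" by (simp add: form_index_def)
  then have "nat (a + b) = (\<Sum>t<n. \<beta> t)" by (metis nat_int)
  then show "koszul_form n (deriv_form n (basis_vec (I, \<beta>))) + deriv_form n (koszul_form n (basis_vec (I, \<beta>)))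
     = fscale (of_nat (nat (a + b))) (basis_vec (I, \<beta>))"
    using koszul_deriv_basis[of n I \<beta>] by simp
qed

lemma deriv_homotopy_forms_eq:
  fixes f :: "'k::field wform"
  assumes "f \<in> forms n b a" "CHAR('k) = p" "p > 0"
  shows "deriv_form n (deriv_homotopy f) + deriv_homotopy (deriv_form n f) + dilate p (cartier p f) = f"
  by (rule forms_eqI[OF _ _ assms(1)]; (intro lin_intros)?;
      intro deriv_homotopy_basis assms(2,3)) (auto simp: form_index_def)

lemma cartier_forms:
  assumes "f \<in> forms n b (int p * q - b)" "p > 0"
  shows "cartier p f \<in> forms n b (q - b)"
proof (rule lin_forms[OF _ assms(1)], intro lin_intros)
  fix I \<beta> assume x: "(I, \<beta>) \<in> form_index n b (int p * q - b)"
  have "(I, \<lambda>t. \<beta> t div p) \<in> form_index n b (q - b)" if dvd: "\<forall>t. p dvd \<beta> t"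
  proof -
    have "\<beta> = (\<lambda>t. p * (\<beta> t div p))" using dvd by auto
    then have s: "(\<Sum>t<n. \<beta> t) = p * (\<Sum>t<n. \<beta> t div p)"
      by (metis (no_types, lifting) sum.cong sum_distrib_left)
    moreover have "0 < \<beta> t div p" if "t \<in> I" for t
      using x dvd that assms(2) by (auto simp: form_index_def div_greater_zero_iff dvd_imp_le)
    moreover have "int (\<Sum>t<n. \<beta> t) = int p * q" using x by (simp add: form_index_def)
    ultimately show ?thesis
      using x assms(2) by (auto simp: form_index_def)
  qed
  then show "cartier p (basis_vec (I, \<beta>)) \<in> forms n b (q - b)"
    by (auto simp: basis_in_forms forms_closed)
qed

lemma dilate_forms:
  assumes "f \<in> forms n b (q - b)" "p > 0"
  shows "dilate p f \<in> forms n b (int p * q - b)"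
proof (rule lin_forms[OF _ assms(1)], intro lin_intros)
  fix I \<beta> assume x: "(I, \<beta>) \<in> form_index n b (q - b)"
  then have "(I, \<lambda>t. p * \<beta> t) \<in> form_index n b (int p * q - b)"
    using assms(2) by (auto simp: form_index_def simp flip: sum_distrib_left)
  then show "dilate p (basis_vec (I, \<beta>)) \<in> forms n b (int p * q - b)"
    by (simp add: basis_in_forms)
qed

section \<open>Symbols as forms\<close>

text \<open>
  Adjacent transpositions generate all permutations.
\<close>

lemma swap_invariant_imp_perm_invariant:
  assumes swap: "\<And>us x y vs. P (us @ x # y # vs) \<Longrightarrow> P (us @ y # x # vs)"
    and "mset xs = mset ys" "P xs"
  shows "P ys"
proof -
  have move: "P (us @ x # vs @ ws) \<Longrightarrow> P (us @ vs @ x # ws)" for us x vs ws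
  proof (induction vs arbitrary: us)
    case (Cons v vs)
    have "P ((us @ [v]) @ x # vs @ ws)"
      using swap[of us x v "vs @ ws"] Cons.prems by simp
    from Cons.IH[OF this] show ?case by simp
  qed simp
  have "mset xs = mset ys \<Longrightarrow> P (us @ xs) \<Longrightarrow> P (us @ ys)" for us
  proof (induction xs arbitrary: us ys)
    case (Cons x xs)
    then have "x \<in> set ys" by (metis list.set_intros(1) mset_eq_setD)
    then obtain as bs where ys: "ys = as @ x # bs" by (meson split_list)
    then have "mset xs = mset (as @ bs)" using Cons.prems by simp
    from Cons.IH[OF this, of "us @ [x]"] have "P (us @ x # as @ bs)" using Cons.prems by simp
    from move[OF this] show ?case by (simp add: ys)
  qed simp
  from this[of "[]"] assms(2,3) show ?thesis by simp
qed

locale coordinates = vector_space scale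
  for scale :: "'k::field \<Rightarrow> 'v::ab_group_add \<Rightarrow> 'v" +
  fixes n :: nat and e :: "nat \<Rightarrow> 'v" and crd :: "nat \<Rightarrow> 'v \<Rightarrow> 'k"
  assumes crd_add [simp]: "crd t (x + y) = crd t x + crd t y"
    and crd_scale [simp]: "crd t (scale c x) = c * crd t x"
    and crd_e: "s < n \<Longrightarrow> t < n \<Longrightarrow> crd t (e s) = (if s = t then 1 else 0)"
    and crd_expansion: "x = (\<Sum>t<n. scale (crd t x) (e t))"
begin

definition mul_vec :: "'v \<Rightarrow> 'k wform \<Rightarrow> 'k wform" where
  "mul_vec x f = (\<Sum>t<n. fscale (crd t x) (mulx t f))"

definition wedge_vec :: "'v \<Rightarrow> 'k wform \<Rightarrow> 'k wform" where
  "wedge_vec x f = (\<Sum>t<n. fscale (crd t x) (wedge t (mulx t f)))"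

lemma lin_vec [lin_intros]:
  "lin A \<Longrightarrow> lin (\<lambda>z. mul_vec x (A z))" "lin A \<Longrightarrow> lin (\<lambda>z. wedge_vec x (A z))"
  unfolding mul_vec_def wedge_vec_def by (intro lin_intros | assumption)+

lemma lin_vec' [lin_intros]: "lin (mul_vec x)" "lin (wedge_vec x)"
  using lin_vec[OF lin_id] by auto

lemmas vec_simps [simp] = lin_simps[OF lin_vec'(1)] lin_simps[OF lin_vec'(2)]

lemma lin_fold_vec [lin_intros]:
  "lin A \<Longrightarrow> lin (\<lambda>z. fold mul_vec xs (A z))" "lin A \<Longrightarrow> lin (\<lambda>z. fold wedge_vec xs (A z))"
proof -
  show "lin A \<Longrightarrow> lin (\<lambda>z. fold mul_vec xs (A z))"
    by (induction xs arbitrary: A) (auto intro: lin_vec)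
  show "lin A \<Longrightarrow> lin (\<lambda>z. fold wedge_vec xs (A z))"
    by (induction xs arbitrary: A) (auto intro: lin_vec)
qed

lemma vec_add: "mul_vec (x + y) f = mul_vec x f + mul_vec y f"
    "wedge_vec (x + y) f = wedge_vec x f + wedge_vec y f"
  and vec_scale: "mul_vec (scale c x) f = fscale c (mul_vec x f)"
    "wedge_vec (scale c x) f = fscale c (wedge_vec x f)"
  by (simp_all add: mul_vec_def wedge_vec_def free.scale_left_distrib sum.distrib
      free.scale_sum_right)

lemma vec_e:
  assumes "t < n"
  shows "mul_vec (e t) f = mulx t f" "wedge_vec (e t) f = wedge t (mulx t f)"
proof -
  have "mul_vec (e t) f = (\<Sum>s<n. if s = t then mulx t f else 0)"
    unfolding mul_vec_def using assms by (intro sum.cong) (auto simp: crd_e)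
  then show "mul_vec (e t) f = mulx t f" using assms by simp
  have "wedge_vec (e t) f = (\<Sum>s<n. if s = t then wedge t (mulx t f) else 0)"
    unfolding wedge_vec_def using assms by (intro sum.cong) (auto simp: crd_e)
  then show "wedge_vec (e t) f = wedge t (mulx t f)" using assms by simp
qed

lemma mul_vec_commute: "mul_vec x (mul_vec y f) = mul_vec y (mul_vec x f)"
  unfolding mul_vec_def
  by (simp add: free.scale_sum_right)
     (subst sum.swap, intro sum.cong refl, simp add: mulx_mulx mult.commute)

lemma wedge_vec_mul_vec: "wedge_vec x (mul_vec y f) = mul_vec y (wedge_vec x f)"
  unfolding mul_vec_def wedge_vec_def
  by (simp add: free.scale_sum_right)
     (subst sum.swap, intro sum.cong refl, simp add: wedge_mulx mulx_mulx mult.commute)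

lemma wedge_mulx_anticomm:
  "wedge s (mulx s (wedge t (mulx t f))) = - wedge t (mulx t (wedge s (mulx s f)))"
  by (simp add: wedge_mulx wedge_anticomm[of s t] mulx_mulx[of s t])

lemma wedge_vec_anticomm: "wedge_vec x (wedge_vec y f) = - wedge_vec y (wedge_vec x f)"
  unfolding wedge_vec_def
  by (simp add: free.scale_sum_right flip: sum_negf)
     (subst sum.swap, intro sum.cong refl, subst wedge_mulx_anticomm, simp add: mult.commute)

lemma wedge_vec_self [simp]: "wedge_vec x (wedge_vec x f) = 0"
proof -
  let ?F = "\<lambda>s t. fscale (crd s x * crd t x) (wedge s (mulx s (wedge t (mulx t f))))"
  have "?F s t = - ?F t s" for s t
    by (subst wedge_mulx_anticomm) (simp add: mult.commute)
  then have "(\<Sum>s<n. \<Sum>t<n. ?F s t) = 0"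
    by (rule alternating_double_sum) (simp add: wedge_mulx)
  then show ?thesis
    unfolding wedge_vec_def by (simp add: free.scale_sum_right)
qed

lemma koszul_mul_vec: "koszul_form n (mul_vec x f) = mul_vec x (koszul_form n f)"
  unfolding mul_vec_def koszul_form_def
  by (simp add: free.scale_sum_right contr_mulx) (subst sum.swap, simp)

lemma koszul_wedge_vec:
  "koszul_form n (wedge_vec x f) = mul_vec x f - wedge_vec x (koszul_form n f)"
proof -
  have "koszul_form n (wedge_vec x f)
      = (\<Sum>t<n. fscale (crd t x) (\<Sum>s<n. contr s (wedge t (mulx t f))))"
    by (simp add: wedge_vec_def koszul_form_def free.scale_sum_right) (subst sum.swap, simp)
  also have "\<dots> = (\<Sum>t<n. fscale (crd t x) (mulx t f - wedge t (mulx t (koszul_form n f))))"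
    by (intro sum.cong refl arg_cong[where f = "fscale _"])
       (simp add: contr_wedge contr_mulx sum_subtractf koszul_form_def)
  finally show ?thesis
    by (simp add: mul_vec_def wedge_vec_def free.scale_right_diff_distrib sum_subtractf)
qed

lemma deriv_mul_vec: "deriv_form n (mul_vec x f) = mul_vec x (deriv_form n f) + wedge_vec x f"
proof -
  have "deriv_form n (mul_vec x f)
      = (\<Sum>t<n. fscale (crd t x) (\<Sum>s<n. wedge s (euler s (mulx t f))))"
    by (simp add: mul_vec_def deriv_form_def free.scale_sum_right) (subst sum.swap, simp)
  also have "\<dots> = (\<Sum>t<n. fscale (crd t x) (mulx t (deriv_form n f) + wedge t (mulx t f)))"
  proof (intro sum.cong refl arg_cong[where f = "fscale _"])
    fix t assume "t \<in> {..<n}"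
    moreover have "wedge s (euler s (mulx t f))
        = mulx t (wedge s (euler s f)) + (if s = t then wedge t (mulx t f) else 0)" for s
      by (simp add: euler_mulx wedge_mulx)
    ultimately show "(\<Sum>s<n. wedge s (euler s (mulx t f))) = mulx t (deriv_form n f) + wedge t (mulx t f)"
      by (simp add: sum.distrib deriv_form_def)
  qed
  finally show ?thesis
    by (simp add: mul_vec_def wedge_vec_def free.scale_right_distrib sum.distrib)
qed

lemma deriv_wedge_vec: "deriv_form n (wedge_vec x f) = - wedge_vec x (deriv_form n f)"
proof -
  have *: "wedge s (euler s (wedge t (mulx t f))) = - wedge t (mulx t (wedge s (euler s f)))" for s t
    by (cases "s = t")
       (simp_all add: euler_wedge euler_mulx wedge_mulx wedge_anticomm[of s t] )
  show ?thesis
    unfolding wedge_vec_def deriv_form_def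
    by (simp add: free.scale_sum_right sum_negf[symmetric] *) (subst sum.swap, simp)
qed

lemma mul_vec_forms: "f \<in> forms n b a \<Longrightarrow> mul_vec x f \<in> forms n b (a + 1)"
  and wedge_vec_forms: "f \<in> forms n b a \<Longrightarrow> wedge_vec x f \<in> forms n (b + 1) a"
  unfolding mul_vec_def wedge_vec_def
  by (intro forms_closed mulx_forms wedge_mulx_forms; simp)+

text \<open>
  The exterior factors are multiplied from the left, so that their order is reversed.  This changes
  the identification with forms only by a sign in each degree.
\<close>

definition form_of :: "'v list \<times> 'v list \<Rightarrow> 'k wform" where
  "form_of = (\<lambda>(xs, ys). fold wedge_vec xs (fold mul_vec ys (basis_vec ({}, \<lambda>_. 0))))"

definition expand :: "('v list \<times> 'v list \<Rightarrow>\<^sub>0 'k) \<Rightarrow> 'k wform" where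
  "expand = lin_ext form_of"

lemma lin_expand [lin_intros]: "lin A \<Longrightarrow> lin (\<lambda>x. expand (A x))" "lin expand"
  unfolding expand_def by (intro lin_intros lin_lin_ext | assumption)+

lemmas expand_simps [simp] = lin_simps[OF lin_expand(2)]

lemma expand_basis [simp]: "expand (basis_vec s) = form_of s"
  by (simp add: expand_def)

lemma fold_mul_vec: "fold mul_vec ys (mul_vec x f) = mul_vec x (fold mul_vec ys f)"
  by (induction ys arbitrary: f) (simp_all add: mul_vec_commute[of _ x])

lemma fold_wedge_mul_vec: "fold wedge_vec xs (mul_vec x f) = mul_vec x (fold wedge_vec xs f)"
  by (induction xs arbitrary: f) (simp_all add: wedge_vec_mul_vec)

lemma fold_wedge_vec:
  "fold wedge_vec xs (wedge_vec x f) = fscale ((-1) ^ length xs) (wedge_vec x (fold wedge_vec xs f))"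
proof (induction xs arbitrary: f)
  case (Cons y xs)
  have "fold wedge_vec (y # xs) (wedge_vec x f) = - fold wedge_vec xs (wedge_vec x (wedge_vec y f))"
    by (simp add: wedge_vec_anticomm[of y x] lin_uminus[OF lin_fold_vec(2)[OF lin_id]])
  then show ?case by (simp add: Cons)
qed simp

lemma form_of_Cons: "form_of (xs, y # ys) = mul_vec y (form_of (xs, ys))"
  by (simp add: form_of_def fold_mul_vec fold_wedge_mul_vec)

lemma form_of_snoc: "form_of (xs @ [x], ys) = wedge_vec x (form_of (xs, ys))"
  by (simp add: form_of_def)

lemma form_of_forms: "form_of (xs, ys) \<in> forms n (int (length xs)) (int (length ys))"
proof (induction xs rule: rev_induct)
  case Nil
  show ?case
  proof (induction ys)
    case Nil
    show ?case by (simp add: form_of_def basis_in_forms form_index_def)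
  next
    case (Cons y ys)
    from mul_vec_forms[OF this, of y] show ?case by (simp add: form_of_Cons add.commute)
  qed
next
  case (snoc x xs)
  from wedge_vec_forms[OF this, of x] show ?case by (simp add: form_of_snoc add.commute)
qed

text \<open>
  The induction uses only \<open>\<kappa>(dx \<and> \<omega>) = x\<omega> - dx \<and> \<kappa>\<omega>\<close> and \<open>\<kappa>(x\<omega>) = x(\<kappa>\<omega>)\<close>.
\<close>

lemma expand_koszul_symbol: "expand (koszul_symbol (xs, ys)) = koszul_form n (form_of (xs, ys))"
proof (induction xs rule: rev_induct)
  case Nil
  have "koszul_form n (form_of ([], ys)) = 0"
  proof (induction ys)
    case Nil
    show ?case by (simp add: form_of_def koszul_form_def)
  next
    case (Cons y ys)
    then show ?case by (simp add: form_of_Cons koszul_mul_vec)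
  qed
  then show ?case by (simp add: koszul_symbol_def)
next
  case (snoc x xs)
  have *: "form_of (remove_nth i (xs @ [x]), (xs @ [x]) ! i # ys)
      = wedge_vec x (form_of (remove_nth i xs, xs ! i # ys))" if "i < length xs" for i
    using that by (simp add: remove_nth_def nth_append flip: append_assoc form_of_snoc)
  have s: "(-1 :: 'k) ^ (length xs - i) = - ((-1) ^ (length xs - 1 - i))" if "i < length xs" for i
  proof -
    have "length xs - i = Suc (length xs - 1 - i)" using that by simp
    then show ?thesis by simp
  qed
  have "expand (koszul_symbol (xs @ [x], ys)) = form_of (xs, x # ys)
      + (\<Sum>i<length xs. fscale ((-1) ^ (length xs - i))
           (form_of (remove_nth i (xs @ [x]), (xs @ [x]) ! i # ys)))"
    by (simp add: koszul_symbol_def remove_nth_def)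
  also have "\<dots> = mul_vec x (form_of (xs, ys)) - wedge_vec x (expand (koszul_symbol (xs, ys)))"
  proof -
    have "(\<Sum>i<length xs. fscale ((-1) ^ (length xs - i))
           (form_of (remove_nth i (xs @ [x]), (xs @ [x]) ! i # ys)))
        = (\<Sum>i<length xs. - wedge_vec x (fscale ((-1) ^ (length xs - 1 - i))
           (form_of (remove_nth i xs, xs ! i # ys))))"
      by (intro sum.cong refl) (simp only: lessThan_iff * s, simp)
    then show ?thesis
      by (simp add: koszul_symbol_def sum_negf) (simp add: form_of_Cons)
  qed
  finally show ?case by (simp add: snoc form_of_snoc koszul_wedge_vec)
qed

text \<open>
  The induction uses only the Leibniz rules \<open>\<phi>(x\<omega>) = x(\<phi>\<omega>) + dx \<and> \<omega>\<close> and
  \<open>\<phi>(dx \<and> \<omega>) = -dx \<and> \<phi>\<omega>\<close>.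
\<close>

lemma expand_phi_symbol: "expand (phi_symbol (xs, ys)) = deriv_form n (form_of (xs, ys))"
proof (induction ys)
  case Nil
  have "deriv_form n (form_of (xs, [])) = 0"
  proof (induction xs rule: rev_induct)
    case Nil
    show ?case by (simp add: form_of_def deriv_form_def)
  next
    case (snoc x xs)
    then show ?case by (simp add: form_of_snoc deriv_wedge_vec)
  qed
  then show ?case by (simp add: phi_symbol_def)
next
  case (Cons y ys)
  have *: "form_of (xs @ [ys ! i], remove_nth (Suc i) (y # ys))
      = mul_vec y (form_of (xs @ [ys ! i], remove_nth i ys))" for i
    by (simp add: remove_nth_def form_of_Cons)
  have "expand (phi_symbol (xs, y # ys)) = form_of (xs @ [y], ys)
      + (\<Sum>i<length ys. form_of (xs @ [ys ! i], remove_nth (Suc i) (y # ys)))"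
    unfolding phi_symbol_def
    by (simp add: sum.lessThan_Suc_shift remove_nth_def del: sum.lessThan_Suc)
  also have "\<dots> = wedge_vec y (form_of (xs, ys)) + mul_vec y (expand (phi_symbol (xs, ys)))"
    by (simp add: * phi_symbol_def) (simp add: form_of_snoc)
  finally show ?case by (simp add: Cons form_of_Cons deriv_mul_vec)
qed

lemma expand_koszul: "expand (lin_ext koszul_symbol x) = koszul_form n (expand x)"
  and expand_phi: "expand (lin_ext phi_symbol x) = deriv_form n (expand x)"
  by (rule lin_eqI[where f = x]; (intro lin_intros lin_lin_ext)?;
      use expand_koszul_symbol expand_phi_symbol in force)+

section \<open>The relations between symbols\<close>

lemma expand_relator: "r \<in> ext_sym_relators scale b a \<Longrightarrow> expand r = 0"
proof (induction rule: ext_sym_relators.induct)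
  case (ext_alt xs u xs' xs'' ys)
  show ?case by (simp add: form_of_def fold_wedge_vec lin_simps[OF lin_fold_vec(2)[OF lin_id]])
next
  case (sym_perm xs ys ys')
  have "fold mul_vec ys = fold mul_vec ys'"
    using sym_perm by (intro fold_multiset_equiv) (auto simp: fun_eq_iff mul_vec_commute)
  then show ?case by (simp add: form_of_def)
qed (simp_all add: form_of_def vec_add vec_scale lin_simps[OF lin_fold_vec(1)[OF lin_id]]
      lin_simps[OF lin_fold_vec(2)[OF lin_id]])

lemma expand_rel: "x \<in> ext_sym_rel scale b a \<Longrightarrow> expand x = 0"
proof -
  have "free.subspace {x. expand x = 0}"
    by (simp add: free.subspace_def)
  then have "ext_sym_rel scale b a \<subseteq> {x. expand x = 0}"
    unfolding ext_sym_rel_def by (intro free.span_minimal) (auto dest: expand_relator)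
  then show "x \<in> ext_sym_rel scale b a \<Longrightarrow> expand x = 0" by auto
qed

lemma subspace_rel: "free.subspace (ext_sym_rel scale b a)"
  by (simp add: ext_sym_rel_def)

lemma relator_in_rel: "r \<in> ext_sym_relators scale b a \<Longrightarrow> r \<in> ext_sym_rel scale b a"
  by (simp add: ext_sym_rel_def free.span_base)

lemma keys_relator:
  "r \<in> ext_sym_relators scale b a \<Longrightarrow> Poly_Mapping.keys r \<subseteq> symbols b a"
proof -
  let ?S = "{f. Poly_Mapping.keys f \<subseteq> symbols b a} :: ('v list \<times> 'v list \<Rightarrow>\<^sub>0 'k) set"
  have S: "basis_vec s \<in> ?S" if "s \<in> symbols b a" for s using that by simp
  note closed = free.subspace_diff[OF subspace_keys] free.subspace_scale[OF subspace_keys]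
  assume "r \<in> ext_sym_relators scale b a"
  then have "r \<in> ?S"
  proof (induction rule: ext_sym_relators.induct)
    case (sym_perm xs ys ys')
    have "length ys' = length ys" using sym_perm mset_eq_length by blast
    with sym_perm show ?case by (intro closed S) (auto simp: symbols_def)
  qed (intro closed S; auto simp: symbols_def)+
  then show ?thesis by simp
qed

lemma keys_rel: "r \<in> ext_sym_rel scale b a \<Longrightarrow> Poly_Mapping.keys r \<subseteq> symbols b a"
proof -
  have "ext_sym_rel scale b a \<subseteq> {f. Poly_Mapping.keys f \<subseteq> symbols b a}"
    unfolding ext_sym_rel_def
    by (intro free.span_minimal subspace_keys) (use keys_relator in blast)
  then show "r \<in> ext_sym_rel scale b a \<Longrightarrow> Poly_Mapping.keys r \<subseteq> symbols b a" by blast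
qed

text \<open>
  A symbol representing a given basis form.  The indices in \<open>I\<close> are listed in decreasing order,
  because each of them is multiplied from the left, where it is then smaller than its predecessors
  and produces no sign.
\<close>

definition symbol_of :: "nat set \<times> (nat \<Rightarrow> nat) \<Rightarrow> 'v list \<times> 'v list" where
  "symbol_of = (\<lambda>(I, \<beta>). (map e (rev (sorted_list_of_set I)),
     map e (concat (map (\<lambda>t. replicate (\<beta> t - (if t \<in> I then 1 else 0)) t) [0..<n]))))"

lemma fold_mulx_list:
  "set js \<subseteq> {..<n} \<Longrightarrow> fold mul_vec (map e js) (basis_vec (I, \<beta>))
     = basis_vec (I, \<lambda>t. \<beta> t + count (mset js) t)"
  by (induction js arbitrary: \<beta>)
     (auto simp: vec_e intro!: arg_cong[where f = "\<lambda>\<gamma>. basis_vec (I, \<gamma>)"])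

lemma fold_wedge_sorted:
  "sorted_wrt (<) is \<Longrightarrow> set is \<subseteq> {..<n} \<Longrightarrow> fold wedge_vec (map e (rev is)) (basis_vec ({}, \<beta>))
     = basis_vec (set is, \<lambda>t. \<beta> t + (if t \<in> set is then 1 else 0))"
proof (induction "is")
  case (Cons t "is")
  have "{s \<in> set is. s < t} = {}" "t \<notin> set is" using Cons.prems by auto
  then have "wsign (set is) t = (1 :: 'k)" by (simp only: wsign_def card.empty power_0)
  with Cons \<open>t \<notin> set is\<close> show ?case
    by (auto simp: vec_e intro!: arg_cong[where f = "\<lambda>\<gamma>. basis_vec (_, \<gamma>)"])
qed simp

lemma form_of_sorted:
  assumes "I \<subseteq> {..<n}" "set js \<subseteq> {..<n}"
  shows "form_of (map e (rev (sorted_list_of_set I)), map e js)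
     = basis_vec (I, \<lambda>t. count (mset js) t + (if t \<in> I then 1 else 0))"
proof -
  have "finite I" using assms(1) finite_subset by blast
  then show ?thesis
    using assms fold_wedge_sorted[of "sorted_list_of_set I"]
    by (simp add: form_of_def fold_mulx_list strict_sorted_list_of_set)
qed

lemma count_concat_replicate:
  "count (mset (concat (map (\<lambda>t. replicate (\<alpha> t) t) [0..<m]))) s = (if s < m then \<alpha> s else 0)"
  by (induction m) auto

lemma form_of_symbol_of:
  assumes "x \<in> form_index n b a" shows "form_of (symbol_of x) = basis_vec x"
proof -
  obtain I \<beta> where x: "x = (I, \<beta>)" by (cases x)
  have "I \<subseteq> {..<n}" using assms form_index_finite x by blast
  moreover have "(if t < n then \<beta> t - (if t \<in> I then 1 else 0) else 0) + (if t \<in> I then 1 else 0) = \<beta> t" for t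
    using assms calculation by (auto simp: x form_index_def)
  moreover have "set (concat (map (\<lambda>t. replicate (\<beta> t - (if t \<in> I then 1 else 0)) t) [0..<n])) \<subseteq> {..<n}"
    by auto
  ultimately show ?thesis
    by (simp only: x symbol_of_def form_of_sorted count_concat_replicate case_prod_conv)
qed

lemma symbol_of_symbols: "x \<in> form_index n b a \<Longrightarrow> symbol_of x \<in> symbols b a"
proof -
  assume x: "x \<in> form_index n b a"
  obtain xs ys where s: "symbol_of x = (xs, ys)" by (cases "symbol_of x")
  have "basis_vec x \<in> (forms n (int (length xs)) (int (length ys)) :: 'k wform set)"
    using form_of_forms[of xs ys] form_of_symbol_of[OF x] by (simp add: s)
  then have "x \<in> form_index n (int (length xs)) (int (length ys))" by (simp add: basis_in_forms)
  then show "symbol_of x \<in> symbols b a"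
    using x by (auto simp: s symbols_def form_index_def)
qed

definition lift :: "'k wform \<Rightarrow> ('v list \<times> 'v list \<Rightarrow>\<^sub>0 'k)" where
  "lift = lin_ext (\<lambda>x. basis_vec (symbol_of x))"

lemma lin_lift [lin_intros]: "lin A \<Longrightarrow> lin (\<lambda>x. lift (A x))" "lin lift"
  unfolding lift_def by (intro lin_intros lin_lin_ext | assumption)+

lemmas lift_simps [simp] = lin_simps[OF lin_lift(2)]

lemma lift_basis [simp]: "lift (basis_vec x) = basis_vec (symbol_of x)"
  by (simp add: lift_def)

lemma expand_lift:
  assumes "f \<in> forms n b a" shows "expand (lift f) = f"
proof (rule forms_eqI[of "\<lambda>f. expand (lift f)" "\<lambda>f. f", OF _ _ assms])
  show "lin (\<lambda>f :: 'k wform. expand (lift f))" by (intro lin_intros)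
  show "lin (\<lambda>f :: 'k wform. f)" by (rule lin_id)
qed (simp add: form_of_symbol_of)

lemma lift_symbols:
  assumes "f \<in> forms n b a" shows "Poly_Mapping.keys (lift f) \<subseteq> symbols b a"
proof -
  have "lift f \<in> {x. Poly_Mapping.keys x \<subseteq> symbols b a}"
  proof (rule lin_in_subspace[OF lin_lift(2) subspace_keys])
    fix x assume "x \<in> Poly_Mapping.keys f"
    then have "x \<in> form_index n b a" using assms by (auto simp: forms_def)
    then show "lift (basis_vec x) \<in> {x :: _ \<Rightarrow>\<^sub>0 'k. Poly_Mapping.keys x \<subseteq> symbols b a}"
      by (simp add: symbol_of_symbols)
  qed
  then show ?thesis by simp
qed

lemma expand_forms: "Poly_Mapping.keys x \<subseteq> symbols b a \<Longrightarrow> expand x \<in> forms n b a"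
proof (rule lin_in_subspace[OF lin_expand(2) subspace_forms])
  fix s assume "Poly_Mapping.keys x \<subseteq> symbols b a" "s \<in> Poly_Mapping.keys x"
  then have "s \<in> symbols b a" by blast
  then show "expand (basis_vec s) \<in> forms n b a"
    using form_of_forms[of "fst s" "snd s"] by (auto simp: symbols_def)
qed

text \<open>
  The entries of a list are expanded in the basis one at a time, from left to right.
\<close>

lemma multilinear_induct [consumes 1, case_names zero add scale basis]:
  assumes "length xs = N"
    and zero: "\<And>xs ys. length (xs @ 0 # ys) = N \<Longrightarrow> P (xs @ 0 # ys)"
    and add: "\<And>xs u v ys. length (xs @ u # ys) = N \<Longrightarrow> P (xs @ u # ys) \<Longrightarrow> P (xs @ v # ys) \<Longrightarrow>
      P (xs @ (u + v) # ys)"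
    and scale: "\<And>xs c u ys. length (xs @ u # ys) = N \<Longrightarrow> P (xs @ u # ys) \<Longrightarrow> P (xs @ scale c u # ys)"
    and basis: "\<And>is. length is = N \<Longrightarrow> set is \<subseteq> {..<n} \<Longrightarrow> P (map e is)"
  shows "P xs"
proof -
  have "length is + length xs = N \<Longrightarrow> set is \<subseteq> {..<n} \<Longrightarrow> P (map e is @ xs)" for "is"
  proof (induction xs arbitrary: "is")
    case Nil
    then show ?case by (simp add: basis)
  next
    case (Cons x xs)
    have Q: "P (map e is @ e t # xs)" if "t < n" for t
      using Cons.IH[of "is @ [t]"] Cons.prems that by simp
    have "P (map e is @ (\<Sum>t\<in>T. scale (crd t x) (e t)) # xs)" if "T \<subseteq> {..<n}" for T
    proof -
      have "finite T" using that finite_subset by blast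
      then show ?thesis using that
        by (induction T) (use Cons.prems in \<open>auto intro!: zero add scale Q\<close>)
    qed
    from this[of "{..<n}"] show ?case using crd_expansion[of x] by simp
  qed
  from this[of "[]"] assms(1) show ?thesis by simp
qed

text \<open>
  The symbols \<open>symbol_of x\<close> span the space of all symbols modulo the relations.  By multilinearity it
  is enough to consider lists of basis vectors.  Such a symbol is zero if an index is repeated among
  its exterior factors; otherwise they can be sorted by exchanging neighbours, up to sign.
\<close>

lemma symbol_congruent_lift:
  assumes "s \<in> symbols b a"
  shows "basis_vec s - lift (form_of s) \<in> ext_sym_rel scale b a"
proof -
  define S where "S = {x. x - lift (expand x) \<in> ext_sym_rel scale b a}"
  note rel_closed = free.subspace_0[OF subspace_rel] free.subspace_add[OF subspace_rel]
    free.subspace_scale[OF subspace_rel] free.subspace_diff[OF subspace_rel]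
  have S: "free.subspace S"
    unfolding free.subspace_def
  proof (intro conjI allI ballI)
    fix x y c assume x: "x \<in> S"
    show "fscale c x \<in> S" using rel_closed(3)[of _ b a c] x
      by (force simp: S_def free.scale_right_diff_distrib)
    assume "y \<in> S"
    then show "x + y \<in> S" using rel_closed(2)[of _ b a "y - lift (expand y)"] x
      by (force simp: S_def algebra_simps)
  qed (simp add: S_def rel_closed)
  have RS: "r \<in> S" if "r \<in> ext_sym_rel scale b a" for r
    using that by (simp add: S_def expand_rel)
  have mod: "x \<in> S" if "y \<in> S" "x - y \<in> ext_sym_rel scale b a" for x y
    using free.subspace_add[OF S that(1) RS[OF that(2)]] by simp
  obtain xs ys where s: "s = (xs, ys)" by (cases s)
  have lens: "int (length xs) = b" "int (length ys) = a" using assms by (auto simp: s symbols_def)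
  have swap: "basis_vec (us @ y # x # vs, zs) \<in> S" if "basis_vec (us @ x # y # vs, zs) \<in> S"
    "(us @ x # y # vs, zs) \<in> symbols b a" for us x y vs zs
  proof -
    let ?B = "\<lambda>u v. basis_vec (us @ u # v # vs, zs) :: _ \<Rightarrow>\<^sub>0 'k"
    have sym: "(us @ u # v # vs, zs) \<in> symbols b a" for u v using that(2) by (simp add: symbols_def)
    have add1: "?B (x + y) z - ?B x z - ?B y z \<in> ext_sym_rel scale b a" for z
      by (rule relator_in_rel, rule ext_sym_relators.ext_add, rule sym)
    have add2: "?B z (x + y) - ?B z x - ?B z y \<in> ext_sym_rel scale b a" for z
      using ext_sym_relators.ext_add[of "us @ [z]" x vs zs b a y] sym
      by (auto intro!: relator_in_rel)
    have alt: "?B z z \<in> ext_sym_rel scale b a" for z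
      using ext_sym_relators.ext_alt[of us z "[]" vs zs b a] sym by (auto intro!: relator_in_rel)
    have "?B x y + ?B y x = ?B (x + y) (x + y) - ?B x x - ?B y y
        - (?B (x + y) (x + y) - ?B x (x + y) - ?B y (x + y))
        - (?B x (x + y) - ?B x x - ?B x y) - (?B y (x + y) - ?B y x - ?B y y)"
      by (simp add: algebra_simps)
    also have "\<dots> \<in> ext_sym_rel scale b a"
      by (intro rel_closed add1 add2 alt)
    finally have "?B y x - fscale (-1) (?B x y) \<in> ext_sym_rel scale b a"
      by (simp add: add.commute)
    from mod[OF free.subspace_scale[OF S that(1)] this] show ?thesis .
  qed
  have bb: "basis_vec (map e is, map e js) \<in> S"
    if i: "set is \<subseteq> {..<n}" "int (length is) = b" and j: "set js \<subseteq> {..<n}" "int (length js) = a"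
    for "is" js
  proof (cases "distinct is")
    case False
    then obtain us x vs ws where "is = us @ [x] @ vs @ [x] @ ws" using not_distinct_decomp by blast
    then show ?thesis
      using that by (auto intro!: RS relator_in_rel ext_sym_relators.ext_alt simp: symbols_def)
  next
    case True
    let ?I = "set is"
    let ?is = "rev (sorted_list_of_set ?I)"
    let ?\<beta> = "\<lambda>t. count (mset js) t + (if t \<in> ?I then 1 else 0)"
    have m: "mset ?is = mset is"
      using True by (simp add: set_eq_iff_mset_eq_distinct flip: mset_set_set)
    have len: "length ?is = length is" using m mset_eq_length by blast
    have "mset (concat (map (\<lambda>t. replicate (?\<beta> t - (if t \<in> ?I then 1 else 0)) t) [0..<n])) = mset js"
    proof (rule multiset_eqI)
      fix t show "count (mset (concat (map (\<lambda>t. replicate (?\<beta> t - (if t \<in> ?I then 1 else 0)) t) [0..<n]))) t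
          = count (mset js) t"
        using j by (auto simp: count_concat_replicate count_eq_zero_iff)
    qed
    then have m2: "mset (snd (symbol_of (?I, ?\<beta>))) = mset (map e js)"
      by (simp add: symbol_of_def)
    have so: "symbol_of (?I, ?\<beta>) = (map e ?is, snd (symbol_of (?I, ?\<beta>)))"
      by (simp add: symbol_of_def)
    have "(map e ?is, map e js) \<in> symbols b a" using that len by (simp add: symbols_def)
    then have "basis_vec (map e ?is, map e js) - basis_vec (symbol_of (?I, ?\<beta>)) \<in> ext_sym_rel scale b a"
      by (subst so) (intro relator_in_rel ext_sym_relators.sym_perm m2)
    then have "basis_vec (map e ?is, map e js) \<in> S"
      using i j by (simp add: S_def form_of_sorted)
    then have "length ?is = length is \<and> basis_vec (map e ?is, map e js) \<in> S" using len by simp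
    then have "length is = length is \<and> basis_vec (map e is, map e js) \<in> S"
      by (rule swap_invariant_imp_perm_invariant[rotated 2, where xs = ?is,
            where P = "\<lambda>is'. length is' = length is \<and> basis_vec (map e is', map e js) \<in> S"])
         (use m i j swap in \<open>auto simp: symbols_def\<close>)
    then show ?thesis by simp
  qed
  have be: "basis_vec (map e is, ys) \<in> S"
    if i: "set is \<subseteq> {..<n}" "int (length is) = b" for "is"
    using lens(2)[THEN arg_cong[where f = nat], simplified]
  proof (induction ys rule: multilinear_induct)
    case (zero us vs)
    have "basis_vec (map e is, us @ scale 0 0 # vs) - fscale 0 (basis_vec (map e is, us @ 0 # vs)) \<in> ext_sym_rel scale b a"
      by (rule relator_in_rel, rule ext_sym_relators.sym_scale) (use zero i lens in \<open>auto simp: symbols_def\<close>)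
    then show ?case by (simp add: RS)
  next
    case (add us u v vs)
    have "basis_vec (map e is, us @ (u + v) # vs) - basis_vec (map e is, us @ u # vs) - basis_vec (map e is, us @ v # vs) \<in> ext_sym_rel scale b a"
      by (rule relator_in_rel, rule ext_sym_relators.sym_add) (use add i lens in \<open>auto simp: symbols_def\<close>)
    then show ?case using mod[OF free.subspace_add[OF S add(2,3)]] by (simp add: algebra_simps)
  next
    case (scale us c u vs)
    have "basis_vec (map e is, us @ scale c u # vs) - fscale c (basis_vec (map e is, us @ u # vs)) \<in> ext_sym_rel scale b a"
      by (rule relator_in_rel, rule ext_sym_relators.sym_scale) (use scale i lens in \<open>auto simp: symbols_def\<close>)
    then show ?case using mod[OF free.subspace_scale[OF S scale(2)]] by blast
  next
    case (basis js)
    then show ?case using bb that lens by auto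
  qed
  have "basis_vec (xs, ys) \<in> S"
    using lens(1)[THEN arg_cong[where f = nat], simplified]
  proof (induction xs rule: multilinear_induct)
    case (zero us vs)
    have "basis_vec (us @ scale 0 0 # vs, ys) - fscale 0 (basis_vec (us @ 0 # vs, ys)) \<in> ext_sym_rel scale b a"
      by (rule relator_in_rel, rule ext_sym_relators.ext_scale) (use zero lens in \<open>auto simp: symbols_def\<close>)
    then show ?case by (simp add: RS)
  next
    case (add us u v vs)
    have "basis_vec (us @ (u + v) # vs, ys) - basis_vec (us @ u # vs, ys) - basis_vec (us @ v # vs, ys) \<in> ext_sym_rel scale b a"
      by (rule relator_in_rel, rule ext_sym_relators.ext_add) (use add lens in \<open>auto simp: symbols_def\<close>)
    then show ?case using mod[OF free.subspace_add[OF S add(2,3)]] by (simp add: algebra_simps)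
  next
    case (scale us c u vs)
    have "basis_vec (us @ scale c u # vs, ys) - fscale c (basis_vec (us @ u # vs, ys)) \<in> ext_sym_rel scale b a"
      by (rule relator_in_rel, rule ext_sym_relators.ext_scale) (use scale lens in \<open>auto simp: symbols_def\<close>)
    then show ?case using mod[OF free.subspace_scale[OF S scale(2)]] by blast
  next
    case (basis "is")
    then show ?case using be lens by auto
  qed
  then show ?thesis by (simp add: S_def s)
qed

text \<open>
  So \<open>expand\<close> identifies \<open>\<Lambda>\<^sup>bV \<otimes> S\<^sub>aV\<close>, defined by generators and relations, with the space of forms.
\<close>

lemma expand_eq_0_iff:
  assumes "Poly_Mapping.keys x \<subseteq> symbols b a"
  shows "expand x = 0 \<longleftrightarrow> x \<in> ext_sym_rel scale b a"
proof
  have "x - lift (expand x) \<in> ext_sym_rel scale b a"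
    by (rule lin_in_subspace[where A = "\<lambda>x. x - lift (expand x)"]; (intro lin_intros subspace_rel)?)
       (use assms symbol_congruent_lift in auto)
  then show "expand x = 0 \<Longrightarrow> x \<in> ext_sym_rel scale b a" by simp
qed (rule expand_rel)

end

section \<open>The inverse Cartier operator on symbols\<close>

definition frob :: "nat \<Rightarrow> ('a \<Rightarrow>\<^sub>0 'k::field) \<Rightarrow> ('a \<Rightarrow>\<^sub>0 'k)" where
  "frob p = Poly_Mapping.map (\<lambda>c. c ^ p)"

context
  fixes p :: nat
  assumes p: "CHAR('k::field) = p" "p > 0"
begin

lemma prime_p: "prime p"
  using prime_CHAR_semidom[where 'a = 'k] p by simp

lemma lookup_frob: "Poly_Mapping.lookup (frob p f) x = Poly_Mapping.lookup (f :: _ \<Rightarrow>\<^sub>0 'k) x ^ p"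
  using p(2) by (simp add: frob_def Poly_Mapping.map.rep_eq when_def)

lemma frob_add: "frob p (f + g) = frob p f + frob p (g :: 'a \<Rightarrow>\<^sub>0 'k)"
proof -
  have "(x + y :: 'k) ^ p = x ^ p + y ^ p" for x y
    by (rule freshmans_dream) (use prime_p p(1) in auto)
  then show ?thesis
    by (intro poly_mapping_eqI) (simp add: lookup_frob lookup_add)
qed

lemma frob_fscale: "frob p (fscale c f) = fscale (c ^ p) (frob p (f :: 'a \<Rightarrow>\<^sub>0 'k))"
  by (intro poly_mapping_eqI) (simp add: lookup_frob lookup_fscale power_mult_distrib)

lemma frob_zero: "frob p (0 :: 'a \<Rightarrow>\<^sub>0 'k) = 0"
  using p by (intro poly_mapping_eqI) (simp add: lookup_frob)

lemma frob_basis: "frob p (basis_vec x :: 'a \<Rightarrow>\<^sub>0 'k) = basis_vec x"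
  using p by (intro poly_mapping_eqI) (simp add: lookup_frob lookup_single when_def)

lemma frob_sum: "frob p (\<Sum>i\<in>S. f i) = (\<Sum>i\<in>S. frob p (f i :: 'a \<Rightarrow>\<^sub>0 'k))"
  by (induction S rule: infinite_finite_induct) (simp_all add: frob_zero frob_add)

text \<open>
  If the matrix of \<open>B\<close> arises from that of \<open>A\<close> by raising the entries to the \<open>p\<close>-th power, then
  the Frobenius map intertwines \<open>A\<close> and \<open>B\<close>.
\<close>

lemma frob_intertwines:
  fixes A B :: "('a \<Rightarrow>\<^sub>0 'k) \<Rightarrow> ('b \<Rightarrow>\<^sub>0 'k)"
  assumes "lin A" "lin B"
    and "\<And>x. x \<in> Poly_Mapping.keys f \<Longrightarrow> frob p (A (basis_vec x)) = B (basis_vec x)"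
  shows "frob p (A f) = B (frob p f)"
  by (subst (1 2) basis_expansion[of f])
     (use assms in \<open>simp add: lin_simps frob_sum frob_fscale frob_basis\<close>)

lemma wsign_power: "(wsign I t :: 'k) ^ p = wsign I t"
proof -
  have "(-1 :: 'k) ^ p = -1"
    using minus_power_prime_CHAR[where ?'a = 'k, of p 1] p prime_p by simp
  then show ?thesis unfolding wsign_def by (metis power_mult mult.commute)
qed

lemma frob_mulx: "frob p (mulx t f) = mulx t (frob p (f :: 'k wform))"
  and frob_wedge: "frob p (wedge t f) = wedge t (frob p (f :: 'k wform))"
  and frob_contr: "frob p (contr t f) = contr t (frob p (f :: 'k wform))"
  by (rule frob_intertwines; (intro lin_intros)?; auto simp: frob_basis frob_fscale frob_zero wsign_power)+

text \<open>
  The matrices of the operators involved have entries \<open>0\<close>, \<open>1\<close> and \<open>-1\<close>.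
\<close>

lemma frob_koszul: "frob p (koszul_form n f) = koszul_form n (frob p (f :: 'k wform))"
  by (simp add: koszul_form_def frob_sum frob_contr)

lemma frob_forms: "(f :: 'k wform) \<in> forms n b a \<Longrightarrow> frob p f \<in> forms n b a"
  using p by (auto simp: forms_def in_keys_iff lookup_frob subset_iff)

end

lemma lookup_mulx:
  "Poly_Mapping.lookup (mulx t f) (J, \<delta>)
     = (if 0 < \<delta> t then Poly_Mapping.lookup f (J, \<delta>(t := \<delta> t - 1)) else 0)"
proof -
  let ?S = "{f. Poly_Mapping.lookup (mulx t f) (J, \<delta>)
     = (if 0 < \<delta> t then Poly_Mapping.lookup f (J, \<delta>(t := \<delta> t - 1)) else 0)}"
  have "f \<in> ?S"
  proof (rule mem_subspace_if_basis)
    show "free.subspace ?S"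
      by (auto simp: free.subspace_def lookup_add lookup_fscale)
    fix x :: "nat set \<times> (nat \<Rightarrow> nat)"
    obtain I \<beta> where "x = (I, \<beta>)" by (cases x)
    moreover have "\<beta>(t := Suc (\<beta> t)) = \<delta> \<longleftrightarrow> 0 < \<delta> t \<and> \<beta> = \<delta>(t := \<delta> t - 1)"
      by auto
    ultimately show "basis_vec x \<in> ?S"
      by (auto simp: lookup_single when_def)
  qed
  then show ?thesis by simp
qed

lemma lookup_cartier:
  assumes "p > 0"
  shows "Poly_Mapping.lookup (cartier p f) (J, \<delta>) = Poly_Mapping.lookup f (J, \<lambda>t. p * \<delta> t)"
proof -
  let ?S = "{f. Poly_Mapping.lookup (cartier p f) (J, \<delta>) = Poly_Mapping.lookup f (J, \<lambda>t. p * \<delta> t)}"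
  have "f \<in> ?S"
  proof (rule mem_subspace_if_basis)
    show "free.subspace ?S"
      by (auto simp: free.subspace_def lookup_add lookup_fscale)
    fix x :: "nat set \<times> (nat \<Rightarrow> nat)"
    obtain I \<beta> where "x = (I, \<beta>)" by (cases x)
    moreover have "(\<forall>t. p dvd \<beta> t) \<and> (\<lambda>t. \<beta> t div p) = \<delta> \<longleftrightarrow> \<beta> = (\<lambda>t. p * \<delta> t)"
      using assms by auto
    ultimately show "basis_vec x \<in> ?S"
      by (auto simp: lookup_single when_def)
  qed
  then show ?thesis by simp
qed

lemma funpow_pred: "0 < p \<Longrightarrow> (A ^^ p) x = A ((A ^^ (p - 1)) x)" for A :: "'a \<Rightarrow> 'a"
  by (cases p) auto

lemma mulx_power_dilate: "(mulx t ^^ p) (dilate p f) = dilate p (mulx t f)"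
proof -
  have *: "(mulx t ^^ k) (basis_vec (I, \<beta>)) = basis_vec (I, \<beta>(t := \<beta> t + k))" for k I \<beta>
    by (induction k) (auto intro!: arg_cong[where f = "\<lambda>\<gamma>. basis_vec (I, \<gamma>)"])
  show ?thesis
    by (rule lin_eqI[where f = f]; (intro lin_intros)?) (auto simp: * intro!: arg_cong[where f = "\<lambda>\<gamma>. basis_vec (_, \<gamma>)"] ext)
qed

context coordinates
begin

text \<open>
  An upper bound for the support of \<open>x\<^sup>k\<close> times the basis form \<open>(I, \<beta>)\<close>.
\<close>

definition shifted_weights :: "nat set \<Rightarrow> (nat \<Rightarrow> nat) \<Rightarrow> nat \<Rightarrow> (nat set \<times> (nat \<Rightarrow> nat)) set" where
  "shifted_weights I \<beta> k = {(J, \<delta>). J = I \<and> (\<forall>s. \<beta> s \<le> \<delta> s) \<and> (\<forall>s\<ge>n. \<delta> s = \<beta> s) \<and>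
     (\<Sum>s<n. \<delta> s) = (\<Sum>s<n. \<beta> s) + k}"

lemma keys_mul_vec_power:
  "Poly_Mapping.keys ((mul_vec x ^^ k) (basis_vec (I, \<beta>))) \<subseteq> shifted_weights I \<beta> k"
proof (induction k)
  case 0
  show ?case by (simp add: shifted_weights_def)
next
  case (Suc k)
  let ?f = "(mul_vec x ^^ k) (basis_vec (I, \<beta>))"
  have "mulx t ?f \<in> {f. Poly_Mapping.keys f \<subseteq> shifted_weights I \<beta> (Suc k)}" if "t < n" for t
  proof (rule lin_in_subspace[OF lin_ops'(1) subspace_keys])
    fix y assume "y \<in> Poly_Mapping.keys ?f"
    then obtain \<delta> where y: "y = (I, \<delta>)" "(I, \<delta>) \<in> shifted_weights I \<beta> k"
      using Suc by (auto simp: shifted_weights_def)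
    have "(\<Sum>s<n. (\<delta>(t := Suc (\<delta> t))) s) = (\<Sum>s<n. \<delta> s + (if s = t then 1 else 0))"
      by (intro sum.cong) auto
    also have "\<dots> = (\<Sum>s<n. \<delta> s) + 1" using that by (simp add: sum.distrib)
    finally have "(I, \<delta>(t := Suc (\<delta> t))) \<in> shifted_weights I \<beta> (Suc k)"
      using y(2) that by (auto simp: shifted_weights_def le_Suc_eq)
    then show "mulx t (basis_vec y) \<in> {f. Poly_Mapping.keys f \<subseteq> shifted_weights I \<beta> (Suc k)}"
      by (simp add: y(1))
  qed
  then have "mul_vec x ?f \<in> {f. Poly_Mapping.keys f \<subseteq> shifted_weights I \<beta> (Suc k)}"
    unfolding mul_vec_def
    by (intro free.subspace_sum[OF subspace_keys] free.subspace_scale[OF subspace_keys]) auto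
  then show ?case by simp
qed

lemma lookup_mul_vec_power:
  assumes "t < n"
  shows "Poly_Mapping.lookup ((mul_vec x ^^ k) (basis_vec (I, \<beta>))) (I, \<beta>(t := \<beta> t + k)) = crd t x ^ k"
proof (induction k)
  case (Suc k)
  let ?f = "(mul_vec x ^^ k) (basis_vec (I, \<beta>))"
  let ?\<delta> = "\<beta>(t := \<beta> t + Suc k)"
  have "Poly_Mapping.lookup (mul_vec x ?f) (I, ?\<delta>)
      = (\<Sum>s<n. crd s x * Poly_Mapping.lookup (mulx s ?f) (I, ?\<delta>))"
    by (simp add: mul_vec_def lookup_sum lookup_fscale)
  also have "\<dots> = (\<Sum>s<n. if s = t then crd t x ^ Suc k else 0)"
  proof -
    have pos: "0 < ?\<delta> t" and e: "?\<delta>(t := ?\<delta> t - 1) = \<beta>(t := \<beta> t + k)" by auto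
    have up: "Poly_Mapping.lookup (mulx t ?f) (I, ?\<delta>) = crd t x ^ k"
      by (simp only: lookup_mulx pos if_True e Suc)
    have "crd s x * Poly_Mapping.lookup (mulx s ?f) (I, ?\<delta>) = (if s = t then crd t x ^ Suc k else 0)" for s
    proof -
      have "(I, ?\<delta>(s := ?\<delta> s - 1)) \<notin> shifted_weights I \<beta> k" if "s \<noteq> t" "0 < \<beta> s"
        using that by (auto simp: shifted_weights_def intro!: exI[of _ s])
      then have "Poly_Mapping.lookup ?f (I, ?\<delta>(s := ?\<delta> s - 1)) = 0" if "s \<noteq> t" "0 < \<beta> s"
        using that keys_mul_vec_power[where x = x and k = k and I = I and \<beta> = \<beta>] by (auto simp: in_keys_iff)
      then show ?thesis
        using up by (cases "s = t") (simp_all add: lookup_mulx)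
    qed
    then show ?thesis by simp
  qed
  also have "\<dots> = crd t x ^ Suc k" using assms by simp
  finally show ?case by (simp only: funpow.simps o_apply)
qed simp

text \<open>
  The monomials of \<open>v\<^sub>t x\<^sup>p\<^sup>-\<^sup>1\<close> have degree \<open>p\<close> and contain \<open>v\<^sub>t\<close>.  The only such monomial whose exponents
  are divisible by \<open>p\<close> is \<open>v\<^sub>t\<^sup>p\<close>, and its coefficient is that of \<open>v\<^sub>t\<^sup>p\<^sup>-\<^sup>1\<close> in \<open>x\<^sup>p\<^sup>-\<^sup>1\<close>.  So no multinomial
  coefficients enter.
\<close>

lemma cartier_mulx_power_dilate:
  assumes "t < n" "p > 0"
  shows "cartier p (mulx t ((mul_vec x ^^ (p - 1)) (dilate p f))) = fscale (crd t x ^ (p - 1)) (mulx t f)"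
proof (rule lin_eqI[where f = f]; (intro lin_intros)?)
  fix y :: "nat set \<times> (nat \<Rightarrow> nat)"
  obtain I \<gamma> where y: "y = (I, \<gamma>)" by (cases y)
  let ?\<beta> = "\<lambda>s. p * \<gamma> s"
  let ?f = "(mul_vec x ^^ (p - 1)) (basis_vec (I, ?\<beta>))"
  have "Poly_Mapping.lookup (mulx t ?f) (J, \<lambda>s. p * \<delta> s)
      = crd t x ^ (p - 1) * (if (J, \<delta>) = (I, \<gamma>(t := Suc (\<gamma> t))) then 1 else 0)" for J \<delta>
  proof (cases "(J, \<delta>) = (I, \<gamma>(t := Suc (\<gamma> t)))")
    case True
    then have "(\<lambda>s. p * \<delta> s)(t := p * \<delta> t - 1) = ?\<beta>(t := ?\<beta> t + (p - 1))"
      using assms(2) by (intro ext) auto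
    then show ?thesis
      using True lookup_mul_vec_power[OF assms(1), where x = x and k = "p - 1" and I = I and \<beta> = ?\<beta>] assms(2)
      by (simp add: lookup_mulx)
  next
    case False
    have "Poly_Mapping.lookup (mulx t ?f) (J, \<lambda>s. p * \<delta> s) = 0"
    proof (rule ccontr)
      assume nz: "Poly_Mapping.lookup (mulx t ?f) (J, \<lambda>s. p * \<delta> s) \<noteq> 0"
      define \<eta> where "\<eta> = (\<lambda>s. p * \<delta> s)(t := p * \<delta> t - 1)"
      have pos: "0 < p * \<delta> t" and "(J, \<eta>) \<in> Poly_Mapping.keys ?f"
        using nz by (auto simp: lookup_mulx in_keys_iff \<eta>_def split: if_splits)
      then have sw: "(J, \<eta>) \<in> shifted_weights I ?\<beta> (p - 1)"
        using keys_mul_vec_power by blast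
      then have le: "p * \<gamma> s \<le> \<eta> s" for s by (auto simp: shifted_weights_def)
      have le': "(\<gamma>(t := Suc (\<gamma> t))) s \<le> \<delta> s" for s
      proof (cases "s = t")
        case True
        have "p * \<gamma> t \<le> p * \<delta> t - 1" using le[of t] by (simp add: \<eta>_def)
        then have "p * \<gamma> t < p * \<delta> t" using pos by linarith
        then show ?thesis using True by simp
      next
        case False
        then show ?thesis using le[of s] assms(2) by (simp add: \<eta>_def)
      qed
      have "(\<Sum>s<n. p * \<delta> s) = (\<Sum>s<n. \<eta> s + (if s = t then 1 else 0))"
        using pos by (intro sum.cong) (auto simp: \<eta>_def)
      also have "\<dots> = (\<Sum>s<n. \<eta> s) + 1" using assms(1) by (simp add: sum.distrib)
      also have "\<dots> = (\<Sum>s<n. p * \<gamma> s) + p"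
        using sw assms(2) by (auto simp: shifted_weights_def)
      finally have "p * (\<Sum>s<n. \<delta> s) = p * ((\<Sum>s<n. \<gamma> s) + 1)"
        by (simp add: sum_distrib_left distrib_left)
      then have "(\<Sum>s<n. \<delta> s) = (\<Sum>s<n. \<gamma> s) + 1"
        by (simp only: nat_mult_eq_cancel1[OF assms(2)])
      also have "\<dots> = (\<Sum>s<n. \<gamma> s + (if s = t then 1 else 0))" using assms(1) by (simp add: sum.distrib)
      also have "\<dots> = (\<Sum>s<n. (\<gamma>(t := Suc (\<gamma> t))) s)" by (intro sum.cong) auto
      finally have "(\<gamma>(t := Suc (\<gamma> t))) s = \<delta> s" if "s < n" for s
        using sum_mono_inv[of "\<gamma>(t := Suc (\<gamma> t))" "{..<n}" \<delta> s] le' that by simp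
      moreover have "(\<gamma>(t := Suc (\<gamma> t))) s = \<delta> s" if "s \<ge> n" for s
        using sw that assms by (auto simp: shifted_weights_def \<eta>_def)
      ultimately have "\<delta> = \<gamma>(t := Suc (\<gamma> t))" using not_less by (metis ext)
      moreover have "J = I" using sw by (simp add: shifted_weights_def)
      ultimately show False using False by simp
    qed
    then show ?thesis by (simp only: False if_False mult_zero_right)
  qed
  then have "Poly_Mapping.lookup (cartier p (mulx t ?f)) z
      = Poly_Mapping.lookup (fscale (crd t x ^ (p - 1)) (mulx t (basis_vec (I, \<gamma>)))) z" for z
    by (cases z) (auto simp: lookup_cartier[OF assms(2)] lookup_fscale lookup_single when_def)
  then show "cartier p (mulx t ((mul_vec x ^^ (p - 1)) (dilate p (basis_vec y))))
      = fscale (crd t x ^ (p - 1)) (mulx t (basis_vec y))"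
    by (simp add: y poly_mapping_eqI)
qed

lemma wedge_vec_mul_vec_power: "wedge_vec x ((mul_vec y ^^ k) f) = (mul_vec y ^^ k) (wedge_vec x f)"
  by (induction k) (simp_all add: wedge_vec_mul_vec)

lemma deriv_mul_vec_power:
  "deriv_form n ((mul_vec x ^^ Suc k) f)
     = (mul_vec x ^^ Suc k) (deriv_form n f) + fscale (of_nat (Suc k)) ((mul_vec x ^^ k) (wedge_vec x f))"
proof (induction k)
  case 0
  show ?case by (simp add: deriv_mul_vec)
next
  case (Suc k)
  have "fscale (of_nat (Suc (Suc k))) v = fscale (of_nat (Suc k)) v + v" for v :: "'k wform"
    by (subst of_nat_Suc) (simp only: free.scale_left_distrib free.scale_one add.commute)
  then show ?case
    by (subst funpow.simps(2), subst o_apply, subst deriv_mul_vec, subst Suc)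
       (simp add: wedge_vec_mul_vec wedge_vec_mul_vec_power add.assoc del: of_nat_Suc)
qed

lemma lin_mul_power: "lin (mul_vec x ^^ k)"
  using lin_funpow[OF lin_vec'(1) lin_id] by blast

lemmas mul_power_simps [simp] = lin_simps[OF lin_mul_power]

lemma deriv_wedge_vec_power:
  "deriv_form n (wedge_vec x ((mul_vec x ^^ k) f)) = - wedge_vec x ((mul_vec x ^^ k) (deriv_form n f))"
proof (cases k)
  case (Suc j)
  have "wedge_vec x ((mul_vec x ^^ j) (wedge_vec x f)) = 0"
    by (simp add: wedge_vec_mul_vec_power)
  then show ?thesis
    unfolding Suc deriv_wedge_vec deriv_mul_vec_power by simp
qed (simp add: deriv_wedge_vec)

text \<open>
  The inverse of the Cartier operator, before passing to cohomology: \<open>y \<mapsto> y\<^sup>p\<close> for symmetric factors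
  and \<open>dx \<mapsto> x\<^sup>p\<^sup>-\<^sup>1 dx\<close> for exterior ones.  It makes no reference to the basis.
\<close>

definition inv_cartier_symbol :: "nat \<Rightarrow> 'v list \<times> 'v list \<Rightarrow> 'v list \<times> 'v list" where
  "inv_cartier_symbol p = (\<lambda>(xs, ys).
     (xs, concat (map (replicate (p - 1)) (rev xs)) @ concat (map (replicate p) ys)))"

lemma form_of_replicate: "form_of (xs, replicate k y @ ys) = (mul_vec y ^^ k) (form_of (xs, ys))"
  by (induction k) (simp_all add: form_of_Cons)

lemma form_of_Nil: "form_of ([], []) = basis_vec ({}, \<lambda>_. 0)"
  by (simp add: form_of_def)

lemma form_of_inv_cartier_Nil:
  "form_of (inv_cartier_symbol p ([], [])) = basis_vec ({}, \<lambda>_. 0)"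
  by (simp add: inv_cartier_symbol_def form_of_def)

lemma form_of_inv_cartier_Cons:
  "form_of (inv_cartier_symbol p ([], y # ys)) = (mul_vec y ^^ p) (form_of (inv_cartier_symbol p ([], ys)))"
  by (simp add: inv_cartier_symbol_def form_of_replicate)

lemma form_of_inv_cartier_snoc:
  "form_of (inv_cartier_symbol p (xs @ [x], ys))
     = wedge_vec x ((mul_vec x ^^ (p - 1)) (form_of (inv_cartier_symbol p (xs, ys))))"
  by (simp add: inv_cartier_symbol_def form_of_replicate form_of_snoc wedge_vec_mul_vec_power)

lemma form_of_any_forms: "\<exists>b a. form_of s \<in> forms n b a"
  using form_of_forms[of "fst s" "snd s"] by auto

context
  fixes p :: nat
  assumes p: "CHAR('k) = p" "p > 0"
begin

lemma deriv_mul_vec_char: "deriv_form n ((mul_vec x ^^ p) f) = (mul_vec x ^^ p) (deriv_form n f)"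
  using deriv_mul_vec_power[where k = "p - 1" and x = x and f = f] p of_nat_CHAR[where 'a = 'k]
  by (simp del: of_nat_Suc funpow.simps)

text \<open>
  On exact forms the Cartier operator vanishes, and on the remaining summand it can be computed by
  means of \<open>cartier_mulx_power_dilate\<close>.  This is how the following
  two lemmas treat an arbitrary closed form.
\<close>

lemma closed_decomposition:
  fixes z :: "'k wform"
  assumes "z \<in> forms n b a" "deriv_form n z = 0"
  shows "z = deriv_form n (deriv_homotopy z) + dilate p (cartier p z)"
  using deriv_homotopy_forms_eq[OF assms(1) p] assms(2) by (simp add: lin_simps lin_intros)

text \<open>
  Multiplication by \<open>x\<^sup>p\<close> commutes with the de Rham differential, since \<open>d(x\<^sup>p) = 0\<close>.
\<close>

lemma cartier_mul_vec_power:
  assumes "z \<in> forms n b a" "deriv_form n z = 0"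
  shows "cartier p ((mul_vec x ^^ p) z) = (\<Sum>t<n. fscale (crd t x ^ p) (mulx t (cartier p z)))"
proof -
  have q: "c * c ^ (p - 1) = c ^ p" for c :: 'k
    using power_Suc[of c "p - 1"] p(2) by simp
  have "cartier p ((mul_vec x ^^ p) z)
      = cartier p ((mul_vec x ^^ p) (deriv_form n (deriv_homotopy z)))
        + cartier p ((mul_vec x ^^ p) (dilate p (cartier p z)))"
    by (subst closed_decomposition[OF assms]) simp
  also have "\<dots> = cartier p (mul_vec x ((mul_vec x ^^ (p - 1)) (dilate p (cartier p z))))"
    by (simp add: cartier_deriv[OF p(1)] flip: deriv_mul_vec_char) (simp add: funpow_pred[OF p(2)])
  also have "\<dots> = (\<Sum>t<n. fscale (crd t x ^ p) (mulx t (cartier p z)))"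
    by (subst mul_vec_def) (simp add: cartier_mulx_power_dilate[OF _ p(2), unfolded One_nat_def] q[unfolded One_nat_def])
  finally show ?thesis .
qed

text \<open>
  Multiplication by \<open>x\<^sup>p\<^sup>-\<^sup>1 dx\<close> anticommutes with the de Rham differential, since this form is closed.
\<close>

lemma cartier_wedge_vec_power:
  assumes "z \<in> forms n b a" "deriv_form n z = 0"
  shows "cartier p (wedge_vec x ((mul_vec x ^^ (p - 1)) z))
    = (\<Sum>t<n. fscale (crd t x ^ p) (wedge t (mulx t (cartier p z))))"
proof -
  have q: "c * c ^ (p - 1) = c ^ p" for c :: 'k
    using power_Suc[of c "p - 1"] p(2) by simp
  have d: "wedge_vec x ((mul_vec x ^^ k) (deriv_form n f))
      = - deriv_form n (wedge_vec x ((mul_vec x ^^ k) f))" for k f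
    by (simp only: deriv_wedge_vec_power minus_minus)
  have "cartier p (wedge_vec x ((mul_vec x ^^ (p - 1)) z))
      = cartier p (wedge_vec x ((mul_vec x ^^ (p - 1)) (deriv_form n (deriv_homotopy z))))
        + cartier p (wedge_vec x ((mul_vec x ^^ (p - 1)) (dilate p (cartier p z))))"
    by (subst closed_decomposition[OF assms]) simp
  also have "\<dots> = cartier p (wedge_vec x ((mul_vec x ^^ (p - 1)) (dilate p (cartier p z))))"
    by (simp add: d cartier_deriv[OF p(1)])
  also have "\<dots> = (\<Sum>t<n. fscale (crd t x ^ p) (wedge t (mulx t (cartier p z))))"
    by (subst wedge_vec_def) (simp add: cartier_wedge cartier_mulx_power_dilate[OF _ p(2), unfolded One_nat_def] q[unfolded One_nat_def])
  finally show ?thesis .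
qed

text \<open>
  The factors \<open>y\<^sup>p\<close> and \<open>x\<^sup>p\<^sup>-\<^sup>1 dx\<close> are closed and pass through the Cartier operator one at a time.  As
  \<open>inv_cartier_symbol\<close> is compatible with linear maps on \<open>V\<close>, this determines how the Cartier
  operator transforms under a change of basis.
\<close>

lemma cartier_inv_cartier_symbol:
  "deriv_form n (form_of (inv_cartier_symbol p (xs, ys))) = 0 \<and>
   cartier p (form_of (inv_cartier_symbol p (xs, ys))) = frob p (form_of (xs, ys))"
proof (induction xs rule: rev_induct)
  case Nil
  show ?case
  proof (induction ys)
    case Nil
    show ?case by (simp add: form_of_inv_cartier_Nil form_of_Nil deriv_form_def frob_basis[OF p])
  next
    case (Cons y ys)
    obtain b a where "form_of (inv_cartier_symbol p ([], ys)) \<in> forms n b a" using form_of_any_forms by blast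
    from cartier_mul_vec_power[OF this, of y] Cons show ?case
      by (simp add: form_of_inv_cartier_Cons form_of_Cons deriv_mul_vec_char mul_vec_def[of y "form_of _"]
          frob_sum[OF p] frob_fscale[OF p] frob_mulx[OF p])
  qed
next
  case (snoc x xs)
  obtain b a where "form_of (inv_cartier_symbol p (xs, ys)) \<in> forms n b a" using form_of_any_forms by blast
  from cartier_wedge_vec_power[OF this, of x] snoc show ?case
    by (simp add: form_of_inv_cartier_snoc form_of_snoc deriv_wedge_vec_power wedge_vec_def[of x "form_of _"]
        frob_sum[OF p] frob_fscale[OF p] frob_mulx[OF p] frob_wedge[OF p])
qed

lemma form_of_inv_cartier_basis:
  assumes "set is \<subseteq> {..<n}" "set js \<subseteq> {..<n}"
  shows "form_of (inv_cartier_symbol p (map e is, map e js)) = dilate p (form_of (map e is, map e js))"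
proof -
  have fp: "(mul_vec (e t) ^^ k) f = (mulx t ^^ k) f" if "t < n" for t k f
    using that by (induction k) (simp_all add: vec_e)
  have pp: "mulx t ((mulx t ^^ (p - 1)) f) = (mulx t ^^ p) f" for t and f :: "'k wform"
    using funpow_pred[OF p(2), of "mulx t" f] by simp
  from assms(1) show ?thesis
  proof (induction "is" rule: rev_induct)
    case Nil
    from assms(2) show ?case
    proof (induction js)
      case (Cons t js)
      then show ?case
        by (simp add: form_of_inv_cartier_Cons form_of_Cons fp vec_e mulx_power_dilate)
    qed (simp add: form_of_inv_cartier_Nil form_of_Nil)
  next
    case (snoc t "is")
    then show ?case
      by (simp add: form_of_inv_cartier_snoc form_of_snoc fp vec_e pp[unfolded One_nat_def] mulx_power_dilate dilate_wedge)
  qed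
qed

lemma form_of_inv_cartier_symbol_of:
  assumes "x \<in> form_index n b a"
  shows "form_of (inv_cartier_symbol p (symbol_of x)) = dilate p (basis_vec x)"
proof -
  obtain I \<beta> where x: "x = (I, \<beta>)" by (cases x)
  have "I \<subseteq> {..<n}" "finite I" using assms form_index_finite x by blast+
  then have "form_of (inv_cartier_symbol p (symbol_of x)) = dilate p (form_of (symbol_of x))"
    unfolding x symbol_of_def case_prod_conv by (intro form_of_inv_cartier_basis) auto
  then show ?thesis by (simp add: form_of_symbol_of[OF assms])
qed

end

section \<open>The action of the general linear group on forms\<close>

definition map_symbol :: "('v \<Rightarrow> 'v) \<Rightarrow> 'v list \<times> 'v list \<Rightarrow> 'v list \<times> 'v list" where
  "map_symbol g = (\<lambda>(xs, ys). (map g xs, map g ys))"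

definition push_symbols :: "('v \<Rightarrow> 'v) \<Rightarrow> ('v list \<times> 'v list \<Rightarrow>\<^sub>0 'k) \<Rightarrow> ('v list \<times> 'v list \<Rightarrow>\<^sub>0 'k)" where
  "push_symbols g = lin_ext (\<lambda>s. basis_vec (map_symbol g s))"

lemma lin_push [lin_intros]: "lin A \<Longrightarrow> lin (\<lambda>x. push_symbols g (A x))" "lin (push_symbols g)"
  unfolding push_symbols_def by (intro lin_intros lin_lin_ext | assumption)+

lemmas push_simps [simp] = lin_simps[OF lin_push(2)]

lemma push_basis [simp]: "push_symbols g (basis_vec s) = basis_vec (map_symbol g s)"
  by (simp add: push_symbols_def)

lemma map_symbol_symbols: "map_symbol g s \<in> symbols b a \<longleftrightarrow> s \<in> symbols b a"
  by (auto simp: map_symbol_def symbols_def split: prod.splits)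

lemma keys_push_symbols: "Poly_Mapping.keys x \<subseteq> symbols b a \<Longrightarrow> Poly_Mapping.keys (push_symbols g x) \<subseteq> symbols b a"
proof -
  assume x: "Poly_Mapping.keys x \<subseteq> symbols b a"
  have "push_symbols g x \<in> {x. Poly_Mapping.keys x \<subseteq> symbols b a}"
    by (rule lin_in_subspace[OF lin_push(2) subspace_keys]) (use x in \<open>auto simp: map_symbol_symbols\<close>)
  then show ?thesis by simp
qed

lemma push_koszul_symbol: "push_symbols g (koszul_symbol s) = koszul_symbol (map_symbol g s)"
  by (cases s) (simp add: koszul_symbol_def map_symbol_def remove_nth_def take_map drop_map)

lemma push_phi_symbol: "push_symbols g (phi_symbol s) = phi_symbol (map_symbol g s)"
  by (cases s) (simp add: phi_symbol_def map_symbol_def remove_nth_def take_map drop_map)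

lemma push_relator:
  assumes g: "\<And>x y. g (x + y) = g x + g y" "\<And>c x. g (scale c x) = scale c (g x)"
    and "r \<in> ext_sym_relators scale b a"
  shows "push_symbols g r \<in> ext_sym_relators scale b a"
  using assms(3)
proof (induction rule: ext_sym_relators.induct)
  case (ext_add xs u xs' ys v)
  then show ?case
    using ext_sym_relators.ext_add[of "map g xs" "g u" "map g xs'" "map g ys" b a "g v" scale]
    by (simp add: map_symbol_def g symbols_def)
next
  case (ext_scale xs u xs' ys c)
  then show ?case
    using ext_sym_relators.ext_scale[of "map g xs" "g u" "map g xs'" "map g ys" b a scale c]
    by (simp add: map_symbol_def g symbols_def)
next
  case (ext_alt xs u xs' xs'' ys)
  then show ?case
    using ext_sym_relators.ext_alt[of "map g xs" "g u" "map g xs'" "map g xs''" "map g ys" b a scale]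
    by (simp add: map_symbol_def g symbols_def)
next
  case (sym_add xs ys u ys' v)
  then show ?case
    using ext_sym_relators.sym_add[of "map g xs" "map g ys" "g u" "map g ys'" b a "g v" scale]
    by (simp add: map_symbol_def g symbols_def)
next
  case (sym_scale xs ys u ys' c)
  then show ?case
    using ext_sym_relators.sym_scale[of "map g xs" "map g ys" "g u" "map g ys'" b a scale c]
    by (simp add: map_symbol_def g symbols_def)
next
  case (sym_perm xs ys ys')
  then show ?case
    using ext_sym_relators.sym_perm[of "map g xs" "map g ys" b a "map g ys'" scale]
    by (simp add: map_symbol_def g symbols_def)
qed

text \<open>
  The action on symbols respects the relations, so it may be computed on any representative.
\<close>

definition gl :: "('v \<Rightarrow> 'v) \<Rightarrow> 'k wform \<Rightarrow> 'k wform" where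
  "gl g f = expand (push_symbols g (lift f))"

lemma lin_gl [lin_intros]: "lin A \<Longrightarrow> lin (\<lambda>x. gl g (A x))" "lin (gl g)"
  unfolding gl_def by (intro lin_intros | assumption)+

lemmas gl_simps [simp] = lin_simps[OF lin_gl(2)]

lemma gl_forms: "f \<in> forms n b a \<Longrightarrow> gl g f \<in> forms n b a"
  unfolding gl_def by (intro expand_forms keys_push_symbols lift_symbols)

text \<open>
  The action on the Frobenius twist in coordinates.  The matrix of \<open>gl_twisted p g\<close> is obtained from
  that of \<open>gl g\<close> by raising the entries to the \<open>p\<close>-th power; this is the content of \<open>frob_gl\<close>.
\<close>

definition gl_twisted :: "nat \<Rightarrow> ('v \<Rightarrow> 'v) \<Rightarrow> 'k wform \<Rightarrow> 'k wform" where
  "gl_twisted p g f = cartier p (gl g (dilate p f))"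

lemma lin_gl_twisted: "lin (gl_twisted p g)"
  unfolding gl_twisted_def by (intro lin_intros)

context
  fixes g :: "'v \<Rightarrow> 'v"
  assumes g: "Vector_Spaces.linear scale scale g"
begin

lemma g_add: "g (x + y) = g x + g y" and g_scale: "g (scale c x) = scale c (g x)"
  using g by (simp_all add: Vector_Spaces.linear_def module_hom_iff)

lemma push_rel: "x \<in> ext_sym_rel scale b a \<Longrightarrow> push_symbols g x \<in> ext_sym_rel scale b a"
proof -
  have "free.subspace {x. push_symbols g x \<in> ext_sym_rel scale b a}"
    using subspace_rel[of b a] by (simp add: free.subspace_def)
  then have "ext_sym_rel scale b a \<subseteq> {x. push_symbols g x \<in> ext_sym_rel scale b a}"
    unfolding ext_sym_rel_def
    by (intro free.span_minimal) (auto intro: free.span_base push_relator g_add g_scale)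
  then show "x \<in> ext_sym_rel scale b a \<Longrightarrow> push_symbols g x \<in> ext_sym_rel scale b a" by blast
qed

lemma expand_push: "expand (push_symbols g x) = gl g (expand x)"
proof (rule lin_eqI[where f = x]; (intro lin_intros)?)
  fix s :: "'v list \<times> 'v list"
  have "s \<in> symbols (int (length (fst s))) (int (length (snd s)))"
    by (cases s) (simp add: symbols_def)
  from expand_rel[OF push_rel[OF symbol_congruent_lift[OF this]]]
  show "expand (push_symbols g (basis_vec s)) = gl g (expand (basis_vec s))"
    by (simp add: gl_def)
qed

lemma form_of_map_symbol: "form_of (map_symbol g s) = gl g (form_of s)"
  using expand_push[of "basis_vec s"] by simp

lemma koszul_gl:
  assumes "f \<in> forms n b a" shows "koszul_form n (gl g f) = gl g (koszul_form n f)"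
proof -
  have "koszul_form n (gl g f) = expand (push_symbols g (lin_ext koszul_symbol (lift f)))"
  proof -
    have "lin_ext koszul_symbol (push_symbols g x) = push_symbols g (lin_ext koszul_symbol x)" for x :: "'v list \<times> 'v list \<Rightarrow>\<^sub>0 'k"
      by (rule lin_eqI[where f = x]; (intro lin_intros lin_lin_ext)?) (simp add: push_koszul_symbol)
    then show ?thesis by (simp add: gl_def flip: expand_koszul)
  qed
  also have "\<dots> = gl g (koszul_form n f)"
    by (simp add: expand_push expand_koszul expand_lift[OF assms])
  finally show ?thesis .
qed

lemma deriv_gl:
  assumes "f \<in> forms n b a" shows "deriv_form n (gl g f) = gl g (deriv_form n f)"
proof -
  have "deriv_form n (gl g f) = expand (push_symbols g (lin_ext phi_symbol (lift f)))"
  proof -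
    have "lin_ext phi_symbol (push_symbols g x) = push_symbols g (lin_ext phi_symbol x)" for x :: "'v list \<times> 'v list \<Rightarrow>\<^sub>0 'k"
      by (rule lin_eqI[where f = x]; (intro lin_intros lin_lin_ext)?) (simp add: push_phi_symbol)
    then show ?thesis by (simp add: gl_def flip: expand_phi)
  qed
  also have "\<dots> = gl g (deriv_form n f)"
    by (simp add: expand_push expand_phi expand_lift[OF assms])
  finally show ?thesis .
qed

lemma frob_gl:
  assumes p: "CHAR('k) = p" "p > 0" and "f \<in> forms n b a"
  shows "frob p (gl g f) = gl_twisted p g (frob p f)"
proof (rule frob_intertwines[OF p lin_gl(2) lin_gl_twisted])
  fix x assume "x \<in> Poly_Mapping.keys f"
  then have x: "x \<in> form_index n b a" using assms(3) by (auto simp: forms_def)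
  let ?s = "symbol_of x"
  have m: "inv_cartier_symbol p (map_symbol g ?s) = map_symbol g (inv_cartier_symbol p ?s)"
    by (cases ?s) (simp add: inv_cartier_symbol_def map_symbol_def map_concat rev_map comp_def)
  have "frob p (gl g (basis_vec x)) = frob p (form_of (map_symbol g ?s))"
    by (simp add: form_of_map_symbol form_of_symbol_of[OF x])
  also have "\<dots> = cartier p (form_of (inv_cartier_symbol p (map_symbol g ?s)))"
    using cartier_inv_cartier_symbol[OF p, of "fst (map_symbol g ?s)" "snd (map_symbol g ?s)"] by simp
  also have "\<dots> = cartier p (gl g (form_of (inv_cartier_symbol p ?s)))"
    by (simp add: m form_of_map_symbol)
  also have "\<dots> = gl_twisted p g (basis_vec x)"
    by (simp add: gl_twisted_def form_of_inv_cartier_symbol_of[OF p x])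
  finally show "frob p (gl g (basis_vec x)) = gl_twisted p g (basis_vec x)" .
qed

text \<open>
  The group preserves exact forms, which the Cartier operator kills.
\<close>

lemma cartier_gl:
  assumes p: "CHAR('k) = p" "p > 0" and z: "z \<in> forms n b a" "deriv_form n z = 0"
  shows "cartier p (gl g z) = gl_twisted p g (cartier p z)"
proof -
  have "cartier p (gl g z) = cartier p (gl g (deriv_form n (deriv_homotopy z)))
      + cartier p (gl g (dilate p (cartier p z)))"
    by (subst closed_decomposition[OF p z]) simp
  then show ?thesis
    by (simp add: gl_twisted_def cartier_deriv[OF p(1)]
        flip: deriv_gl[OF deriv_homotopy_forms[OF z(1)]])
qed

end

end

section \<open>Quotients in coordinates\<close>

text \<open>
  The function \<open>f\<close> is a homomorphism from \<open>M\<close> to a space of coordinate vectors on which \<open>G\<close> acts by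
  \<open>\<rho>\<close>.  The carrier \<open>M\<close> may consist of cosets of cosets; as it has no subtraction, the last
  condition provides differences.  Two representations with injective models that have the same
  image are isomorphic.
\<close>

definition models :: "'g set \<Rightarrow> ('k::field, 'g, 'w) rep \<Rightarrow> ('g \<Rightarrow> ('a \<Rightarrow>\<^sub>0 'k) \<Rightarrow> ('a \<Rightarrow>\<^sub>0 'k)) \<Rightarrow>
    ('w \<Rightarrow> ('a \<Rightarrow>\<^sub>0 'k)) \<Rightarrow> bool" where
  "models G M \<rho> f \<longleftrightarrow>
     zer M \<in> carr M \<and> f (zer M) = 0 \<and>
     (\<forall>x\<in>carr M. \<forall>y\<in>carr M. add M x y \<in> carr M \<and> f (add M x y) = f x + f y) \<and>
     (\<forall>c. \<forall>x\<in>carr M. scl M c x \<in> carr M \<and> f (scl M c x) = fscale c (f x)) \<and>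
     (\<forall>g\<in>G. \<forall>x\<in>carr M. act M g x \<in> carr M \<and> f (act M g x) = \<rho> g (f x)) \<and>
     (\<forall>x\<in>carr M. \<forall>z\<in>carr M. \<exists>y\<in>carr M. add M x y = z)"

lemma models_zer: "models G M \<rho> f \<Longrightarrow> zer M \<in> carr M" "models G M \<rho> f \<Longrightarrow> f (zer M) = 0"
  and models_add: "models G M \<rho> f \<Longrightarrow> x \<in> carr M \<Longrightarrow> y \<in> carr M \<Longrightarrow> add M x y \<in> carr M"
    "models G M \<rho> f \<Longrightarrow> x \<in> carr M \<Longrightarrow> y \<in> carr M \<Longrightarrow> f (add M x y) = f x + f y"
  and models_scl: "models G M \<rho> f \<Longrightarrow> x \<in> carr M \<Longrightarrow> scl M c x \<in> carr M"
    "models G M \<rho> f \<Longrightarrow> x \<in> carr M \<Longrightarrow> f (scl M c x) = fscale c (f x)"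
  and models_act: "models G M \<rho> f \<Longrightarrow> g \<in> G \<Longrightarrow> x \<in> carr M \<Longrightarrow> act M g x \<in> carr M"
    "models G M \<rho> f \<Longrightarrow> g \<in> G \<Longrightarrow> x \<in> carr M \<Longrightarrow> f (act M g x) = \<rho> g (f x)"
  and models_solve: "models G M \<rho> f \<Longrightarrow> x \<in> carr M \<Longrightarrow> z \<in> carr M \<Longrightarrow> \<exists>y\<in>carr M. add M x y = z"
  unfolding models_def by simp_all

lemma models_comp:
  assumes "models G M \<rho> f" "lin h" "\<And>g x. g \<in> G \<Longrightarrow> x \<in> carr M \<Longrightarrow> h (\<rho> g (f x)) = \<rho>' g (h (f x))"
  shows "models G M \<rho>' (\<lambda>x. h (f x))"
  using assms unfolding models_def by (simp add: lin_simps)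

lemma models_sub:
  assumes M: "models G M \<rho> f"
    and S: "free.subspace S" "\<And>g x. g \<in> G \<Longrightarrow> x \<in> carr M \<Longrightarrow> f x \<in> S \<Longrightarrow> \<rho> g (f x) \<in> S"
    and Z: "Z = {x \<in> carr M. f x \<in> S}"
  shows "models G (sub_rep M Z) \<rho> f"
proof -
  have "\<exists>y\<in>Z. add M x y = z" if "x \<in> Z" "z \<in> Z" for x z
  proof -
    obtain y where y: "y \<in> carr M" "add M x y = z" using models_solve[OF M, of x z] \<open>x \<in> Z\<close> \<open>z \<in> Z\<close> Z by auto
    then have "f y = f z - f x" using models_add(2)[OF M, of x y] \<open>x \<in> Z\<close> Z by auto
    then have "y \<in> Z" using y Z free.subspace_diff[OF S(1)] \<open>x \<in> Z\<close> \<open>z \<in> Z\<close> by auto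
    then show ?thesis using y by blast
  qed
  then show ?thesis
    unfolding models_def sub_rep_def using S(2)
    by (auto simp: Z models_zer[OF M] models_add[OF M] models_scl[OF M] models_act[OF M]
        free.subspace_0[OF S(1)] free.subspace_add[OF S(1)] free.subspace_scale[OF S(1)])
qed

text \<open>
  If \<open>B\<close> is the kernel of \<open>f\<close>, then the cosets of \<open>B\<close> are the fibres of \<open>f\<close>, and this is the function
  that \<open>f\<close> induces on them.
\<close>

definition quot_fun :: "('w \<Rightarrow> 'b) \<Rightarrow> 'w set \<Rightarrow> 'b" where
  "quot_fun f X = the_elem (f ` X)"

lemma coset_eq_fiber:
  assumes M: "models G M \<rho> f" and B: "B = {b \<in> carr M. f b = 0}" and x: "x \<in> carr M"
  shows "coset M B x = {y \<in> carr M. f y = f x}"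
proof
  show "coset M B x \<subseteq> {y \<in> carr M. f y = f x}"
    using x by (auto simp: coset_def B models_add[OF M])
  show "{y \<in> carr M. f y = f x} \<subseteq> coset M B x"
  proof
    fix z assume z: "z \<in> {y \<in> carr M. f y = f x}"
    then obtain y where y: "y \<in> carr M" "add M x y = z" using models_solve[OF M x] by blast
    then have "f y = 0" using models_add(2)[OF M x y(1)] z by simp
    then show "z \<in> coset M B x" using y by (auto simp: coset_def B)
  qed
qed

context
  fixes G :: "'g set" and M :: "('k::field, 'g, 'w) rep" and \<rho> and f :: "'w \<Rightarrow> ('a \<Rightarrow>\<^sub>0 'k)" and B
  assumes M: "models G M \<rho> f" and B: "B = {b \<in> carr M. f b = 0}"
begin

lemmas fiber = coset_eq_fiber[OF M B]

lemma mem_coset: "x \<in> carr M \<Longrightarrow> x \<in> coset M B x"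
  by (simp add: fiber)

lemma quot_fun_coset: "x \<in> carr M \<Longrightarrow> quot_fun f (coset M B x) = f x"
proof -
  assume x: "x \<in> carr M"
  then have "f ` coset M B x = {f x}" using mem_coset[OF x] by (auto simp: fiber)
  then show ?thesis by (simp add: quot_fun_def)
qed

lemma carr_quot: "carr (quot_rep M B) = coset M B ` carr M"
  by (simp add: quot_rep_def)

text \<open>
  Operations on cosets are defined as unions over all representatives.  The union has only one
  distinct member if the result depends on the representative only through \<open>f\<close>.
\<close>

lemma Union_coset:
  assumes N: "models G' N \<rho>' f'" "B' = {b \<in> carr N. f' b = 0}"
    and h: "\<And>y. y \<in> carr M \<Longrightarrow> h y \<in> carr N" "\<And>y. y \<in> carr M \<Longrightarrow> f y = f x \<Longrightarrow> f' (h y) = f' (h x)"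
    and x: "x \<in> carr M"
  shows "(\<Union>y\<in>coset M B x. coset N B' (h y)) = {z \<in> carr N. f' z = f' (h x)}"
proof -
  have "coset N B' (h y) = {z \<in> carr N. f' z = f' (h x)}" if "y \<in> coset M B x" for y
  proof -
    have "y \<in> carr M" "f y = f x" using that x by (auto simp: fiber)
    then show ?thesis
      using coset_eq_fiber[OF N h(1)] h(2) by simp
  qed
  then show ?thesis using mem_coset[OF x] by auto
qed

lemma quot_add: "x \<in> carr M \<Longrightarrow> y \<in> carr M \<Longrightarrow>
    add (quot_rep M B) (coset M B x) (coset M B y) = coset M B (add M x y)"
proof -
  assume x: "x \<in> carr M" and y: "y \<in> carr M"
  have "{add M x' y' | x' y'. x' \<in> coset M B x \<and> y' \<in> coset M B y} = coset M B (add M x y)"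
  proof (intro equalityI subsetI)
    fix z assume z: "z \<in> coset M B (add M x y)"
    then have z': "z \<in> carr M" "f z = f x + f y"
      using x y by (auto simp: fiber models_add[OF M])
    obtain y' where y': "y' \<in> carr M" "add M x y' = z" using models_solve[OF M x z'(1)] by blast
    then have "f y' = f y" using models_add(2)[OF M x y'(1)] z' by simp
    then have "y' \<in> coset M B y" using y y' by (simp add: fiber)
    then show "z \<in> {add M x' y' | x' y'. x' \<in> coset M B x \<and> y' \<in> coset M B y}"
      using y' mem_coset[OF x] by blast
  qed (use x y in \<open>auto simp: fiber models_add[OF M]\<close>)
  then show ?thesis by (simp add: quot_rep_def)
qed

lemma quot_scl: "x \<in> carr M \<Longrightarrow> scl (quot_rep M B) c (coset M B x) = coset M B (scl M c x)"
  using Union_coset[OF M B, of "scl M c" x]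
  by (simp add: quot_rep_def fiber models_scl[OF M])

lemma quot_act:
  "g \<in> G \<Longrightarrow> x \<in> carr M \<Longrightarrow> act (quot_rep M B) g (coset M B x) = coset M B (act M g x)"
  using Union_coset[OF M B, of "act M g" x]
  by (simp add: quot_rep_def fiber models_act[OF M])

lemma quot_zer: "zer (quot_rep M B) = coset M B (zer M)"
  unfolding fiber[OF models_zer(1)[OF M]] models_zer(2)[OF M] by (simp add: quot_rep_def B)

lemma models_quot: "models G (quot_rep M B) \<rho> (quot_fun f)"
  unfolding models_def carr_quot
proof (intro conjI ballI allI)
  fix X Z assume "X \<in> coset M B ` carr M" "Z \<in> coset M B ` carr M"
  then obtain x z where x: "x \<in> carr M" "X = coset M B x" and z: "z \<in> carr M" "Z = coset M B z" by blast
  then obtain y where "y \<in> carr M" "add M x y = z" using models_solve[OF M] by blast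
  then show "\<exists>Y\<in>coset M B ` carr M. add (quot_rep M B) X Y = Z"
    using x z by (auto simp: quot_add)
qed (auto simp: quot_zer quot_add quot_scl quot_act quot_fun_coset models_zer[OF M] models_add[OF M]
    models_scl[OF M] models_act[OF M])

lemma quot_fun_inj: "inj_on (quot_fun f) (carr (quot_rep M B))"
proof (rule inj_onI)
  fix X Y assume "X \<in> carr (quot_rep M B)" "Y \<in> carr (quot_rep M B)" and eq: "quot_fun f X = quot_fun f Y"
  then obtain x y where "x \<in> carr M" "X = coset M B x" "y \<in> carr M" "Y = coset M B y"
    by (auto simp: carr_quot)
  with eq show "X = Y" by (simp add: quot_fun_coset) (simp add: fiber)
qed

lemma quot_fun_image: "quot_fun f ` carr (quot_rep M B) = f ` carr M"
  by (auto simp: carr_quot quot_fun_coset image_iff)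

lemma induced_map_coset:
  assumes N: "models G' N \<rho>' f'" "B' = {b \<in> carr N. f' b = 0}"
    and h: "\<And>y. y \<in> carr M \<Longrightarrow> h y \<in> carr N" "\<And>y. y \<in> carr M \<Longrightarrow> f' (h y) = h' (f y)"
    and X: "X \<in> carr (quot_rep M B)"
  shows "\<exists>y\<in>carr N. induced_map N B' h X = coset N B' y \<and> f' y = h' (quot_fun f X)"
proof -
  obtain x where x: "x \<in> carr M" "X = coset M B x" using X by (auto simp: carr_quot)
  have "induced_map N B' h X = {z \<in> carr N. f' z = f' (h x)}"
    unfolding induced_map_def x(2) using h x(1) by (intro Union_coset[OF N]) auto
  moreover have "coset N B' (h x) = {z \<in> carr N. f' z = f' (h x)}"
    using h(1)[OF x(1)] by (rule coset_eq_fiber[OF N])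
  ultimately show ?thesis using h x by (auto simp: quot_fun_coset)
qed

end

lemma models_isomorphic:
  assumes M: "models G M \<rho> f" "inj_on f (carr M)" and N: "models G N \<rho> f'" "inj_on f' (carr N)"
    and eq: "f ` carr M = f' ` carr N"
  shows "rep_isomorphic G M N"
proof -
  define i where "i x = inv_into (carr N) f' (f x)" for x
  have i: "i x \<in> carr N" "f' (i x) = f x" if "x \<in> carr M" for x
  proof -
    have "f x \<in> f' ` carr N" using that eq by blast
    then show "i x \<in> carr N" "f' (i x) = f x" unfolding i_def by (rule inv_into_into, rule f_inv_into_f)
  qed
  have eqI: "y = z" if "f' y = f' z" "y \<in> carr N" "z \<in> carr N" for y z
    using inj_onD[OF N(2)] that by blast
  have "bij_betw i (carr M) (carr N)"
  proof (rule bij_betwI')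
    fix x y assume "x \<in> carr M" "y \<in> carr M"
    then show "i x = i y \<longleftrightarrow> x = y" using i inj_onD[OF M(2)] by metis
  next
    fix y assume y: "y \<in> carr N"
    then obtain x where "x \<in> carr M" "f' y = f x" using eq by (metis imageE imageI)
    then show "\<exists>x\<in>carr M. y = i x" using i eqI y by metis
  qed (use i in blast)
  then have "rep_iso G M N i"
    unfolding rep_iso_def
    by (auto intro!: eqI simp: i models_add[OF M(1)] models_add[OF N(1)] models_scl[OF M(1)]
        models_scl[OF N(1)] models_act[OF M(1)] models_act[OF N(1)])
  then show ?thesis unfolding rep_isomorphic_def by blast
qed

section \<open>Frobenius twists in coordinates\<close>

definition twist_relators :: "nat \<Rightarrow> ('k::field, 'g, 'w) rep \<Rightarrow> ('w \<Rightarrow>\<^sub>0 'k) set" where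
  "twist_relators p M =
    {basis_vec (add M w w') - basis_vec w - basis_vec w' | w w'. w \<in> carr M \<and> w' \<in> carr M}
        \<union> {basis_vec (scl M c w) - fscale (c ^ p) (basis_vec w) | c w. w \<in> carr M}"

lemma frobenius_twist_relators:
  "frobenius_twist p M = quot_rep (free_rep (carr M) (act M)) (fspan (twist_relators p M))"
  by (simp add: frobenius_twist_def twist_relators_def)

text \<open>
  The linear map that sends the symbol \<open>F\<^sup>p w\<close> to the \<open>p\<close>-th powers of the coordinates of \<open>w\<close>.
\<close>

definition twist_fun :: "nat \<Rightarrow> ('w \<Rightarrow> ('a \<Rightarrow>\<^sub>0 'k)) \<Rightarrow> ('w \<Rightarrow>\<^sub>0 'k::field) \<Rightarrow> ('a \<Rightarrow>\<^sub>0 'k)" where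
  "twist_fun p f = lin_ext (\<lambda>w. frob p (f w))"

lemma lin_twist_fun: "lin (twist_fun p f)"
  unfolding twist_fun_def by (rule lin_lin_ext)

lemma twist_fun_basis: "twist_fun p f (basis_vec w) = frob p (f w)"
  by (simp add: twist_fun_def)

context
  fixes G :: "'g set" and M :: "('k::field, 'g, 'w) rep" and \<rho> and f :: "'w \<Rightarrow> ('a \<Rightarrow>\<^sub>0 'k)" and p :: nat
  assumes M: "models G M \<rho> f" and inj: "inj_on f (carr M)" and p: "CHAR('k) = p" "p > 0"
begin

lemmas twist_simps = lin_simps[OF lin_twist_fun[of p f]] twist_fun_basis

lemma models_free:
  assumes "\<And>g x. g \<in> G \<Longrightarrow> x \<in> carr M \<Longrightarrow> frob p (\<rho> g (f x)) = \<rho>' g (frob p (f x))"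
    and "\<And>g. g \<in> G \<Longrightarrow> lin (\<rho>' g)"
  shows "models G (free_rep (carr M) (act M)) \<rho>' (twist_fun p f)"
proof -
  let ?S = "{x. Poly_Mapping.keys x \<subseteq> carr M} :: ('w \<Rightarrow>\<^sub>0 'k) set"
  have S: "free.subspace ?S" by (rule subspace_keys)
  have "lin_ext (\<lambda>x. basis_vec (act M g x)) x \<in> ?S \<and>
      twist_fun p f (lin_ext (\<lambda>x. basis_vec (act M g x)) x) = \<rho>' g (twist_fun p f x)"
    if g: "g \<in> G" and x: "x \<in> ?S" for g x
  proof
    show "lin_ext (\<lambda>x. basis_vec (act M g x)) x \<in> ?S"
      by (rule lin_in_subspace[OF lin_lin_ext S]) (use x in \<open>auto simp: models_act[OF M g]\<close>)
    have "lin (\<lambda>x. twist_fun p f (lin_ext (\<lambda>x. basis_vec (act M g x)) x))"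
      unfolding twist_fun_def by (intro lin_intros)
    moreover have "lin (\<lambda>x. \<rho>' g (twist_fun p f x))"
      using assms(2)[OF g] by (intro linI) (simp_all add: lin_simps lin_twist_fun)
    ultimately show "twist_fun p f (lin_ext (\<lambda>x. basis_vec (act M g x)) x) = \<rho>' g (twist_fun p f x)"
      by (rule lin_eqI) (use x g assms(1) in \<open>auto simp: twist_fun_basis models_act[OF M g]\<close>)
  qed
  moreover have "\<exists>y\<in>?S. x + y = z" if "x \<in> ?S" "z \<in> ?S" for x z
    using free.subspace_diff[OF S that(2,1)] by (intro bexI[of _ "z - x"]) auto
  ultimately show ?thesis
    unfolding models_def free_rep_def
    by (simp add: twist_simps keys_add_subset keys_fscale_subset)
qed

text \<open>
  Modulo the relators, every element is a linear combination of the symbols \<open>F\<^sup>p w\<close>, where \<open>f w\<close> runs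
  through a basis \<open>E\<close> of the image of \<open>f\<close>.  Their images \<open>frob p b\<close>, \<open>b \<in> E\<close>, remain linearly
  independent: choose a linear map \<open>l\<close> that sends \<open>E\<close> to distinct basis vectors, and raise the entries
  of its matrix to the \<open>p\<close>-th power.  The result sends the vectors \<open>frob p b\<close> to the same basis vectors.
\<close>

lemma twist_relator_kernel:
  "fspan (twist_relators p M) = {x \<in> carr (free_rep (carr M) (act M)). twist_fun p f x = 0}"
proof -
  let ?R = "twist_relators p M" and ?S = "{x. Poly_Mapping.keys x \<subseteq> carr M} :: ('w \<Rightarrow>\<^sub>0 'k) set"
  have S: "free.subspace ?S" by (rule subspace_keys)
  have bS: "basis_vec w \<in> ?S" if "w \<in> carr M" for w using that by simp
  have "free.subspace (?S \<inter> {x. twist_fun p f x = 0})"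
    by (intro free.subspace_inter S) (simp add: free.subspace_def twist_simps)
  also have "?S \<inter> {x. twist_fun p f x = 0} = {x \<in> ?S. twist_fun p f x = 0}" by auto
  finally have "free.subspace {x \<in> ?S. twist_fun p f x = 0}" .
  moreover have "?R \<subseteq> {x \<in> ?S. twist_fun p f x = 0}"
  proof
    fix r assume "r \<in> ?R"
    then consider (a) w w' where "w \<in> carr M" "w' \<in> carr M" "r = basis_vec (add M w w') - basis_vec w - basis_vec w'"
      | (s) c w where "w \<in> carr M" "r = basis_vec (scl M c w) - fscale (c ^ p) (basis_vec w)"
      unfolding twist_relators_def by blast
    then show "r \<in> {x \<in> ?S. twist_fun p f x = 0}"
    proof cases
      case a
      then have "r \<in> ?S" unfolding a(3)
        by (intro free.subspace_diff[OF S] bS models_add[OF M])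
      then show ?thesis using a by (simp add: twist_simps models_add[OF M] frob_add[OF p])
    next
      case s
      then have "r \<in> ?S" unfolding s(2)
        by (intro free.subspace_diff[OF S] free.subspace_scale[OF S] bS models_scl[OF M])
      then show ?thesis using s by (simp add: twist_simps models_scl[OF M] frob_fscale[OF p])
    qed
  qed
  ultimately have sub: "fspan ?R \<subseteq> {x \<in> ?S. twist_fun p f x = 0}"
    by (intro free.span_minimal)
  obtain E where E: "E \<subseteq> f ` carr M" "free.independent E" "f ` carr M \<subseteq> fspan E"
    using free.maximal_independent_subset[of "f ` carr M"] by blast
  define w where "w = inv_into (carr M) f"
  have w: "w b \<in> carr M" "f (w b) = b" if "b \<in> E" for b
    using that E(1) by (auto simp: w_def intro: inv_into_into f_inv_into_f)
  note R = free.subspace_span[of ?R]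
  let ?T = "{y. Poly_Mapping.keys y \<subseteq> w ` E} :: ('w \<Rightarrow>\<^sub>0 'k) set"
  have T: "free.subspace ?T" by (rule subspace_keys)
  have zero: "basis_vec (zer M) \<in> fspan ?R"
  proof -
    have z: "scl M 0 (zer M) = zer M"
      by (rule inj_onD[OF inj]) (simp_all add: models_scl[OF M] models_zer[OF M])
    have "basis_vec (scl M 0 (zer M)) - fscale (0 ^ p) (basis_vec (zer M)) \<in> ?R"
      unfolding twist_relators_def using models_zer[OF M] by blast
    then show ?thesis using p(2) by (intro free.span_base) (simp add: z power_0_left)
  qed
  have red: "\<exists>y\<in>?T. basis_vec w0 - y \<in> fspan ?R"
    if "finite t" "t \<subseteq> E" "w0 \<in> carr M" "f w0 = (\<Sum>b\<in>t. fscale (r b) b)" for t w0 r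
    using that
  proof (induction t arbitrary: w0)
    case empty
    then have "w0 = zer M" using inj_onD[OF inj, of w0 "zer M"] models_zer[OF M] by simp
    then show ?case using zero by (intro bexI[of _ 0]) auto
  next
    case (insert b t)
    let ?w1 = "scl M (r b) (w b)"
    have b: "b \<in> E" using insert.prems by simp
    have w1: "?w1 \<in> carr M" "f ?w1 = fscale (r b) b" by (simp_all add: models_scl[OF M] w b)
    obtain w' where w': "w' \<in> carr M" "add M ?w1 w' = w0" using models_solve[OF M w1(1) insert.prems(2)] by blast
    then have "f w' = (\<Sum>b\<in>t. fscale (r b) b)"
      using models_add(2)[OF M w1(1) w'(1)] w1(2) insert by simp
    moreover have "t \<subseteq> E" using insert.prems by simp
    ultimately obtain y where y: "y \<in> ?T" "basis_vec w' - y \<in> fspan ?R"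
      using insert.IH[OF _ w'(1)] by blast
    have "basis_vec w0 - basis_vec ?w1 - basis_vec w' \<in> fspan ?R"
      using w1 w' by (intro free.span_base) (auto simp: twist_relators_def)
    moreover have "basis_vec ?w1 - fscale (r b ^ p) (basis_vec (w b)) \<in> fspan ?R"
      using w(1)[OF b] by (intro free.span_base) (unfold twist_relators_def, blast)
    ultimately have "(basis_vec w0 - basis_vec ?w1 - basis_vec w')
        + (basis_vec ?w1 - fscale (r b ^ p) (basis_vec (w b))) + (basis_vec w' - y) \<in> fspan ?R"
      using y(2) by (intro free.subspace_add[OF R])
    then have "basis_vec w0 - (fscale (r b ^ p) (basis_vec (w b)) + y) \<in> fspan ?R"
      by (simp add: algebra_simps)
    moreover have "fscale (r b ^ p) (basis_vec (w b)) + y \<in> ?T"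
      using b y(1) by (intro free.subspace_add[OF T] free.subspace_scale[OF T]) auto
    ultimately show ?case by blast
  qed
  have "x \<in> fspan ?R" if x: "x \<in> ?S" "twist_fun p f x = 0" for x
  proof -
    let ?Q = "{x. \<exists>y\<in>?T. x - y \<in> fspan ?R}"
    have "free.subspace ?Q"
      unfolding free.subspace_def
    proof (intro conjI allI ballI)
      show "0 \<in> ?Q" 
        by (simp, intro exI[of _ 0]) (simp add: free.subspace_0[OF R])
      fix c u v assume "u \<in> ?Q"
      then obtain y where y: "y \<in> ?T" "u - y \<in> fspan ?R" by blast
      have "fscale c u - fscale c y \<in> fspan ?R"
        using free.subspace_scale[OF R y(2), of c] by (simp add: free.scale_right_diff_distrib)
      then show "fscale c u \<in> ?Q" using free.subspace_scale[OF T y(1)] by blast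
      assume "v \<in> ?Q"
      then obtain z where z: "z \<in> ?T" "v - z \<in> fspan ?R" by blast
      have "u + v - (y + z) \<in> fspan ?R"
        using free.subspace_add[OF R y(2) z(2)] by (simp add: algebra_simps)
      then show "u + v \<in> ?Q" using free.subspace_add[OF T y(1) z(1)] by blast
    qed
    then have "x \<in> ?Q"
    proof (rule mem_subspace_if_basis)
      fix w0 assume "w0 \<in> Poly_Mapping.keys x"
      then have w0: "w0 \<in> carr M" using x by auto
      then have "f w0 \<in> fspan E" using E(3) by blast
      then obtain t r where "finite t" "t \<subseteq> E" "f w0 = (\<Sum>b\<in>t. fscale (r b) b)"
        unfolding free.span_explicit by blast
      from red[OF this(1,2) w0 this(3)] show "basis_vec w0 \<in> ?Q" by blast
    qed
    then obtain y where y: "y \<in> ?T" "x - y \<in> fspan ?R" by blast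
    then have "twist_fun p f (x - y) = 0" using sub by blast
    then have ty: "twist_fun p f y = 0" using x(2) by (simp add: twist_simps)
    have vp: "vector_space_pair (fscale :: 'k \<Rightarrow> ('a \<Rightarrow>\<^sub>0 'k) \<Rightarrow> _) (fscale :: 'k \<Rightarrow> ('w \<Rightarrow>\<^sub>0 'k) \<Rightarrow> _)"
      by (intro vector_space_pair.intro free.vector_space_axioms)
    obtain l :: "('a \<Rightarrow>\<^sub>0 'k) \<Rightarrow> ('w \<Rightarrow>\<^sub>0 'k)" where l: "lin l" "\<And>b. b \<in> E \<Longrightarrow> l b = basis_vec (w b)"
      using vector_space_pair.linear_independent_extend[OF vp E(2), of "\<lambda>b. basis_vec (w b)"] by blast
    define L where "L = lin_ext (\<lambda>x. frob p (l (basis_vec x)))"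
    have L: "lin L" "L (frob p u) = frob p (l u)" for u
      using frob_intertwines[OF p l(1), of L u] by (simp_all add: L_def lin_lin_ext)
    have "L (twist_fun p f y) = y"
    proof (rule lin_eqI[where A = "\<lambda>y. L (twist_fun p f y)" and B = "\<lambda>y. y"])
      show "lin (\<lambda>y. L (twist_fun p f y))"
        unfolding L_def twist_fun_def by (intro lin_intros)
      fix v assume "v \<in> Poly_Mapping.keys y"
      then obtain b where "b \<in> E" "v = w b" using y(1) by auto
      then show "L (twist_fun p f (basis_vec v)) = basis_vec v"
        by (simp add: twist_fun_basis L w l frob_basis[OF p])
    qed (rule lin_id)
    then have "y = 0" using ty lin_zero[OF L(1)] by simp
    then show ?thesis using y(2) by simp
  qed
  then show ?thesis using sub by (auto simp: free_rep_def)
qed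

end

section \<open>The complex in coordinates\<close>

lemma form_index_nonneg:
  assumes "(I, \<beta>) \<in> form_index n b a" shows "a \<ge> 0"
proof -
  have I: "I \<subseteq> {..<n}" using form_index_finite[OF assms] by simp
  have "int (card I) = (\<Sum>t\<in>I. 1)" by simp
  also have "\<dots> \<le> (\<Sum>t\<in>I. int (\<beta> t))"
    using assms by (intro sum_mono) (force simp: form_index_def)
  also have "\<dots> \<le> (\<Sum>t<n. int (\<beta> t))" using I by (intro sum_mono2) auto
  finally show ?thesis using assms by (simp add: form_index_def)
qed

lemma forms_neg:
  assumes "a < 0" "f \<in> forms n b a" shows "f = 0"
proof -
  have "form_index n b a = {}" using form_index_nonneg assms(1) by fastforce
  then have "Poly_Mapping.keys f = {}" using assms(2) by (simp add: forms_def)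
  then show ?thesis by simp
qed

definition cycles :: "nat \<Rightarrow> int \<Rightarrow> int \<Rightarrow> 'k::field wform set" where
  "cycles n b a = {f \<in> forms n b a. koszul_form n f = 0}"

lemma subspace_cycles: "free.subspace (cycles n b a)"
  using subspace_forms[of n b a] by (auto simp: cycles_def free.subspace_def)

lemma cycles_exact:
  assumes "f \<in> cycles n b a" "a + b > 0"
  shows "f = koszul_form n (koszul_homotopy f)" "koszul_homotopy f \<in> forms n (b + 1) (a - 1)"
  using koszul_homotopy_forms_eq[of f n b a] koszul_homotopy_forms[of f n b a] assms
  by (auto simp: cycles_def lin_zero lin_intros)

context coordinates
begin

abbreviation "G \<equiv> GL scale"

lemma G_linear: "g \<in> G \<Longrightarrow> Vector_Spaces.linear scale scale g"
  by (simp add: GL_def)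

lemma carr_symbol_rep: "carr (symbol_rep b a :: ('k, 'v \<Rightarrow> 'v, _) rep) = {x. Poly_Mapping.keys x \<subseteq> symbols b a}"
  by (simp add: symbol_rep_def free_rep_def)

lemma models_symbol_rep: "models G (symbol_rep b a) gl expand"
proof -
  have rep: "zer (symbol_rep b a) = (0 :: 'v list \<times> 'v list \<Rightarrow>\<^sub>0 'k)"
    "add (symbol_rep b a) = ((+) :: ('v list \<times> 'v list \<Rightarrow>\<^sub>0 'k) \<Rightarrow> _)"
    "scl (symbol_rep b a) = (fscale :: 'k \<Rightarrow> ('v list \<times> 'v list \<Rightarrow>\<^sub>0 'k) \<Rightarrow> _)"
    "act (symbol_rep b a) = push_symbols"
    by (simp_all add: symbol_rep_def free_rep_def push_symbols_def map_symbol_def fun_eq_iff)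
  have "\<exists>y. Poly_Mapping.keys y \<subseteq> symbols b a \<and> x + y = z"
    if "Poly_Mapping.keys x \<subseteq> symbols b a" "Poly_Mapping.keys z \<subseteq> symbols b a"
    for x z :: "'v list \<times> 'v list \<Rightarrow>\<^sub>0 'k"
    using free.subspace_diff[OF subspace_keys[of "symbols b a"], of z x] that
    by (intro exI[of _ "z - x"]) simp
  then show ?thesis
    unfolding models_def carr_symbol_rep rep
    by (simp add: keys_add_subset keys_fscale_subset keys_push_symbols expand_push[OF G_linear])
qed

lemma ext_sym_rel_kernel: "ext_sym_rel scale b a = {x \<in> carr (symbol_rep b a). expand x = 0}"
  using keys_rel expand_eq_0_iff[of _ b a] expand_rel[of _ b a] by (auto simp: carr_symbol_rep)

abbreviation "coord_form \<equiv> quot_fun expand"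

lemma models_ext_sym: "models G (ext_sym scale b a) gl coord_form"
  unfolding ext_sym_def by (rule models_quot[OF models_symbol_rep ext_sym_rel_kernel])

lemma inj_coord_form: "inj_on coord_form (carr (ext_sym scale b a))"
  unfolding ext_sym_def by (rule quot_fun_inj[OF models_symbol_rep ext_sym_rel_kernel])

lemma coord_form_image: "coord_form ` carr (ext_sym scale b a) = forms n b a"
proof -
  have "coord_form ` carr (ext_sym scale b a) = expand ` carr (symbol_rep b a)"
    unfolding ext_sym_def by (rule quot_fun_image[OF models_symbol_rep ext_sym_rel_kernel])
  also have "\<dots> = forms n b a"
    using expand_forms expand_lift lift_symbols
    by (auto simp: carr_symbol_rep image_iff) metis
  finally show ?thesis .
qed

lemma coord_form_forms: "X \<in> carr (ext_sym scale b a) \<Longrightarrow> coord_form X \<in> forms n b a"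
  using coord_form_image by blast

lemma coord_form_eq_0_iff: "X \<in> carr (ext_sym scale b a) \<Longrightarrow> X = zer (ext_sym scale b a) \<longleftrightarrow> coord_form X = 0"
  using inj_onD[OF inj_coord_form, of X "zer (ext_sym scale b a)" b a] models_zer[OF models_ext_sym] by metis

lemma coord_form_induced_map:
  assumes X: "X \<in> carr (ext_sym scale b a)"
    and h: "\<And>y. expand (h y) = h' (expand y)"
      "\<And>y. Poly_Mapping.keys y \<subseteq> symbols b a \<Longrightarrow> Poly_Mapping.keys (h y) \<subseteq> symbols b' a'"
  defines "Y \<equiv> induced_map (symbol_rep b' a' :: ('k, 'v \<Rightarrow> 'v, _) rep) (ext_sym_rel scale b' a') h X"
  shows "Y \<in> carr (ext_sym scale b' a')" "coord_form Y = h' (coord_form X)"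
proof -
  obtain y where y: "y \<in> carr (symbol_rep b' a' :: ('k, 'v \<Rightarrow> 'v, _) rep)"
    "Y = coset (symbol_rep b' a' :: ('k, 'v \<Rightarrow> 'v, _) rep) (ext_sym_rel scale b' a') y" "expand y = h' (coord_form X)"
    using induced_map_coset[OF models_symbol_rep ext_sym_rel_kernel models_symbol_rep ext_sym_rel_kernel,
        of b a h b' a' h' X] X h unfolding Y_def ext_sym_def by (auto simp: carr_symbol_rep)
  then show "Y \<in> carr (ext_sym scale b' a')" "coord_form Y = h' (coord_form X)"
    by (auto simp: ext_sym_def carr_quot[OF models_symbol_rep ext_sym_rel_kernel]
        quot_fun_coset[OF models_symbol_rep ext_sym_rel_kernel])
qed

lemma keys_koszul_symbol:
  assumes "Poly_Mapping.keys y \<subseteq> symbols b a"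
  shows "Poly_Mapping.keys (lin_ext koszul_symbol y) \<subseteq> symbols (b - 1) (a + 1)"
proof -
  let ?S = "{f. Poly_Mapping.keys f \<subseteq> symbols (b - 1) (a + 1)}"
  have "lin_ext koszul_symbol y \<in> ?S"
  proof (rule lin_in_subspace[OF lin_lin_ext subspace_keys])
    fix s assume "s \<in> Poly_Mapping.keys y"
    then have s: "s \<in> symbols b a" using assms by blast
    obtain xs ys where xy: "s = (xs, ys)" by (cases s)
    have "(remove_nth i xs, xs ! i # ys) \<in> symbols (b - 1) (a + 1)" if "i < length xs" for i
      using s that by (auto simp: xy symbols_def remove_nth_def)
    then show "lin_ext koszul_symbol (basis_vec s) \<in> ?S"
      unfolding lin_ext_basis xy koszul_symbol_def case_prod_conv
      by (intro free.subspace_sum[OF subspace_keys] free.subspace_scale[OF subspace_keys]) auto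
  qed
  then show ?thesis by simp
qed

lemma keys_phi_symbol:
  assumes "Poly_Mapping.keys y \<subseteq> symbols b a"
  shows "Poly_Mapping.keys (lin_ext phi_symbol y) \<subseteq> symbols (b + 1) (a - 1)"
proof -
  let ?S = "{f. Poly_Mapping.keys f \<subseteq> symbols (b + 1) (a - 1)}"
  have "lin_ext phi_symbol y \<in> ?S"
  proof (rule lin_in_subspace[OF lin_lin_ext subspace_keys])
    fix s assume "s \<in> Poly_Mapping.keys y"
    then have s: "s \<in> symbols b a" using assms by blast
    obtain xs ys where xy: "s = (xs, ys)" by (cases s)
    have "(xs @ [ys ! i], remove_nth i ys) \<in> symbols (b + 1) (a - 1)" if "i < length ys" for i
      using s that by (auto simp: xy symbols_def remove_nth_def)
    then show "lin_ext phi_symbol (basis_vec s) \<in> ?S"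
      unfolding lin_ext_basis xy phi_symbol_def case_prod_conv
      by (intro free.subspace_sum[OF subspace_keys]) auto
  qed
  then show ?thesis by simp
qed

lemma coord_form_koszul:
  assumes "X \<in> carr (ext_sym scale b a)"
  shows "koszul scale a b X \<in> carr (ext_sym scale (b - 1) (a + 1))"
    "coord_form (koszul scale a b X) = koszul_form n (coord_form X)"
  unfolding koszul_def
  by (rule coord_form_induced_map[where h = "lin_ext koszul_symbol" and h' = "koszul_form n", OF assms];
      simp add: expand_koszul keys_koszul_symbol)+

lemma coord_form_phi:
  assumes "X \<in> carr (ext_sym scale b a)"
  shows "phi scale b a X \<in> carr (ext_sym scale (b + 1) (a - 1))"
    "coord_form (phi scale b a X) = deriv_form n (coord_form X)"
  unfolding phi_def
  by (rule coord_form_induced_map[where h = "lin_ext phi_symbol" and h' = "deriv_form n", OF assms];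
      simp add: expand_phi keys_phi_symbol)+

text \<open>
  For \<open>a \<le> 0\<close> the hook module is zero by convention.  This agrees with the kernel of the Koszul map,
  which by exactness is the image of a space of forms of negative symmetric degree.
\<close>

lemma carr_hook:
  assumes "a + b > 0"
  shows "carr (hook scale a b) = {X \<in> carr (ext_sym scale b a). coord_form X \<in> cycles n b a}"
proof (cases "a \<le> 0")
  case True
  have "X = zer (ext_sym scale b a)" if X: "X \<in> carr (ext_sym scale b a)" "coord_form X \<in> cycles n b a" for X
  proof -
    have "koszul_homotopy (coord_form X) = 0"
      using cycles_exact(2)[OF X(2) assms] True by (intro forms_neg) auto
    then have "coord_form X = 0" using cycles_exact(1)[OF X(2) assms] by simp
    then show ?thesis using X coord_form_eq_0_iff by blast
  qed
  moreover have "0 \<in> cycles n b a" using free.subspace_0[OF subspace_cycles] .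
  ultimately show ?thesis using True models_zer[OF models_ext_sym]
    by (auto simp: hook_def sub_rep_def)
next
  case False
  have "koszul scale a b X = zer (ext_sym scale (b - 1) (a + 1)) \<longleftrightarrow> coord_form X \<in> cycles n b a"
    if X: "X \<in> carr (ext_sym scale b a)" for X
    using coord_form_koszul[OF X] coord_form_eq_0_iff coord_form_forms[OF X] by (simp add: cycles_def)
  then show ?thesis using False by (auto simp: hook_def sub_rep_def)
qed

lemma gl_cycles: "g \<in> G \<Longrightarrow> f \<in> cycles n b a \<Longrightarrow> gl g f \<in> cycles n b a"
  using koszul_gl[OF G_linear] gl_forms by (auto simp: cycles_def)

lemma models_hook:
  assumes "a + b > 0" shows "models G (hook scale a b) gl coord_form"
proof -
  have "hook scale a b = sub_rep (ext_sym scale b a) (carr (hook scale a b))"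
    by (simp add: hook_def sub_rep_def)
  moreover have "models G (sub_rep (ext_sym scale b a) (carr (hook scale a b))) gl coord_form"
    by (rule models_sub[OF models_ext_sym subspace_cycles gl_cycles carr_hook[OF assms]])
  ultimately show ?thesis by simp
qed

lemma inj_hook: "a + b > 0 \<Longrightarrow> inj_on coord_form (carr (hook scale a b))"
  by (rule inj_on_subset[OF inj_coord_form]) (auto simp: carr_hook)

lemma hook_image: "a + b > 0 \<Longrightarrow> coord_form ` carr (hook scale a b) = cycles n b a"
  using coord_form_image[of b a] by (auto simp: carr_hook cycles_def image_iff)

lemma zer_hook: "zer (hook scale a b) = zer (ext_sym scale b a)"
  by (simp add: hook_def sub_rep_def)

context
  fixes p m q :: nat
  assumes p: "CHAR('k) = p" "p > 0" and m: "m = p * q" "m > 0"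
begin

lemma carr_N: "carr (N_module scale m i) = {X \<in> carr (ext_sym scale i (int m - i)). coord_form X \<in> cycles n i (int m - i)}"
  unfolding N_module_def using m by (intro carr_hook) simp

lemma deriv_cycles:
  fixes f :: "'k wform"
  assumes "f \<in> cycles n b a" "a + b = int m"
  shows "deriv_form n f \<in> cycles n (b + 1) (a - 1)"
proof -
  have "of_nat (nat (a + b)) = (0 :: 'k)" using p m assms(2) by (simp add: of_nat_eq_0_iff_char_dvd)
  then show ?thesis
    using koszul_deriv_forms[of f n b a] assms deriv_form_forms[of f n b a]
    by (auto simp: cycles_def lin_zero lin_intros)
qed

lemma koszul_deriv_char:
  fixes f :: "'k wform"
  assumes "f \<in> forms n b a" "a + b = int m"
  shows "koszul_form n (deriv_form n f) = - deriv_form n (koszul_form n f)"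
proof -
  have "of_nat (nat (a + b)) = (0 :: 'k)" using p m assms(2) by (simp add: of_nat_eq_0_iff_char_dvd)
  then show ?thesis
    using koszul_deriv_forms[of f n b a] assms by (simp add: eq_neg_iff_add_eq_0)
qed

text \<open>
  The preimage \<open>Y\<close> in the definition of the differential exists by exactness of the Koszul complex, and
  \<open>\<kappa>\<phi>Y = -\<phi>\<kappa>Y = -\<phi>X\<close> depends on \<open>X\<close> only.
\<close>

lemma coord_form_N_diff:
  assumes X: "X \<in> carr (N_module scale m i)"
  shows "N_diff scale m i X \<in> carr (N_module scale m (i + 1))"
    "coord_form (N_diff scale m i X) = - deriv_form n (coord_form X)"
proof -
  let ?a = "int m - i - 1"
  let ?P = "\<lambda>Z. \<exists>Y\<in>carr (ext_sym scale (i + 1) ?a). X = koszul scale ?a (i + 1) Y \<and>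
     Z = koszul scale (int m - i - 2) (i + 2) (phi scale (i + 1) ?a Y)"
  have X1: "X \<in> carr (ext_sym scale i (int m - i))" "coord_form X \<in> cycles n i (int m - i)"
    using X carr_N by auto
  have PD: "Z \<in> carr (ext_sym scale (i + 1) ?a)" "coord_form Z = - deriv_form n (coord_form X)" if "?P Z" for Z
  proof -
    obtain Y where Y: "Y \<in> carr (ext_sym scale (i + 1) ?a)" "X = koszul scale ?a (i + 1) Y"
      "Z = koszul scale (int m - i - 2) (i + 2) (phi scale (i + 1) ?a Y)" using \<open>?P Z\<close> by blast
    have 1: "phi scale (i + 1) ?a Y \<in> carr (ext_sym scale (i + 2) (int m - i - 2))"
      using coord_form_phi(1)[OF Y(1)] by (simp add: algebra_simps)
    show "Z \<in> carr (ext_sym scale (i + 1) ?a)"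
      using coord_form_koszul(1)[OF 1] Y(3) by (simp add: algebra_simps)
    have "coord_form Z = koszul_form n (deriv_form n (coord_form Y))"
      using coord_form_koszul(2)[OF 1] coord_form_phi(2)[OF Y(1)] Y(3) by simp
    also have "\<dots> = - deriv_form n (koszul_form n (coord_form Y))"
      using coord_form_forms[OF Y(1)] by (rule koszul_deriv_char) simp
    also have "koszul_form n (coord_form Y) = coord_form X"
      using coord_form_koszul(2)[OF Y(1)] Y(2) by simp
    finally show "coord_form Z = - deriv_form n (coord_form X)" .
  qed
  have "\<exists>Z. ?P Z"
  proof -
    have pos: "int m - i + i > 0" using m by simp
    have "koszul_homotopy (coord_form X) \<in> coord_form ` carr (ext_sym scale (i + 1) ?a)"
      using cycles_exact(2)[OF X1(2) pos] coord_form_image by simp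
    then obtain Y where Y: "Y \<in> carr (ext_sym scale (i + 1) ?a)" "coord_form Y = koszul_homotopy (coord_form X)" by auto
    have "koszul scale ?a (i + 1) Y \<in> carr (ext_sym scale i (int m - i))"
      using coord_form_koszul(1)[OF Y(1)] by simp
    moreover have "coord_form (koszul scale ?a (i + 1) Y) = coord_form X"
      using coord_form_koszul(2)[OF Y(1)] Y(2) cycles_exact(1)[OF X1(2) pos] by simp
    ultimately have "X = koszul scale ?a (i + 1) Y"
      using inj_onD[OF inj_coord_form] X1(1) by metis
    then show ?thesis using Y(1) by blast
  qed
  moreover have "Z = Z'" if "?P Z" "?P Z'" for Z Z'
    using PD[OF that(1)] PD[OF that(2)] inj_onD[OF inj_coord_form] by metis
  ultimately have "\<exists>!Z. ?P Z" by (rule ex_ex1I)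
  then have "?P (THE Z. ?P Z)" by (rule theI')
  then have P: "?P (N_diff scale m i X)" unfolding N_diff_def .
  show "coord_form (N_diff scale m i X) = - deriv_form n (coord_form X)" using PD[OF P] by blast
  moreover have "deriv_form n (coord_form X) \<in> cycles n (i + 1) ?a"
    using deriv_cycles[OF X1(2)] by simp
  ultimately show "N_diff scale m i X \<in> carr (N_module scale m (i + 1))"
    using PD(1)[OF P] free.subspace_neg[OF subspace_cycles]
    by (auto simp: carr_N algebra_simps)
qed

text \<open>
  A cocycle killed by the Cartier operator is \<open>\<phi>\<close> of its image under \<open>deriv_homotopy\<close>, which again lies
  in the kernel of the Koszul map, so that the cocycle is a
  coboundary of the complex.  Conversely, a cycle \<open>u\<close> in degree \<open>m/p\<close> is
  the image of the cocycle \<open>dilate p u\<close>.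
\<close>

lemma cohomology_models:
  fixes i :: int
  defines "H \<equiv> cohomology (N_module scale m) (N_diff scale m) i"
  shows "\<exists>f. models G H (gl_twisted p) f \<and> inj_on f (carr H) \<and> f ` carr H = cycles n i (int q - i)"
proof -
  let ?N = "N_module scale m i"
  define Z where "Z = {X \<in> carr ?N. N_diff scale m i X = zer (N_module scale m (i + 1))}"
  let ?B = "N_diff scale m (i - 1) ` carr (N_module scale m (i - 1))"
  let ?f = "\<lambda>X. cartier p (coord_form X)"
  have N: "models G ?N gl coord_form"
    unfolding N_module_def using m by (intro models_hook) simp
  have injN: "inj_on coord_form (carr ?N)"
    unfolding N_module_def using m by (intro inj_hook) simp
  have imN: "coord_form ` carr (N_module scale m j) = cycles n j (int m - j)" for j
    unfolding N_module_def using m by (intro hook_image) simp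
  have qm: "int p * int q - i = int m - i" using m by simp
  have Z: "Z = {X \<in> carr ?N. coord_form X \<in> {f. deriv_form n f = 0}}"
  proof -
    have "N_diff scale m i X = zer (N_module scale m (i + 1)) \<longleftrightarrow> deriv_form n (coord_form X) = 0"
      if "X \<in> carr ?N" for X
    proof -
      have "N_diff scale m i X \<in> carr (ext_sym scale (i + 1) (int m - (i + 1)))"
        using coord_form_N_diff(1)[OF that] carr_N by blast
      then show ?thesis
        using coord_form_eq_0_iff coord_form_N_diff(2)[OF that] by (simp add: N_module_def zer_hook)
    qed
    then show ?thesis by (auto simp: Z_def)
  qed
  have ZN: "X \<in> carr ?N" "coord_form X \<in> forms n i (int m - i)" "koszul_form n (coord_form X) = 0"
    "deriv_form n (coord_form X) = 0" if "X \<in> Z" for X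
    using that imN[of i] by (auto simp: Z cycles_def)
  have mZ: "models G (sub_rep ?N Z) gl coord_form"
  proof (rule models_sub[OF N _ _ Z])
    show "free.subspace {f :: 'k wform. deriv_form n f = 0}" by (simp add: free.subspace_def)
    fix g X assume g: "g \<in> G" and X: "X \<in> carr ?N" "coord_form X \<in> {f. deriv_form n f = 0}"
    then have "X \<in> Z" by (simp add: Z)
    from deriv_gl[OF G_linear[OF g] ZN(2)[OF this]] X show "gl g (coord_form X) \<in> {f. deriv_form n f = 0}"
      by simp
  qed
  have mf: "models G (sub_rep ?N Z) (gl_twisted p) ?f"
  proof (rule models_comp[OF mZ])
    show "lin (cartier p)" by (rule lin_intros)
    fix g X assume "g \<in> G" "X \<in> carr (sub_rep ?N Z)"
    then show "cartier p (gl g (coord_form X)) = gl_twisted p g (cartier p (coord_form X))"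
      using cartier_gl[OF G_linear p ZN(2,4)] by (simp add: sub_rep_def)
  qed
  have B: "?B = {X \<in> carr (sub_rep ?N Z). ?f X = 0}"
  proof (intro equalityI subsetI)
    fix X assume "X \<in> ?B"
    then obtain Y where Y: "Y \<in> carr (N_module scale m (i - 1))" "X = N_diff scale m (i - 1) Y" by blast
    have "X \<in> carr ?N" "coord_form X = - deriv_form n (coord_form Y)"
      using coord_form_N_diff[OF Y(1)] Y(2) by auto
    then show "X \<in> {X \<in> carr (sub_rep ?N Z). ?f X = 0}"
      by (simp add: sub_rep_def Z cartier_deriv[OF p(1)])
  next
    fix X assume "X \<in> {X \<in> carr (sub_rep ?N Z). ?f X = 0}"
    then have X: "X \<in> Z" "?f X = 0" by (auto simp: sub_rep_def)
    have e: "coord_form X = deriv_form n (deriv_homotopy (coord_form X))"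
      using closed_decomposition[OF p ZN(2,4)[OF X(1)]] X(2) by simp
    have "koszul_form n (deriv_homotopy (coord_form X)) = 0"
      by (simp add: deriv_homotopy_koszul ZN(3)[OF X(1)] lin_zero lin_intros)
    moreover have "int m - i + 1 = int m - (i - 1)" by simp
    ultimately have "deriv_homotopy (coord_form X) \<in> cycles n (i - 1) (int m - (i - 1))"
      using deriv_homotopy_forms[OF ZN(2)[OF X(1)]] by (simp only: cycles_def mem_Collect_eq)
    then have "- deriv_homotopy (coord_form X) \<in> cycles n (i - 1) (int m - (i - 1))"
      by (rule free.subspace_neg[OF subspace_cycles])
    then obtain Y where Y: "Y \<in> carr (N_module scale m (i - 1))" "- deriv_homotopy (coord_form X) = coord_form Y"
      unfolding imN[symmetric] by (auto elim: imageE)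
    have "coord_form (N_diff scale m (i - 1) Y) = coord_form X" "N_diff scale m (i - 1) Y \<in> carr ?N"
      using coord_form_N_diff[OF Y(1)] e by (simp_all flip: Y(2))
    then have "X = N_diff scale m (i - 1) Y"
      using inj_onD[OF injN] ZN(1)[OF X(1)] by metis
    then show "X \<in> ?B" using Y(1) by blast
  qed
  have H: "H = quot_rep (sub_rep ?N Z) ?B"
    by (simp add: H_def cohomology_def Z_def)
  have "?f ` Z = cycles n i (int q - i)"
  proof (intro equalityI subsetI)
    fix u assume "u \<in> ?f ` Z"
    then obtain X where X: "X \<in> Z" "u = cartier p (coord_form X)" by blast
    have "coord_form X \<in> forms n i (int p * int q - i)" using ZN(2)[OF X(1)] qm by simp
    then have "cartier p (coord_form X) \<in> forms n i (int q - i)" using cartier_forms p(2) by blast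
    moreover have "koszul_form n (cartier p (coord_form X)) = 0"
      using cartier_koszul[of p n "coord_form X"] ZN(3)[OF X(1)] by simp
    ultimately show "u \<in> cycles n i (int q - i)" by (simp add: cycles_def X(2))
  next
    fix u :: "'k wform" assume u: "u \<in> cycles n i (int q - i)"
    have "dilate p u \<in> forms n i (int m - i)"
      using dilate_forms[of u n i "int q" p] u p(2) qm by (simp add: cycles_def)
    moreover have "koszul_form n (dilate p u) = 0"
      using dilate_koszul[of p n u] u by (simp add: cycles_def)
    ultimately have "dilate p u \<in> cycles n i (int m - i)" by (simp add: cycles_def)
    then obtain X where X: "X \<in> carr ?N" "dilate p u = coord_form X"
      unfolding imN[symmetric] by (auto elim: imageE)
    then have "X \<in> Z" by (simp add: Z deriv_dilate[OF p(1)] flip: X(2))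
    moreover have "?f X = u" using p(2) by (simp flip: X(2))
    ultimately show "u \<in> ?f ` Z" by blast
  qed
  then have "quot_fun ?f ` carr H = cycles n i (int q - i)"
    unfolding H quot_fun_image[OF mf B] by (simp add: sub_rep_def)
  then show ?thesis
    using models_quot[OF mf B] quot_fun_inj[OF mf B] unfolding H by blast
qed

text \<open>
  The image of the Frobenius twist contains every \<open>\<kappa>(e)\<close>, \<open>e\<close> a basis form, because the coordinates
  of this vector lie in the prime field and are fixed by the Frobenius map.  By exactness of the
  Koszul complex these vectors span all cycles.
\<close>

lemma twist_models:
  fixes i :: int
  defines "W \<equiv> hook scale (int q - i) i"
  defines "T \<equiv> frobenius_twist p W"
  shows "\<exists>f. models G T (gl_twisted p) f \<and> inj_on f (carr T) \<and> f ` carr T = cycles n i (int q - i)"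
proof -
  have pos: "int q - i + i > 0" using m by auto
  note W = models_hook[OF pos, folded W_def] inj_hook[OF pos, folded W_def]
  note im = hook_image[OF pos, folded W_def]
  let ?t = "twist_fun p coord_form"
  have eb: "coord_form X \<in> cycles n i (int q - i)" if "X \<in> carr W" for X using im that by blast
  have mf: "models G (free_rep (carr W) (act W)) (gl_twisted p) ?t"
  proof (rule models_free[OF W p])
    fix g X assume g: "g \<in> G" and X: "X \<in> carr W"
    have "coord_form X \<in> forms n i (int q - i)" using eb[OF X] by (simp add: cycles_def)
    then show "frob p (gl g (coord_form X)) = gl_twisted p g (frob p (coord_form X))"
      by (rule frob_gl[OF G_linear[OF g] p])
  qed (rule lin_gl_twisted)
  have ker: "fspan (twist_relators p W) = {x \<in> carr (free_rep (carr W) (act W)). ?t x = 0}"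
    by (rule twist_relator_kernel[OF W p])
  have T: "T = quot_rep (free_rep (carr W) (act W)) (fspan (twist_relators p W))"
    unfolding T_def by (rule frobenius_twist_relators)
  have basis: "?t (basis_vec X) = frob p (coord_form X)" for X
    by (rule twist_fun_basis)
  have lin: "lin ?t" by (rule lin_twist_fun)
  have "?t ` {x. Poly_Mapping.keys x \<subseteq> carr W} = cycles n i (int q - i)"
  proof (intro equalityI subsetI)
    fix u assume "u \<in> ?t ` {x. Poly_Mapping.keys x \<subseteq> carr W}"
    then obtain x where x: "Poly_Mapping.keys x \<subseteq> carr W" "u = ?t x" by blast
    show "u \<in> cycles n i (int q - i)"
      unfolding x(2)
    proof (rule lin_in_subspace[OF lin subspace_cycles])
      fix X assume "X \<in> Poly_Mapping.keys x"
      then have "coord_form X \<in> cycles n i (int q - i)" using eb x(1) by blast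
      then show "?t (basis_vec X) \<in> cycles n i (int q - i)"
        using frob_forms[OF p] frob_koszul[OF p, of n "coord_form X"]
        by (auto simp: basis cycles_def frob_zero[OF p])
    qed
  next
    fix u :: "'k wform" assume u: "u \<in> cycles n i (int q - i)"
    let ?v = "koszul_homotopy u"
    note v = cycles_exact[OF u pos]
    define h where "h y = inv_into (carr W) coord_form (koszul_form n (basis_vec y))" for y
    have h: "h y \<in> carr W" "coord_form (h y) = koszul_form n (basis_vec y)" if "y \<in> Poly_Mapping.keys ?v" for y
    proof -
      have "basis_vec y \<in> (forms n (i + 1) (int q - i - 1) :: 'k wform set)"
        using v(2) that by (auto simp: basis_in_forms forms_def)
      then have "koszul_form n (basis_vec y) \<in> (cycles n i (int q - i) :: 'k wform set)"
        using koszul_form_forms by (fastforce simp: cycles_def)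
      then show "h y \<in> carr W" "coord_form (h y) = koszul_form n (basis_vec y)"
        unfolding h_def using im by (auto intro: inv_into_into f_inv_into_f)
    qed
    let ?x = "lin_ext (\<lambda>y. basis_vec (h y)) ?v"
    have x: "?x \<in> {x. Poly_Mapping.keys x \<subseteq> carr W}"
      by (rule lin_in_subspace[OF lin_lin_ext subspace_keys]) (simp add: h)
    have "?t ?x = koszul_form n ?v"
    proof (rule lin_eqI[where A = "\<lambda>v. ?t (lin_ext (\<lambda>y. basis_vec (h y)) v)" and B = "koszul_form n"])
      show "lin (\<lambda>v. ?t (lin_ext (\<lambda>y. basis_vec (h y)) v))"
        unfolding twist_fun_def by (intro lin_intros)
      fix y assume "y \<in> Poly_Mapping.keys ?v"
      then show "?t (lin_ext (\<lambda>y. basis_vec (h y)) (basis_vec y)) = koszul_form n (basis_vec y)"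
        using frob_koszul[OF p, of n "basis_vec y"] by (simp add: basis h frob_basis[OF p])
    qed (rule lin_intros)
    also have "\<dots> = u" by (rule v(1)[symmetric])
    finally show "u \<in> ?t ` {x. Poly_Mapping.keys x \<subseteq> carr W}"
      using x by (rule image_eqI[OF sym])
  qed
  then have "quot_fun ?t ` carr T = cycles n i (int q - i)"
    unfolding T quot_fun_image[OF mf ker] by (simp add: free_rep_def)
  then show ?thesis
    using models_quot[OF mf ker] quot_fun_inj[OF mf ker] unfolding T by blast
qed

lemma cohomology_isomorphic:
  "rep_isomorphic G (cohomology (N_module scale m) (N_diff scale m) i)
     (frobenius_twist p (hook scale (int q - i) i))"
proof -
  let ?H = "cohomology (N_module scale m) (N_diff scale m) i"
  let ?T = "frobenius_twist p (hook scale (int q - i) i)"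
  obtain f where f: "models G ?H (gl_twisted p) f" "inj_on f (carr ?H)" "f ` carr ?H = cycles n i (int q - i)"
    using cohomology_models[of i] by blast
  obtain f' where f': "models G ?T (gl_twisted p) f'" "inj_on f' (carr ?T)" "f' ` carr ?T = cycles n i (int q - i)"
    using twist_models[of i] by blast
  show ?thesis by (rule models_isomorphic[OF f(1,2) f'(1,2)]) (simp add: f(3) f'(3))
qed

end

end

lemma (in finite_dimensional_vector_space) ex_coordinates:
  "\<exists>n e crd. coordinates scale n e crd"
proof -
  obtain e where e: "bij_betw e {0..<card Basis} Basis"
    using ex_bij_betw_nat_finite[OF finite_Basis] by blast
  let ?crd = "\<lambda>t x. representation Basis x (e t)"
  have mem: "e t \<in> Basis" if "t < card Basis" for t
    using e that by (auto simp: bij_betw_def)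
  have "coordinates scale (card Basis) e ?crd"
  proof unfold_locales
    fix x
    have "x = (\<Sum>b\<in>Basis. scale (representation Basis x b) b)"
      using sum_representation_eq[OF independent_Basis _ finite_Basis order_refl] span_Basis by simp
    also have "\<dots> = (\<Sum>t\<in>{0..<card Basis}. scale (?crd t x) (e t))"
      by (rule sum.reindex_bij_betw[OF e, symmetric])
    finally show "x = (\<Sum>t<card Basis. scale (?crd t x) (e t))"
      by (simp add: atLeast0LessThan)
  next
    fix s t assume st: "s < card Basis" "t < card Basis"
    then have "e t = e s \<longleftrightarrow> s = t"
      using e by (auto simp: bij_betw_def inj_on_def)
    then show "?crd t (e s) = (if s = t then 1 else 0)"
      using mem st by (simp add: representation_basis[OF independent_Basis])
  qed (simp_all add: representation_add[OF independent_Basis] representation_scale[OF independent_Basis] span_Basis)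
  then show ?thesis by blast
qed

theorem theorem3p21:
  fixes scale :: "'k::field \<Rightarrow> 'v::ab_group_add \<Rightarrow> 'v"
    and Basis :: "'v set"
    and p m i :: nat
  assumes "finite_dimensional_vector_space scale Basis"
    and "CHAR('k) = p" and "p > 0"
    and "m > 0" and "p dvd m"
  shows "rep_isomorphic (GL scale)
           (cohomology (N_module scale m) (N_diff scale m) (int i))
           (frobenius_twist p (hook scale (int (m div p) - int i) (int i)))"
proof -
  obtain n e crd where "coordinates scale n e crd"
    using finite_dimensional_vector_space.ex_coordinates[OF assms(1)] by blast
  then interpret coordinates scale n e crd .
  show ?thesis
    by (rule cohomology_isomorphic[OF assms(2,3) _ assms(4)]) (use assms(5) in simp)
qed

end
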